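(* Let $\mathcal N$ be a single-qubit quantum channel with contraction coefficient $c(\mathcal N)<\frac13$. There are constants $C,\kappa>0$ and $n_0$, depending only on $\mathcal N$, such that the following holds for every $n\ge n_0$ and every depth $L\ge1$. Consider a one-dimensional noisy brickwall circuit on $n$ qubits, whose layers are $\Phi_\ell=\mathcal N^{\otimes n}\circ\mathcal U_\ell$, $\ell=1,\dots,L$, where all two-qubit gates are drawn independently from a unitary $2$-design on two qubits; let $\rho_0$ be a product state, $\rho_\ell=\Phi_\ell\circ\cdots\circ\Phi_1(\rho_0)$, and fix an arbitrary cut of the chain into a left part $A$ and a right part $B$. Then, with probability at least $1-L\,e^{-\kappa n}$ over the choice of gates, $$\sup_{\ell\in\{1,\dots,L\}}S_{OE}(\rho_\ell)\le C .$$
   Context: Brickwall circuit: qubits $1,\dots,n$ on a line; $\mathcal U_\ell(\cdot)=U_\ell(\cdot)U_\ell^\dagger$, where $U_\ell$ is a product of two-qubit gates on the disjoint nearest-neighbour pairs $(i,i+1)$ with $i$ odd for odd $\ell$ and $i$ even for even $\ell$ (staggered layers). After each layer the same channel $\mathcal N$ acts on every qubit. Contraction coefficient: any single-qubit channel can be written $\mathcal N(\cdot)=U\mathcal N'(V^\dagger(\cdot)V)U^\dagger$ with $U,V$ single-qubit unitaries and $\mathcal N'\big(\tfrac12(\mathbb I+\vec v\cdot\vec\sigma)\big)=\tfrac12\big(\mathbb I+(D\vec v+\vec t)\cdot\vec\sigma\big)$, where $D=\mathrm{diag}(D_X,D_Y,D_Z)$ is real with entries of the same sign, $\vec t=(t_X,t_Y,t_Z)\in\mathbb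 R^3$, and $\vec\sigma=(X,Y,Z)$ are the Pauli matrices. Then $c(\mathcal N)=\frac13(t_X^2+t_Y^2+t_Z^2+D_X^2+D_Y^2+D_Z^2)$. Operator entanglement entropy across $A\mid B$: if $\rho=\sum_\alpha\lambda_\alpha L_\alpha\otimes R_\alpha$ is an operator Schmidt decomposition ($\lambda_\alpha>0$, $\{L_\alpha\}$ on $A$ and $\{R_\alpha\}$ on $B$ Hilbert-Schmidt orthonormal), then $S_{OE}(\rho)=-\sum_\alpha\lambda_\alpha^2\log_2\lambda_\alpha^2$. *)

theory Defs
  imports "HOL-Probability.Probability" "Jordan_Normal_Form.Schur_Decomposition"
begin

section \<open>Matrices\<close>

definition mtrace :: "complex mat \<Rightarrow> complex" where
  "mtrace A = (\<Sum>i<dim_row A. A $$ (i, i))"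

definition unitary_mat :: "nat \<Rightarrow> complex mat \<Rightarrow> bool" where
  "unitary_mat d U \<longleftrightarrow>
     U \<in> carrier_mat d d \<and> mat_adjoint U * U = 1\<^sub>m d \<and> U * mat_adjoint U = 1\<^sub>m d"

text \<open>The order on \<^typ>\<open>complex\<close> is the one of \<^theory>\<open>HOL-Library.Complex_Order\<close>:
  \<open>0 \<le> z\<close> means that \<open>z\<close> is real and nonnegative. Hence
  positive semidefinite matrices are Hermitian.\<close>

definition pos_semidef :: "nat \<Rightarrow> complex mat \<Rightarrow> bool" where
  "pos_semidef d A \<longleftrightarrow>
     A \<in> carrier_mat d d \<and> (\<forall>v \<in> carrier_vec d. 0 \<le> (A *\<^sub>v v) \<bullet>c v)"

definition density_operator :: "nat \<Rightarrow> complex mat \<Rightarrow> bool" where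
  "density_operator d \<rho> \<longleftrightarrow> pos_semidef d \<rho> \<and> mtrace \<rho> = 1"

definition kron :: "complex mat \<Rightarrow> complex mat \<Rightarrow> complex mat" where
  "kron A B = mat (dim_row A * dim_row B) (dim_col A * dim_col B)
     (\<lambda>(i, j). A $$ (i div dim_row B, j div dim_col B) * B $$ (i mod dim_row B, j mod dim_col B))"

definition product_state :: "nat \<Rightarrow> complex mat \<Rightarrow> bool" where
  "product_state n \<rho> \<longleftrightarrow>
     (\<exists>\<sigma> :: nat \<Rightarrow> complex mat. (\<forall>i \<in> {1..n}. density_operator 2 (\<sigma> i)) \<and>
        \<rho> = foldr (\<lambda>i A. kron (\<sigma> i) A) [1..<n + 1] (1\<^sub>m 1))"


section \<open>Single-qubit channels\<close>

text \<open>\<open>apply_local p N q\<close> is the map \<open>id \<otimes> N \<otimes> id\<close> on operators on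
  \<open>\<complex>\<^sup>p \<otimes> \<complex>\<^sup>2 \<otimes> \<complex>\<^sup>q\<close>, where a basis index is \<open>r = (x * 2 + b) * q + y\<close> with
  \<open>x < p\<close>, \<open>b < 2\<close>, \<open>y < q\<close> (the index convention of \<^const>\<open>kron\<close>): \<open>N\<close> is applied to
  each block obtained by fixing \<open>x, y\<close> on the row side and on the column side.\<close>

definition apply_local ::
    "nat \<Rightarrow> (complex mat \<Rightarrow> complex mat) \<Rightarrow> nat \<Rightarrow> complex mat \<Rightarrow> complex mat" where
  "apply_local p N q X = mat (p * 2 * q) (p * 2 * q)
     (\<lambda>(r, s). N (mat 2 2 (\<lambda>(b, c). X $$ ((r div (2 * q) * 2 + b) * q + r mod q,
                                              (s div (2 * q) * 2 + c) * q + s mod q)))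
               $$ (r div q mod 2, s div q mod 2))"

definition qubit_channel :: "(complex mat \<Rightarrow> complex mat) \<Rightarrow> bool" where
  "qubit_channel N \<longleftrightarrow>
     (\<forall>X \<in> carrier_mat 2 2. N X \<in> carrier_mat 2 2) \<and>
     (\<forall>X \<in> carrier_mat 2 2. \<forall>Y \<in> carrier_mat 2 2. N (X + Y) = N X + N Y) \<and>
     (\<forall>z. \<forall>X \<in> carrier_mat 2 2. N (z \<cdot>\<^sub>m X) = z \<cdot>\<^sub>m N X) \<and>
     (\<forall>X \<in> carrier_mat 2 2. mtrace (N X) = mtrace X) \<and>
     (\<forall>k X. pos_semidef (k * 2) X \<longrightarrow> pos_semidef (k * 2) (apply_local k N 1 X))"

definition pauli_X :: "complex mat" where "pauli_X = mat_of_rows_list 2 [[0, 1], [1, 0]]"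
definition pauli_Y :: "complex mat" where "pauli_Y = mat_of_rows_list 2 [[0, - \<i>], [\<i>, 0]]"
definition pauli_Z :: "complex mat" where "pauli_Z = mat_of_rows_list 2 [[1, 0], [0, - 1]]"

definition bloch :: "real \<Rightarrow> real \<Rightarrow> real \<Rightarrow> complex mat" where
  "bloch x y z = (1 / 2) \<cdot>\<^sub>m (1\<^sub>m 2 + complex_of_real x \<cdot>\<^sub>m pauli_X +
      complex_of_real y \<cdot>\<^sub>m pauli_Y + complex_of_real z \<cdot>\<^sub>m pauli_Z)"

definition normal_form ::
    "(complex mat \<Rightarrow> complex mat) \<Rightarrow> complex mat \<Rightarrow> complex mat \<Rightarrow>
     real \<times> real \<times> real \<Rightarrow> real \<times> real \<times> real \<Rightarrow> bool" where
  "normal_form N U V = (\<lambda>(DX, DY, DZ) (tX, tY, tZ).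
     unitary_mat 2 U \<and> unitary_mat 2 V \<and>
     (DX \<ge> 0 \<and> DY \<ge> 0 \<and> DZ \<ge> 0 \<or> DX \<le> 0 \<and> DY \<le> 0 \<and> DZ \<le> 0) \<and>
     (\<exists>N'. (\<forall>X \<in> carrier_mat 2 2. N X = U * N' (mat_adjoint V * X * V) * mat_adjoint U) \<and>
           (\<forall>x y z. N' (bloch x y z) = bloch (DX * x + tX) (DY * y + tY) (DZ * z + tZ))))"

text \<open>The normal form exists for every channel and the value below is independent of its choice.\<close>

definition contraction_coefficient :: "(complex mat \<Rightarrow> complex mat) \<Rightarrow> real" where
  "contraction_coefficient N = (THE c. \<exists>U V DX DY DZ tX tY tZ.
     normal_form N U V (DX, DY, DZ) (tX, tY, tZ) \<and>
     c = (tX^2 + tY^2 + tZ^2 + DX^2 + DY^2 + DZ^2) / 3)"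


section \<open>Unitary 2-designs\<close>

text \<open>The Borel sigma-algebra of the unitary group, generated by the matrix entries;
  only the space and the measurable sets of this measure are used.\<close>

definition unitary_borel :: "nat \<Rightarrow> complex mat measure" where
  "unitary_borel d = vimage_algebra {U. unitary_mat d U}
     (\<lambda>U. \<lambda>p \<in> {..<d} \<times> {..<d}. U $$ p) (PiM ({..<d} \<times> {..<d}) (\<lambda>_. borel))"

definition haar_unitary :: "nat \<Rightarrow> complex mat measure \<Rightarrow> bool" where
  "haar_unitary d \<mu> \<longleftrightarrow> prob_space \<mu> \<and> sets \<mu> = sets (unitary_borel d) \<and>
     (\<forall>V. unitary_mat d V \<longrightarrow>
        distr \<mu> (unitary_borel d) (\<lambda>U. V * U) = \<mu> \<and> distr \<mu> (unitary_borel d) (\<lambda>U. U * V) = \<mu>)"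

text \<open>The second-moment operator, i.e. the entrywise expectation of
  \<open>(U \<otimes> U) X (U \<otimes> U)\<^sup>\<dagger>\<close>.\<close>

definition twirl2 :: "nat \<Rightarrow> complex mat measure \<Rightarrow> complex mat \<Rightarrow> complex mat" where
  "twirl2 d \<nu> X = mat (d * d) (d * d)
     (\<lambda>p. LINT U|\<nu>. (kron U U * X * mat_adjoint (kron U U)) $$ p)"

text \<open>The Haar probability measure on the unitary group exists and is unique, so that the
  existential quantifier just names it.\<close>

definition unitary_2_design :: "nat \<Rightarrow> complex mat measure \<Rightarrow> bool" where
  "unitary_2_design d \<nu> \<longleftrightarrow> prob_space \<nu> \<and> sets \<nu> = sets (unitary_borel d) \<and>
     (\<exists>\<mu>. haar_unitary d \<mu> \<and> (\<forall>X \<in> carrier_mat (d * d) (d * d). twirl2 d \<nu> X = twirl2 d \<mu> X))"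


section \<open>Noisy brickwall circuits\<close>

text \<open>Qubits are numbered from 1. The site \<open>(l, i)\<close> is the gate of layer \<open>l\<close> on the
  qubits \<open>i\<close>, \<open>i + 1\<close>.\<close>

definition gate_positions :: "nat \<Rightarrow> nat \<Rightarrow> nat list" where
  "gate_positions n l = filter (\<lambda>i. odd i \<longleftrightarrow> odd l) [1..<n]"

definition gate_sites :: "nat \<Rightarrow> nat \<Rightarrow> (nat \<times> nat) set" where
  "gate_sites n L = (SIGMA l : {1..L}. set (gate_positions n l))"

definition circuit_measure ::
    "nat \<Rightarrow> nat \<Rightarrow> complex mat measure \<Rightarrow> (nat \<times> nat \<Rightarrow> complex mat) measure" where
  "circuit_measure n L \<nu> = PiM (gate_sites n L) (\<lambda>_. \<nu>)"

definition embed_gate :: "nat \<Rightarrow> nat \<Rightarrow> complex mat \<Rightarrow> complex mat" where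
  "embed_gate n i G = kron (kron (1\<^sub>m (2 ^ (i - 1))) G) (1\<^sub>m (2 ^ (n - i - 1)))"

definition layer_unitary :: "nat \<Rightarrow> (nat \<times> nat \<Rightarrow> complex mat) \<Rightarrow> nat \<Rightarrow> complex mat" where
  "layer_unitary n g l =
     foldr (\<lambda>i A. embed_gate n i (g (l, i)) * A) (gate_positions n l) (1\<^sub>m (2 ^ n))"

definition noise_layer ::
    "nat \<Rightarrow> (complex mat \<Rightarrow> complex mat) \<Rightarrow> complex mat \<Rightarrow> complex mat" where
  "noise_layer n N \<rho> = fold (\<lambda>i. apply_local (2 ^ (i - 1)) N (2 ^ (n - i))) [1..<n + 1] \<rho>"

primrec circuit_state ::
    "nat \<Rightarrow> (complex mat \<Rightarrow> complex mat) \<Rightarrow> (nat \<times> nat \<Rightarrow> complex mat) \<Rightarrow>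
     complex mat \<Rightarrow> nat \<Rightarrow> complex mat" where
  "circuit_state n N g \<rho>0 0 = \<rho>0"
| "circuit_state n N g \<rho>0 (Suc l) =
     noise_layer n N (layer_unitary n g (Suc l) * circuit_state n N g \<rho>0 l *
       mat_adjoint (layer_unitary n g (Suc l)))"


section \<open>Operator entanglement entropy\<close>

definition hs_orthonormal :: "nat \<Rightarrow> nat \<Rightarrow> (nat \<Rightarrow> complex mat) \<Rightarrow> bool" where
  "hs_orthonormal d r E \<longleftrightarrow> (\<forall>\<alpha><r. E \<alpha> \<in> carrier_mat d d) \<and>
     (\<forall>\<alpha><r. \<forall>\<beta><r. mtrace (mat_adjoint (E \<alpha>) * E \<beta>) = (if \<alpha> = \<beta> then 1 else 0))"

definition operator_schmidt ::
    "nat \<Rightarrow> nat \<Rightarrow> complex mat \<Rightarrow> nat \<Rightarrow> (nat \<Rightarrow> real) \<Rightarrow>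
     (nat \<Rightarrow> complex mat) \<Rightarrow> (nat \<Rightarrow> complex mat) \<Rightarrow> bool" where
  "operator_schmidt dA dB \<rho> r lam E F \<longleftrightarrow>
     (\<forall>\<alpha><r. lam \<alpha> > 0) \<and> hs_orthonormal dA r E \<and> hs_orthonormal dB r F \<and>
     \<rho> = mat (dA * dB) (dA * dB)
           (\<lambda>p. \<Sum>\<alpha><r. complex_of_real (lam \<alpha>) * kron (E \<alpha>) (F \<alpha>) $$ p)"

text \<open>The Schmidt coefficients are unique up to reordering. No normalisation is imposed:
  the sum of their squares is the purity of \<open>\<rho>\<close>, not 1. The cut is between the qubits
  \<open>a\<close> and \<open>a + 1\<close>.\<close>

definition operator_entanglement :: "nat \<Rightarrow> nat \<Rightarrow> complex mat \<Rightarrow> real" where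
  "operator_entanglement n a \<rho> = (THE S. \<exists>r lam E F.
     operator_schmidt (2 ^ a) (2 ^ (n - a)) \<rho> r lam E F \<and>
     S = - (\<Sum>\<alpha><r. (lam \<alpha>)^2 * log 2 ((lam \<alpha>)^2)))"

end

theory Submission
  imports Defs "HOL-Real_Asymp.Real_Asymp"
begin

text \<open>One layer suffices. Averaging a two-qubit gate over a 2-design turns the second moment of the
  noise on its two qubits into \<open>\<alpha> \<cdot> tr \<otimes> tr + \<beta> \<cdot> SWAP\<close> with \<open>\<alpha>, \<beta> \<ge> 0\<close>, and
  \<open>\<alpha> + \<beta> \<le> ((1 + 3c)/2)\<^sup>2 < 1\<close> when \<open>c < 1/3\<close>. As partial traces of states have purity at most 1, the
  expected purity after a layer with \<open>k\<close> gates is at most \<open>4 (\<alpha> + \<beta>)\<^sup>k\<close>, whatever the input state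
  (the factor 4 accounts for at most two qubits without a gate). By Markov's inequality the purity \<open>P\<close> exceeds \<open>1/n\<close> with exponentially
  small probability in each layer, and \<open>S\<close> is at most \<open>1 / ln 2 + 2 n P\<close>, because there are at most
  \<open>4\<^sup>n\<close> Schmidt coefficients and their squares add up to \<open>P\<close>.

  The moments of the 2-design come from the invariance of Haar measure under monomial matrices and
  one rotation. The hypothesis on \<open>c\<close> becomes usable through \<open>1 + 3c = \<Sum> \<parallel>N(E\<^sub>a\<^sub>b)\<parallel>\<^sup>2\<close>, which does not
  depend on the normal form; the normal form itself exists by the singular value decomposition of
  the Bloch matrix with factors that are rotations.\<close>


text \<open>One layer is enough because its estimate holds for an arbitrary density operator as
  input. The state before a layer depends only on the gates of earlier layers, so the fresh gates
  can be averaged with that state held fixed; nothing but positivity and trace 1 is carried through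
  the circuit. The term tr \<otimes> tr is the obstacle: it replaces the state by a reduced state on
  fewer qubits. A reset of the two qubits keeps the dimension, has the same purity as the reduced
  state and commutes with the remaining gates of the layer, so that the induction over these gates
  can be run for all inputs at once. The threshold 1/n is dictated by the term 2 n P of the entropy
  bound; the extra factor n in Markov's inequality is absorbed by the exponential decay of the mean
  purity. A second obstacle is that contraction coefficient and operator entanglement are definite
  descriptions. Each of them is tied to a quantity that is visibly independent of the choice made:
  the Hilbert-Schmidt norm of the channel as a linear map, and the traces of powers of a Gram matrix
  of the state.\<close>

lemma adjoint_dim [simp]:
  "dim_row (mat_adjoint A) = dim_col A" "dim_col (mat_adjoint A) = dim_row A"
  by (simp_all add: mat_adjoint_def)

lemma adjoint_carrier [simp]: "A \<in> carrier_mat m n \<Longrightarrow> mat_adjoint A \<in> carrier_mat n m"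
  by auto

lemma adjoint_index [simp]:
  "i < dim_col A \<Longrightarrow> j < dim_row A \<Longrightarrow> mat_adjoint A $$ (i, j) = cnj (A $$ (j, i))" for A :: "complex mat"
  by (simp add: mat_adjoint_def mat_of_rows_def)

lemma mult_index:
  assumes "A \<in> carrier_mat m n" "B \<in> carrier_mat n k" "i < m" "j < k"
  shows "(A * B) $$ (i, j) = (\<Sum>l<n. A $$ (i, l) * B $$ (l, j))"
  using assms by (auto simp: scalar_prod_def lessThan_atLeast0 intro!: sum.cong)

lemma sum_mult_delta [simp]:
  fixes f :: "'a \<Rightarrow> 'b :: semiring_1"
  assumes "finite A"
  shows "(\<Sum>a\<in>A. f a * (if a = b then 1 else 0)) = (if b \<in> A then f b else 0)"
    and "(\<Sum>a\<in>A. f a * (if b = a then 1 else 0)) = (if b \<in> A then f b else 0)"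
proof -
  have "(\<Sum>a\<in>A. f a * (if a = b then 1 else 0)) = (\<Sum>a\<in>A. if a = b then f a else 0)"
    by (intro sum.cong) auto
  thus "(\<Sum>a\<in>A. f a * (if a = b then 1 else 0)) = (if b \<in> A then f b else 0)"
    using assms by simp
  thus "(\<Sum>a\<in>A. f a * (if b = a then 1 else 0)) = (if b \<in> A then f b else 0)"
    by (simp only: eq_commute[of b])
qed

lemma mtrace_comm:
  assumes "A \<in> carrier_mat m n" "B \<in> carrier_mat n m"
  shows "mtrace (A * B) = mtrace (B * A)"
proof -
  have "mtrace (A * B) = (\<Sum>i<m. \<Sum>l<n. A $$ (i, l) * B $$ (l, i))"
    unfolding mtrace_def using assms by (auto intro!: sum.cong simp: mult_index[OF assms] simp del: index_mult_mat(1))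
  also have "\<dots> = (\<Sum>l<n. \<Sum>i<m. B $$ (l, i) * A $$ (i, l))"
    by (subst sum.swap) (simp add: mult.commute)
  also have "\<dots> = mtrace (B * A)"
    unfolding mtrace_def using assms by (auto intro!: sum.cong simp: mult_index[OF assms(2,1)] simp del: index_mult_mat(1))
  finally show ?thesis .
qed

section \<open>Spectral decomposition\<close>

text \<open>Matrices and families of vectors are plain functions on indices below \<open>D\<close>,
  so that reshaped matrices with flattened index pairs can be used without carrier conditions. In
  \<open>orthonormal_on D r q\<close> the first argument of \<open>q\<close> numbers the vector, the
  second its component.\<close>

definition hermitian_on :: "nat \<Rightarrow> (nat \<Rightarrow> nat \<Rightarrow> complex) \<Rightarrow> bool" where
  "hermitian_on D H \<longleftrightarrow> (\<forall>u<D. \<forall>v<D. H u v = cnj (H v u))"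

definition orthonormal_on :: "nat \<Rightarrow> nat \<Rightarrow> (nat \<Rightarrow> nat \<Rightarrow> complex) \<Rightarrow> bool" where
  "orthonormal_on D r q \<longleftrightarrow>
     (\<forall>\<alpha><r. \<forall>\<beta><r. (\<Sum>u<D. cnj (q \<alpha> u) * q \<beta> u) = (if \<alpha> = \<beta> then 1 else 0))"

lemma hermitian_onD: "hermitian_on D H \<Longrightarrow> u < D \<Longrightarrow> v < D \<Longrightarrow> cnj (H u v) = H v u"
  unfolding hermitian_on_def by metis

lemma hermitian_onI: "(\<And>u v. u < D \<Longrightarrow> v < D \<Longrightarrow> cnj (H u v) = H v u) \<Longrightarrow> hermitian_on D H"
  unfolding hermitian_on_def by metis

text \<open>In a Schur triangular form the eigenvalues stand on the diagonal. If all of them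
  vanished, the form would be strictly upper triangular and tr (A^2) would be 0; for Hermitian A,
  however, tr (A^2) is the sum of the squared moduli of the entries.\<close>

lemma hermitian_nonzero_eigenvalue:
  assumes H: "hermitian_on D H" and nz: "u0 < D" "v0 < D" "H u0 v0 \<noteq> 0"
  obtains e x where "e \<noteq> 0" "\<exists>u<D. x u \<noteq> 0" "\<And>u. u < D \<Longrightarrow> (\<Sum>w<D. H u w * x w) = e * x u"
proof -
  define A where "A = mat D D (\<lambda>(i, j). H i j)"
  have A: "A \<in> carrier_mat D D" by (simp add: A_def)
  from schur_decomposition_exists[OF A]
  obtain B es where B: "B = schur_upper_triangular A es" and es: "char_poly A = (\<Prod>e\<leftarrow>es. [:- e, 1:])"
    by (metis A char_poly_factorized)
  obtain B P Q where BPQ: "schur_decomposition A es = (B, P, Q)" by (metis prod_cases3)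
  from schur_decomposition[OF A es BPQ]
  have sim: "similar_mat_wit A B P Q" and ut: "upper_triangular B" and dg: "diag_mat B = es" by auto
  from similar_mat_witD2[OF A sim] have PQ: "P * Q = 1\<^sub>m D" "Q * P = 1\<^sub>m D" "A = P * B * Q"
    and c: "B \<in> carrier_mat D D" "P \<in> carrier_mat D D" "Q \<in> carrier_mat D D" by auto
  have "\<exists>i<D. B $$ (i, i) \<noteq> 0"
  proof (rule ccontr)
    assume "\<not> ?thesis"
    hence d0: "\<And>i. i < D \<Longrightarrow> B $$ (i, i) = 0" by auto
    have "A * A = P * (B * B) * Q"
    proof -
      have "A * A = P * B * (Q * (P * (B * Q)))"
        unfolding PQ(3) using c by (simp add: assoc_mult_mat[of _ D D _ D _ D])
      also have "Q * (P * (B * Q)) = (Q * P) * (B * Q)" using c by (simp add: assoc_mult_mat[of _ D D _ D _ D])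
      also have "\<dots> = B * Q" using c by (simp add: PQ)
      finally show ?thesis using c by (simp add: assoc_mult_mat[of _ D D _ D _ D])
    qed
    hence "mtrace (A * A) = mtrace (P * (B * B * Q))" using c by (simp add: assoc_mult_mat[of _ D D _ D _ D])
    also have "\<dots> = mtrace (B * B * Q * P)" using c by (intro mtrace_comm[of _ D D]) auto
    also have "B * B * Q * P = B * B * (Q * P)" using c by (simp add: assoc_mult_mat[of _ D D _ D _ D])
    also have "\<dots> = B * B" using c by (simp add: PQ)
    also have "mtrace (B * B) = (\<Sum>i<D. \<Sum>l<D. B $$ (i, l) * B $$ (l, i))"
      unfolding mtrace_def using c by (auto intro!: sum.cong simp: mult_index[OF c(1) c(1)] simp del: index_mult_mat(1))
    also have "\<dots> = 0"
    proof (intro sum.neutral ballI)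
      fix i l assume "i \<in> {..<D}" "l \<in> {..<D}"
      thus "B $$ (i, l) * B $$ (l, i) = 0"
        using ut c d0 unfolding upper_triangular_def by (cases i l rule: linorder_cases) auto
    qed
    finally have "mtrace (A * A) = 0" .
    moreover have "mtrace (A * A) = (\<Sum>i<D. \<Sum>l<D. A $$ (i, l) * A $$ (l, i))"
      unfolding mtrace_def using A by (auto intro!: sum.cong simp: mult_index[OF A A] simp del: index_mult_mat(1))
    moreover have "\<dots> = (\<Sum>i<D. \<Sum>l<D. complex_of_real ((cmod (H i l))\<^sup>2))"
    proof (intro sum.cong refl)
      fix i l assume "i \<in> {..<D}" "l \<in> {..<D}"
      thus "A $$ (i, l) * A $$ (l, i) = complex_of_real ((cmod (H i l))\<^sup>2)"
        using hermitian_onD[OF H, of i l] unfolding A_def by (simp add: complex_norm_square del: of_real_power)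
    qed
    ultimately have "complex_of_real (\<Sum>i<D. \<Sum>l<D. (cmod (H i l))\<^sup>2) = 0" by simp
    hence "(\<Sum>i<D. \<Sum>l<D. (cmod (H i l))\<^sup>2) = 0" by (simp only: of_real_eq_0_iff)
    hence "\<forall>i<D. \<forall>l<D. (cmod (H i l))\<^sup>2 = 0"
      by (subst (asm) sum_nonneg_eq_0_iff) (auto simp: sum_nonneg sum_nonneg_eq_0_iff)
    with nz show False by auto
  qed
  then obtain i where i: "i < D" "B $$ (i, i) \<noteq> 0" by auto
  have "B $$ (i, i) \<in> set es" unfolding dg[symmetric] diag_mat_def using i c by auto
  moreover have "poly (\<Prod>e\<leftarrow>fs. [:- e, 1:]) x = 0" if "x \<in> set fs" for x :: complex and fs
    using that by (induction fs) auto
  ultimately have "poly (char_poly A) (B $$ (i, i)) = 0" unfolding es by blast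
  hence "eigenvalue A (B $$ (i, i))" by (simp add: eigenvalue_root_char_poly[OF A])
  then obtain v where v: "eigenvector A v (B $$ (i, i))" unfolding eigenvalue_def by auto
  hence vc: "v \<in> carrier_vec D" and v0: "v \<noteq> 0\<^sub>v D" and ev: "A *\<^sub>v v = B $$ (i, i) \<cdot>\<^sub>v v"
    using A unfolding eigenvector_def by auto
  show thesis
  proof (rule that[of "B $$ (i, i)" "\<lambda>u. v $ u"])
    show "\<exists>u<D. v $ u \<noteq> 0"
    proof (rule ccontr)
      assume "\<not> ?thesis"
      hence "v = 0\<^sub>v D" using vc by (intro eq_vecI) auto
      with v0 show False by simp
    qed
    fix u assume u: "u < D"
    have "(A *\<^sub>v v) $ u = (\<Sum>w<D. H u w * v $ w)"
      using u vc by (auto simp: A_def scalar_prod_def lessThan_atLeast0 intro!: sum.cong)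
    with ev u vc show "(\<Sum>w<D. H u w * v $ w) = B $$ (i, i) * v $ u" by simp
  qed (use i in auto)
qed

lemma orthonormal_projection:
  assumes "orthonormal_on D r q"
  defines "Pj \<equiv> \<lambda>u v. \<Sum>\<alpha><r. q \<alpha> u * cnj (q \<alpha> v)"
  shows "(\<Sum>w<D. Pj u w * Pj w v) = Pj u v"
proof -
  have "(\<Sum>w<D. Pj u w * Pj w v) = (\<Sum>w<D. \<Sum>\<alpha><r. \<Sum>\<beta><r. q \<alpha> u * cnj (q \<beta> v) * (cnj (q \<alpha> w) * q \<beta> w))"
    unfolding Pj_def sum_product by (simp only: mult_ac)
  also have "\<dots> = (\<Sum>\<alpha><r. \<Sum>\<beta><r. \<Sum>w<D. q \<alpha> u * cnj (q \<beta> v) * (cnj (q \<alpha> w) * q \<beta> w))"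
    by (subst sum.swap, rule sum.cong[OF refl], rule sum.swap)
  also have "\<dots> = (\<Sum>\<alpha><r. \<Sum>\<beta><r. q \<alpha> u * cnj (q \<beta> v) * (if \<alpha> = \<beta> then 1 else 0))"
    using assms(1) by (intro sum.cong refl) (simp add: orthonormal_on_def flip: sum_distrib_left)
  also have "\<dots> = Pj u v" unfolding Pj_def by simp
  finally show ?thesis .
qed

text \<open>The trace of the projection onto the span is computed in two ways: it is
  \<open>r\<close> by normalization, and at most \<open>D\<close> because every diagonal entry is at
  most 1, which is Bessel's inequality for a standard basis vector.\<close>

lemma orthonormal_card_le:
  assumes q: "orthonormal_on D r q"
  shows "r \<le> D"
proof -
  define Pj where "Pj = (\<lambda>u v. \<Sum>\<alpha><r. q \<alpha> u * cnj (q \<alpha> v))"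
  have cnjPj: "cnj (Pj u v) = Pj v u" for u v unfolding Pj_def by (simp add: mult.commute)
  have diag: "Pj v v = complex_of_real (\<Sum>\<alpha><r. (cmod (q \<alpha> v))\<^sup>2)" for v
    unfolding Pj_def by (simp add: complex_norm_square del: of_real_power)
  have le1: "(\<Sum>\<alpha><r. (cmod (q \<alpha> v))\<^sup>2) \<le> 1" if v: "v < D" for v
  proof -
    \<comment> \<open>The part of the v-th standard basis vector orthogonal to the span; its squared
      norm is 1 - \<open>Pj v v\<close>.\<close>
    let ?y = "\<lambda>u. (if u = v then 1 else 0) - Pj u v"
    have "complex_of_real (\<Sum>u<D. (cmod (?y u))\<^sup>2) = (\<Sum>u<D. ?y u * cnj (?y u))"
      by (simp only: of_real_sum complex_norm_square)
    also have "\<dots> = (\<Sum>u<D. (if u = v then 1 - Pj u v - Pj v u else 0) + Pj v u * Pj u v)"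
      by (intro sum.cong refl) (auto simp: cnjPj algebra_simps)
    also have "\<dots> = 1 - Pj v v - Pj v v + Pj v v"
      using v orthonormal_projection[OF q, of v v] by (simp add: sum.distrib Pj_def)
    also have "\<dots> = complex_of_real (1 - (\<Sum>\<alpha><r. (cmod (q \<alpha> v))\<^sup>2))" by (simp add: diag)
    finally have "(\<Sum>u<D. (cmod (?y u))\<^sup>2) = 1 - (\<Sum>\<alpha><r. (cmod (q \<alpha> v))\<^sup>2)"
      by (simp only: of_real_eq_iff)
    moreover have "(\<Sum>u<D. (cmod (?y u))\<^sup>2) \<ge> 0" by (simp add: sum_nonneg)
    ultimately show ?thesis by linarith
  qed
  have norm1: "(\<Sum>u<D. (cmod (q \<alpha> u))\<^sup>2) = 1" if "\<alpha> < r" for \<alpha>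
  proof -
    have "complex_of_real (\<Sum>u<D. (cmod (q \<alpha> u))\<^sup>2) = (\<Sum>u<D. cnj (q \<alpha> u) * q \<alpha> u)"
      by (simp only: of_real_sum complex_norm_square mult.commute)
    also have "\<dots> = complex_of_real 1" using q that by (simp add: orthonormal_on_def)
    finally show ?thesis by (simp only: of_real_eq_iff)
  qed
  have "real r = (\<Sum>\<alpha><r. \<Sum>u<D. (cmod (q \<alpha> u))\<^sup>2)" by (simp add: norm1)
  also have "\<dots> = (\<Sum>u<D. \<Sum>\<alpha><r. (cmod (q \<alpha> u))\<^sup>2)" by (rule sum.swap)
  also have "\<dots> \<le> (\<Sum>u<D. 1)" using le1 by (intro sum_mono) auto
  finally show ?thesis by simp
qed

lemma orthonormal_extend:
  assumes q: "orthonormal_on D r q" and nz: "\<exists>u<D. x u \<noteq> 0"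
    and perp: "\<And>\<alpha>. \<alpha> < r \<Longrightarrow> (\<Sum>u<D. cnj (q \<alpha> u) * x u) = 0"
  obtains c where "orthonormal_on D (Suc r) (q(r := \<lambda>u. complex_of_real c * x u))"
proof -
  define s where "s = (\<Sum>u<D. (cmod (x u))\<^sup>2)"
  have "s > 0"
  proof -
    obtain u where "u < D" "x u \<noteq> 0" using nz by auto
    thus ?thesis unfolding s_def by (intro sum_pos2[of _ u]) auto
  qed
  define c where "c = 1 / sqrt s"
  have c2: "c * c * s = 1" using \<open>s > 0\<close> by (simp add: c_def field_simps)
  have xx: "(\<Sum>u<D. cnj (x u) * x u) = complex_of_real s"
    unfolding s_def by (simp only: of_real_sum complex_norm_square mult.commute)
  have perp': "(\<Sum>u<D. cnj (x u) * q \<alpha> u) = 0" if "\<alpha> < r" for \<alpha>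
  proof -
    have "cnj (\<Sum>u<D. cnj (q \<alpha> u) * x u) = (\<Sum>u<D. cnj (x u) * q \<alpha> u)" by (simp add: mult.commute)
    thus ?thesis using perp[OF that] by simp
  qed
  have "orthonormal_on D (Suc r) (q(r := \<lambda>u. complex_of_real c * x u))"
    unfolding orthonormal_on_def
  proof (intro allI impI)
    fix \<alpha> \<beta> assume ab: "\<alpha> < Suc r" "\<beta> < Suc r"
    let ?q = "q(r := \<lambda>u. complex_of_real c * x u)"
    consider "\<alpha> < r" "\<beta> < r" | "\<alpha> = r" "\<beta> < r" | "\<alpha> < r" "\<beta> = r" | "\<alpha> = r" "\<beta> = r" using ab by linarith
    thus "(\<Sum>u<D. cnj (?q \<alpha> u) * ?q \<beta> u) = (if \<alpha> = \<beta> then 1 else 0)"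
    proof cases
      case 1 thus ?thesis using q by (auto simp: orthonormal_on_def)
    next
      case 2
      have "(\<Sum>u<D. cnj (?q \<alpha> u) * ?q \<beta> u) = complex_of_real c * (\<Sum>u<D. cnj (x u) * q \<beta> u)"
        using 2 by (simp add: sum_distrib_left mult_ac)
      thus ?thesis using 2 perp' by simp
    next
      case 3
      have "(\<Sum>u<D. cnj (?q \<alpha> u) * ?q \<beta> u) = complex_of_real c * (\<Sum>u<D. cnj (q \<alpha> u) * x u)"
        using 3 by (simp add: sum_distrib_left mult_ac)
      thus ?thesis using 3 perp by simp
    next
      case 4
      have "(\<Sum>u<D. cnj (?q \<alpha> u) * ?q \<beta> u) = complex_of_real (c * c) * (\<Sum>u<D. cnj (x u) * x u)"
        using 4 by (simp add: sum_distrib_left mult_ac)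
      also have "\<dots> = complex_of_real (c * c * s)" by (simp only: xx of_real_mult)
      also have "\<dots> = 1" by (simp only: c2 of_real_1)
      finally show ?thesis using 4 by simp
    qed
  qed
  thus thesis by (rule that)
qed

lemma hermitian_eigenvalue_real:
  assumes H: "hermitian_on D H" and nz: "\<exists>u<D. x u \<noteq> 0"
    and ev: "\<And>u. u < D \<Longrightarrow> (\<Sum>w<D. H u w * x w) = e * x u"
  shows "cnj e = e"
proof -
  define s where "s = (\<Sum>u<D. cnj (x u) * x u)"
  have "s = complex_of_real (\<Sum>u<D. (cmod (x u))\<^sup>2)"
    unfolding s_def by (simp only: of_real_sum complex_norm_square mult.commute)
  moreover have "(\<Sum>u<D. (cmod (x u))\<^sup>2) > 0"
  proof -
    obtain u where "u < D" "x u \<noteq> 0" using nz by auto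
    thus ?thesis by (intro sum_pos2[of _ u]) auto
  qed
  ultimately have s: "s \<noteq> 0" "cnj s = s"
    by (simp_all only: of_real_eq_0_iff complex_cnj_complex_of_real less_irrefl not_False_eq_True simp_thms)
  have es: "e * s = (\<Sum>u<D. \<Sum>w<D. cnj (x u) * H u w * x w)"
  proof -
    have "e * s = (\<Sum>u<D. cnj (x u) * (e * x u))" unfolding s_def by (simp add: sum_distrib_left mult_ac)
    also have "\<dots> = (\<Sum>u<D. cnj (x u) * (\<Sum>w<D. H u w * x w))" using ev by (intro sum.cong) auto
    finally show ?thesis by (simp add: sum_distrib_left mult_ac)
  qed
  have Hc: "cnj (H u w) = H w u" if "u < D" "w < D" for u w
    using hermitian_onD[OF H] that by metis
  have "cnj (e * s) = (\<Sum>u<D. \<Sum>w<D. cnj (x w) * H w u * x u)"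
    unfolding es cnj_sum by (intro sum.cong refl) (simp add: mult_ac Hc)
  also have "\<dots> = e * s" unfolding es by (rule sum.swap)
  finally show ?thesis using s by simp
qed

text \<open>A maximal orthonormal family of eigenvectors with nonzero eigenvalues already gives the
  whole matrix. The remainder \<open>H'\<close> annihilates the family, so an eigenvector of
  \<open>H'\<close> with nonzero eigenvalue is orthogonal to the family and hence also an
  eigenvector of \<open>H\<close>, against maximality. Leaving out the kernel makes the coefficients
  of the derived Schmidt decomposition strictly positive, as its definition demands.\<close>

theorem hermitian_spectral:
  assumes H: "hermitian_on D H"
  obtains r q \<mu> where "orthonormal_on D r q" "\<And>\<alpha>. \<alpha> < r \<Longrightarrow> \<mu> \<alpha> \<noteq> (0::real)"
    "\<And>\<alpha> u. \<alpha> < r \<Longrightarrow> u < D \<Longrightarrow> (\<Sum>w<D. H u w * q \<alpha> w) = complex_of_real (\<mu> \<alpha>) * q \<alpha> u"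
    "\<And>u w. u < D \<Longrightarrow> w < D \<Longrightarrow> H u w = (\<Sum>\<alpha><r. complex_of_real (\<mu> \<alpha>) * q \<alpha> u * cnj (q \<alpha> w))"
proof -
  define good where "good = (\<lambda>r q \<mu>. orthonormal_on D r q \<and> (\<forall>\<alpha><r. \<mu> \<alpha> \<noteq> (0::real)) \<and>
    (\<forall>\<alpha><r. \<forall>u<D. (\<Sum>w<D. H u w * q \<alpha> w) = complex_of_real (\<mu> \<alpha>) * q \<alpha> u))"
  define R where "R = {r. \<exists>q \<mu>. good r q \<mu>}"
  have "good 0 (\<lambda>_ _. 0) (\<lambda>_. 0)" by (simp add: good_def orthonormal_on_def)
  hence R0: "0 \<in> R" unfolding R_def by blast
  have "R \<subseteq> {..D}" using orthonormal_card_le unfolding R_def good_def by auto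
  hence fin: "finite R" using finite_subset by blast
  define r where "r = Max R"
  have "r \<in> R" unfolding r_def using fin R0 by (intro Max_in) auto
  then obtain q \<mu> where g: "good r q \<mu>" unfolding R_def by auto
  hence q: "orthonormal_on D r q" and \<mu>0: "\<And>\<alpha>. \<alpha> < r \<Longrightarrow> \<mu> \<alpha> \<noteq> 0"
    and ev: "\<And>\<alpha> u. \<alpha> < r \<Longrightarrow> u < D \<Longrightarrow> (\<Sum>w<D. H u w * q \<alpha> w) = complex_of_real (\<mu> \<alpha>) * q \<alpha> u"
    unfolding good_def by auto
  define S where "S = (\<lambda>u w. \<Sum>\<alpha><r. complex_of_real (\<mu> \<alpha>) * q \<alpha> u * cnj (q \<alpha> w))"
  define H' where "H' = (\<lambda>u w. H u w - S u w)"
  have Scnj: "cnj (S u w) = S w u" for u w unfolding S_def by (simp add: mult_ac)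
  have H': "hermitian_on D H'"
    unfolding H'_def by (rule hermitian_onI) (simp add: Scnj hermitian_onD[OF H])
  have Sx: "(\<Sum>w<D. S u w * x w) = (\<Sum>\<alpha><r. complex_of_real (\<mu> \<alpha>) * q \<alpha> u * (\<Sum>w<D. cnj (q \<alpha> w) * x w))" for u x
    unfolding S_def sum_distrib_right by (subst sum.swap) (simp add: sum_distrib_left mult_ac)
  have Sq: "(\<Sum>w<D. S u w * q \<beta> w) = complex_of_real (\<mu> \<beta>) * q \<beta> u" if "\<beta> < r" for u \<beta>
  proof -
    have "(\<Sum>w<D. S u w * q \<beta> w) = (\<Sum>\<alpha><r. complex_of_real (\<mu> \<alpha>) * q \<alpha> u * (if \<alpha> = \<beta> then 1 else 0))"
      unfolding Sx using q that by (intro sum.cong) (auto simp: orthonormal_on_def)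
    thus ?thesis using that by simp
  qed
  have H'q: "(\<Sum>w<D. H' u w * q \<beta> w) = 0" if "\<beta> < r" "u < D" for u \<beta>
    using ev[OF that] Sq[OF that(1)] by (simp add: H'_def left_diff_distrib sum_subtractf)
  have Hc: "cnj (H' w u) = H' u w" if "u < D" "w < D" for u w
    using hermitian_onD[OF H'] that by metis
  have zero: "H' u0 v0 = 0" if uv: "u0 < D" "v0 < D" for u0 v0
  proof (rule ccontr)
    assume "H' u0 v0 \<noteq> 0"
    from hermitian_nonzero_eigenvalue[OF H' uv this]
    obtain e x where e: "e \<noteq> 0" and x: "\<exists>u<D. x u \<noteq> 0"
      and ex: "\<And>u. u < D \<Longrightarrow> (\<Sum>w<D. H' u w * x w) = e * x u" by blast
    have "cnj e = e" by (rule hermitian_eigenvalue_real[OF H' x ex])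
    then obtain m where m: "e = complex_of_real m" by (metis Reals_cnj_iff Reals_cases)
    \<comment> \<open>Self-adjointness moves \<open>H'\<close> from \<open>x\<close> to
      \<open>q \<alpha>\<close>, where it gives 0; the factor \<open>e\<close> can be cancelled as
      it is nonzero.\<close>
    have perp: "(\<Sum>u<D. cnj (q \<alpha> u) * x u) = 0" if a: "\<alpha> < r" for \<alpha>
    proof -
      have "e * (\<Sum>u<D. cnj (q \<alpha> u) * x u) = (\<Sum>u<D. cnj (q \<alpha> u) * (e * x u))"
        by (simp add: sum_distrib_left mult_ac)
      also have "\<dots> = (\<Sum>u<D. cnj (q \<alpha> u) * (\<Sum>w<D. H' u w * x w))" using ex by (intro sum.cong) auto
      also have "\<dots> = (\<Sum>u<D. \<Sum>w<D. cnj (H' w u * q \<alpha> u) * x w)"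
        unfolding sum_distrib_left by (intro sum.cong refl) (simp add: mult_ac Hc)
      also have "\<dots> = (\<Sum>w<D. cnj (\<Sum>u<D. H' w u * q \<alpha> u) * x w)"
        by (subst sum.swap) (simp add: sum_distrib_right)
      also have "\<dots> = 0" using H'q[OF a] by simp
      finally show ?thesis using e by simp
    qed
    have Hx: "(\<Sum>w<D. H u w * x w) = complex_of_real m * x u" if "u < D" for u
    proof -
      have "(\<Sum>w<D. S u w * x w) = 0" unfolding Sx using perp by simp
      thus ?thesis using ex[OF that] m by (simp add: H'_def left_diff_distrib sum_subtractf)
    qed
    from orthonormal_extend[OF q x perp]
    obtain c where c: "orthonormal_on D (Suc r) (q(r := \<lambda>u. complex_of_real c * x u))" by blast
    have "good (Suc r) (q(r := \<lambda>u. complex_of_real c * x u)) (\<mu>(r := m))"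
      unfolding good_def
    proof (intro conjI allI impI)
      show "(\<mu>(r := m)) \<alpha> \<noteq> 0" if "\<alpha> < Suc r" for \<alpha> using that \<mu>0 e m by (auto simp: less_Suc_eq)
      fix \<alpha> u assume "\<alpha> < Suc r" "u < D"
      thus "(\<Sum>w<D. H u w * (q(r := \<lambda>u. complex_of_real c * x u)) \<alpha> w) =
        complex_of_real ((\<mu>(r := m)) \<alpha>) * (q(r := \<lambda>u. complex_of_real c * x u)) \<alpha> u"
        using ev Hx[of u] by (cases "\<alpha> = r") (auto simp: less_Suc_eq mult.left_commute simp flip: sum_distrib_left)
    qed (rule c)
    hence "Suc r \<in> R" unfolding R_def by blast
    hence "Suc r \<le> r" unfolding r_def using fin by (simp add: Max_ge)
    thus False by simp
  qed
  show thesis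
    by (rule that[OF q \<mu>0 ev]) (use zero in \<open>auto simp: H'_def S_def\<close>)
qed

lemma sum_div_mod:
  "(\<Sum>u<m * n. f u) = (\<Sum>i<m. \<Sum>j<n. f (i * n + j))" for f :: "nat \<Rightarrow> 'a :: comm_monoid_add"
proof -
  have "(\<Sum>u<m * n. f u) = (\<Sum>i<m. \<Sum>u = i * n..<i * n + n. f u)" by (rule sum.nat_group[symmetric])
  also have "\<dots> = (\<Sum>i<m. \<Sum>j<n. f (i * n + j))"
  proof (rule sum.cong[OF refl])
    fix i
    show "(\<Sum>u = i * n..<i * n + n. f u) = (\<Sum>j<n. f (i * n + j))"
      using sum.shift_bounds_nat_ivl[of f 0 "i * n" n] by (simp add: lessThan_atLeast0 add.commute)
  qed
  finally show ?thesis .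
qed

section \<open>Singular values and the operator Schmidt decomposition\<close>

text \<open>The left singular vectors are the eigenvectors of M M^dagger with nonzero eigenvalue
  \<mu>. The rows \<open>K \<alpha>\<close> of q^dagger M are then orthogonal with squared norm
  \<mu>, and dividing them by sqrt \<mu> gives the right singular vectors.\<close>

theorem singular_value_decomposition:
  fixes M :: "nat \<Rightarrow> nat \<Rightarrow> complex"
  obtains r lam q f where "\<And>\<alpha>. \<alpha> < r \<Longrightarrow> lam \<alpha> > (0::real)"
    "orthonormal_on m r q" "orthonormal_on n r f"
    "\<And>u y. u < m \<Longrightarrow> y < n \<Longrightarrow> M u y = (\<Sum>\<alpha><r. complex_of_real (lam \<alpha>) * q \<alpha> u * f \<alpha> y)"
proof -
  define G where "G = (\<lambda>u v. \<Sum>y<n. M u y * cnj (M v y))"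
  have "hermitian_on m G" unfolding G_def by (rule hermitian_onI) (simp add: mult.commute)
  from hermitian_spectral[OF this] obtain r q \<mu> where q: "orthonormal_on m r q"
    and \<mu>0: "\<And>\<alpha>. \<alpha> < r \<Longrightarrow> \<mu> \<alpha> \<noteq> (0::real)"
    and ev: "\<And>\<alpha> u. \<alpha> < r \<Longrightarrow> u < m \<Longrightarrow> (\<Sum>w<m. G u w * q \<alpha> w) = complex_of_real (\<mu> \<alpha>) * q \<alpha> u"
    and G: "\<And>u w. u < m \<Longrightarrow> w < m \<Longrightarrow> G u w = (\<Sum>\<alpha><r. complex_of_real (\<mu> \<alpha>) * q \<alpha> u * cnj (q \<alpha> w))"
    by blast
  define K where "K \<alpha> y = (\<Sum>u<m. cnj (q \<alpha> u) * M u y)" for \<alpha> y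
  have MK: "(\<Sum>y<n. M u y * cnj (K \<alpha> y)) = complex_of_real (\<mu> \<alpha>) * q \<alpha> u" if "\<alpha> < r" "u < m" for \<alpha> u
  proof -
    have "(\<Sum>y<n. M u y * cnj (K \<alpha> y)) = (\<Sum>y<n. \<Sum>w<m. M u y * cnj (M w y) * q \<alpha> w)"
      unfolding K_def by (simp add: sum_distrib_left mult_ac)
    also have "\<dots> = (\<Sum>w<m. G u w * q \<alpha> w)"
      unfolding G_def by (subst sum.swap) (simp add: sum_distrib_right)
    finally show ?thesis using ev that by simp
  qed
  have KK: "(\<Sum>y<n. K \<beta> y * cnj (K \<alpha> y)) = complex_of_real (\<mu> \<alpha>) * (if \<beta> = \<alpha> then 1 else 0)"
    if "\<alpha> < r" "\<beta> < r" for \<alpha> \<beta>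
  proof -
    have "(\<Sum>y<n. K \<beta> y * cnj (K \<alpha> y)) = (\<Sum>y<n. \<Sum>u<m. cnj (q \<beta> u) * (M u y * cnj (K \<alpha> y)))"
      unfolding K_def[of \<beta>] sum_distrib_right by (simp only: mult_ac)
    also have "\<dots> = (\<Sum>u<m. cnj (q \<beta> u) * (complex_of_real (\<mu> \<alpha>) * q \<alpha> u))"
      using MK[OF that(1)] by (subst sum.swap) (simp flip: sum_distrib_left)
    also have "\<dots> = complex_of_real (\<mu> \<alpha>) * (\<Sum>u<m. cnj (q \<beta> u) * q \<alpha> u)"
      by (simp add: sum_distrib_left mult_ac)
    finally show ?thesis using q that by (simp add: orthonormal_on_def)
  qed
  have \<mu>pos: "\<mu> \<alpha> > 0" if a: "\<alpha> < r" for \<alpha>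
  proof -
    have "complex_of_real (\<Sum>y<n. (cmod (K \<alpha> y))\<^sup>2) = complex_of_real (\<mu> \<alpha>)"
      using KK[OF a a] by (simp add: complex_norm_square del: of_real_power)
    hence "(\<Sum>y<n. (cmod (K \<alpha> y))\<^sup>2) = \<mu> \<alpha>" by (simp only: of_real_eq_iff)
    hence "\<mu> \<alpha> \<ge> 0" by (metis sum_nonneg zero_le_power2)
    thus ?thesis using \<mu>0[OF a] by simp
  qed
  \<comment> \<open>For a fixed row the squared norm of the residual expands into the four sums
    \<open>t1\<close> to \<open>t4\<close>. They all have the same value and cancel, so the residual
    vanishes. This avoids a separate treatment of the kernel of \<open>G\<close>, which the family
    \<open>q\<close> does not span.\<close>
  have M: "M u y = (\<Sum>\<alpha><r. q \<alpha> u * K \<alpha> y)" if u: "u < m" and y: "y < n" for u y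
  proof -
    let ?R = "\<lambda>y. M u y - (\<Sum>\<alpha><r. q \<alpha> u * K \<alpha> y)"
    have t1: "(\<Sum>y<n. M u y * cnj (M u y)) = (\<Sum>\<alpha><r. complex_of_real (\<mu> \<alpha>) * q \<alpha> u * cnj (q \<alpha> u))"
      using G[OF u u] by (simp add: G_def)
    have t2: "(\<Sum>y<n. M u y * cnj (\<Sum>\<alpha><r. q \<alpha> u * K \<alpha> y)) = (\<Sum>\<alpha><r. complex_of_real (\<mu> \<alpha>) * q \<alpha> u * cnj (q \<alpha> u))"
    proof -
      have "(\<Sum>y<n. M u y * cnj (\<Sum>\<alpha><r. q \<alpha> u * K \<alpha> y)) = (\<Sum>y<n. \<Sum>\<alpha><r. cnj (q \<alpha> u) * (M u y * cnj (K \<alpha> y)))"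
        by (simp add: sum_distrib_left mult_ac)
      also have "\<dots> = (\<Sum>\<alpha><r. cnj (q \<alpha> u) * (complex_of_real (\<mu> \<alpha>) * q \<alpha> u))"
        using MK u by (subst sum.swap) (simp flip: sum_distrib_left)
      finally show ?thesis by (simp add: mult_ac)
    qed
    have "cnj (\<Sum>y<n. M u y * cnj (\<Sum>\<alpha><r. q \<alpha> u * K \<alpha> y)) = (\<Sum>y<n. (\<Sum>\<alpha><r. q \<alpha> u * K \<alpha> y) * cnj (M u y))"
      by (simp add: mult_ac)
    hence t3: "(\<Sum>y<n. (\<Sum>\<alpha><r. q \<alpha> u * K \<alpha> y) * cnj (M u y)) = (\<Sum>\<alpha><r. complex_of_real (\<mu> \<alpha>) * q \<alpha> u * cnj (q \<alpha> u))"
      unfolding t2 by (simp add: mult_ac)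
    have t4: "(\<Sum>y<n. (\<Sum>\<alpha><r. q \<alpha> u * K \<alpha> y) * cnj (\<Sum>\<alpha><r. q \<alpha> u * K \<alpha> y)) = (\<Sum>\<alpha><r. complex_of_real (\<mu> \<alpha>) * q \<alpha> u * cnj (q \<alpha> u))"
    proof -
      have "(\<Sum>y<n. (\<Sum>\<alpha><r. q \<alpha> u * K \<alpha> y) * cnj (\<Sum>\<alpha><r. q \<alpha> u * K \<alpha> y)) =
          (\<Sum>y<n. \<Sum>\<beta><r. \<Sum>\<alpha><r. q \<beta> u * cnj (q \<alpha> u) * (K \<beta> y * cnj (K \<alpha> y)))"
        by (simp add: sum_product mult_ac)
      also have "\<dots> = (\<Sum>\<beta><r. \<Sum>\<alpha><r. \<Sum>y<n. q \<beta> u * cnj (q \<alpha> u) * (K \<beta> y * cnj (K \<alpha> y)))"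
        by (subst sum.swap, rule sum.cong[OF refl], rule sum.swap)
      also have "\<dots> = (\<Sum>\<beta><r. \<Sum>\<alpha><r. q \<beta> u * cnj (q \<alpha> u) * complex_of_real (\<mu> \<alpha>) * (if \<beta> = \<alpha> then 1 else 0))"
        using KK by (intro sum.cong refl) (simp flip: sum_distrib_left)
      also have "\<dots> = (\<Sum>\<alpha><r. complex_of_real (\<mu> \<alpha>) * q \<alpha> u * cnj (q \<alpha> u))"
        by (simp only: sum_mult_delta finite_lessThan lessThan_iff if_True cong: sum.cong)
          (simp add: mult_ac)
      finally show ?thesis .
    qed
    have "complex_of_real (\<Sum>y<n. (cmod (?R y))\<^sup>2) = (\<Sum>y<n. ?R y * cnj (?R y))"
      by (simp only: of_real_sum complex_norm_square)
    also have "\<dots> = (\<Sum>y<n. M u y * cnj (M u y) - M u y * cnj (\<Sum>\<alpha><r. q \<alpha> u * K \<alpha> y)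
        - (\<Sum>\<alpha><r. q \<alpha> u * K \<alpha> y) * cnj (M u y) + (\<Sum>\<alpha><r. q \<alpha> u * K \<alpha> y) * cnj (\<Sum>\<alpha><r. q \<alpha> u * K \<alpha> y))"
      by (intro sum.cong refl) (simp only: complex_cnj_diff algebra_simps)
    also have "\<dots> = 0" by (simp only: sum.distrib sum_subtractf t1 t2 t3 t4) simp
    finally have "(\<Sum>y<n. (cmod (?R y))\<^sup>2) = 0" by (simp only: of_real_eq_0_iff)
    hence "?R y = 0" using y by (subst (asm) sum_nonneg_eq_0_iff) auto
    thus ?thesis by simp
  qed
  show thesis
  proof (rule that[of r "\<lambda>\<alpha>. sqrt (\<mu> \<alpha>)" q "\<lambda>\<alpha> y. K \<alpha> y / complex_of_real (sqrt (\<mu> \<alpha>))"])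
    show "orthonormal_on n r (\<lambda>\<alpha> y. K \<alpha> y / complex_of_real (sqrt (\<mu> \<alpha>)))"
      unfolding orthonormal_on_def
    proof (intro allI impI)
      fix \<alpha> \<beta> assume ab: "\<alpha> < r" "\<beta> < r"
      have "(\<Sum>y<n. cnj (K \<alpha> y / complex_of_real (sqrt (\<mu> \<alpha>))) * (K \<beta> y / complex_of_real (sqrt (\<mu> \<beta>)))) =
         (\<Sum>y<n. K \<beta> y * cnj (K \<alpha> y)) / (complex_of_real (sqrt (\<mu> \<alpha>)) * complex_of_real (sqrt (\<mu> \<beta>)))"
        by (simp add: sum_divide_distrib mult_ac)
      also have "\<dots> = (if \<alpha> = \<beta> then 1 else 0)"
        using KK[OF ab] \<mu>pos[OF ab(1)] by (auto simp flip: of_real_mult)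
      finally show "(\<Sum>y<n. cnj (K \<alpha> y / complex_of_real (sqrt (\<mu> \<alpha>))) * (K \<beta> y / complex_of_real (sqrt (\<mu> \<beta>)))) =
        (if \<alpha> = \<beta> then 1 else 0)" .
    qed
    show "M u y = (\<Sum>\<alpha><r. complex_of_real (sqrt (\<mu> \<alpha>)) * q \<alpha> u * (K \<alpha> y / complex_of_real (sqrt (\<mu> \<alpha>))))"
      if "u < m" "y < n" for u y
      unfolding M[OF that] using \<mu>pos by (intro sum.cong refl) force
  qed (use q \<mu>pos in auto)
qed

text \<open>The realigned (reshuffled) matrix: a row index \<open>u\<close> encodes the pair of
  indices on A, a column index \<open>y\<close> the pair on B. A tensor product across the cut
  becomes a matrix of rank one, so that operator Schmidt decompositions of \<rho> are singular value
  decompositions of this matrix.\<close>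

definition realign :: "nat \<Rightarrow> nat \<Rightarrow> complex mat \<Rightarrow> nat \<Rightarrow> nat \<Rightarrow> complex" where
  "realign dA dB \<rho> u y = \<rho> $$ (u div dA * dB + y div dB, u mod dA * dB + y mod dB)"

lemma div_mod_less: "u < m * n \<Longrightarrow> u div n < m" "u < m * n \<Longrightarrow> u mod n < n" for u m n :: nat
  by (simp_all add: less_mult_imp_div_less) (metis mod_less_divisor mult_0_right not_less_zero neq0_conv)

lemma mult_add_less: "i < m \<Longrightarrow> k < n \<Longrightarrow> i * n + k < m * n" for i k m n :: nat
proof -
  assume "i < m" "k < n"
  hence "i * n + k < Suc i * n" by simp
  also have "\<dots> \<le> m * n" using \<open>i < m\<close> by (intro mult_le_mono1) simp
  finally show ?thesis .
qed

lemma hs_inner_product: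
  assumes "A \<in> carrier_mat d d" "B \<in> carrier_mat d d"
  shows "mtrace (mat_adjoint A * B) =
    (\<Sum>u<d * d. cnj (A $$ (u div d, u mod d)) * B $$ (u div d, u mod d))"
proof -
  have "mtrace (mat_adjoint A * B) = (\<Sum>j<d. \<Sum>i<d. cnj (A $$ (i, j)) * B $$ (i, j))"
    unfolding mtrace_def using assms
    by (auto intro!: sum.cong simp: mult_index[of "mat_adjoint A" d d B d] simp del: index_mult_mat(1))
  also have "\<dots> = (\<Sum>i<d. \<Sum>j<d. cnj (A $$ (i, j)) * B $$ (i, j))" by (rule sum.swap)
  finally show ?thesis by (simp add: sum_div_mod)
qed

lemma hs_orthonormal_iff:
  "hs_orthonormal d r E \<longleftrightarrow> (\<forall>\<alpha><r. E \<alpha> \<in> carrier_mat d d) \<and>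
     orthonormal_on (d * d) r (\<lambda>\<alpha> u. E \<alpha> $$ (u div d, u mod d))"
proof (cases "\<forall>\<alpha><r. E \<alpha> \<in> carrier_mat d d")
  case True
  hence "mtrace (mat_adjoint (E \<alpha>) * E \<beta>) =
      (\<Sum>u<d * d. cnj (E \<alpha> $$ (u div d, u mod d)) * E \<beta> $$ (u div d, u mod d))"
    if "\<alpha> < r" "\<beta> < r" for \<alpha> \<beta>
    using that by (intro hs_inner_product) auto
  thus ?thesis unfolding hs_orthonormal_def orthonormal_on_def by simp
next
  case False
  thus ?thesis unfolding hs_orthonormal_def by blast
qed

lemma operator_schmidt_iff:
  "operator_schmidt dA dB \<rho> r lam E F \<longleftrightarrow>
     (\<forall>\<alpha><r. lam \<alpha> > 0) \<and> hs_orthonormal dA r E \<and> hs_orthonormal dB r F \<and>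
     \<rho> \<in> carrier_mat (dA * dB) (dA * dB) \<and>
     (\<forall>u<dA * dA. \<forall>y<dB * dB. realign dA dB \<rho> u y =
        (\<Sum>\<alpha><r. complex_of_real (lam \<alpha>) * E \<alpha> $$ (u div dA, u mod dA) * F \<alpha> $$ (y div dB, y mod dB)))"
proof -
  have kron: "kron (E \<alpha>) (F \<alpha>) $$ (s, t) = E \<alpha> $$ (s div dB, t div dB) * F \<alpha> $$ (s mod dB, t mod dB)"
    if "s < dA * dB" "t < dA * dB" "E \<alpha> \<in> carrier_mat dA dA" "F \<alpha> \<in> carrier_mat dB dB" for \<alpha> s t
    using that by (auto simp: kron_def)
  have "\<rho> = mat (dA * dB) (dA * dB) (\<lambda>p. \<Sum>\<alpha><r. complex_of_real (lam \<alpha>) * kron (E \<alpha>) (F \<alpha>) $$ p) \<longleftrightarrow>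
     \<rho> \<in> carrier_mat (dA * dB) (dA * dB) \<and>
     (\<forall>u<dA * dA. \<forall>y<dB * dB. realign dA dB \<rho> u y =
        (\<Sum>\<alpha><r. complex_of_real (lam \<alpha>) * E \<alpha> $$ (u div dA, u mod dA) * F \<alpha> $$ (y div dB, y mod dB)))"
    (is "\<rho> = ?K \<longleftrightarrow> _ \<and> ?R") if E: "hs_orthonormal dA r E" and F: "hs_orthonormal dB r F"
  proof (intro iffI conjI allI impI)
    assume eq: "\<rho> = ?K"
    show "\<rho> \<in> carrier_mat (dA * dB) (dA * dB)" by (subst eq) simp
    fix u y assume "u < dA * dA" "y < dB * dB"
    hence l: "u div dA < dA" "u mod dA < dA" "y div dB < dB" "y mod dB < dB" by (auto simp: div_mod_less)
    show "realign dA dB \<rho> u y =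
        (\<Sum>\<alpha><r. complex_of_real (lam \<alpha>) * E \<alpha> $$ (u div dA, u mod dA) * F \<alpha> $$ (y div dB, y mod dB))"
      unfolding realign_def by (subst eq)
        (use l E F in \<open>auto simp: mult_add_less kron hs_orthonormal_def intro!: sum.cong\<close>)
  next
    assume "\<rho> \<in> carrier_mat (dA * dB) (dA * dB) \<and> ?R"
    hence c: "\<rho> \<in> carrier_mat (dA * dB) (dA * dB)" and R: ?R by auto
    show "\<rho> = ?K"
    proof (rule eq_matI)
      fix s t assume "s < dim_row ?K" "t < dim_col ?K"
      hence st: "s < dA * dB" "t < dA * dB" by auto
      hence l: "s div dB < dA" "t div dB < dA" "s mod dB < dB" "t mod dB < dB" by (auto simp: div_mod_less)
      have "\<rho> $$ (s, t) = realign dA dB \<rho> (s div dB * dA + t div dB) (s mod dB * dB + t mod dB)"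
        unfolding realign_def using l by simp
      also have "\<dots> = (\<Sum>\<alpha><r. complex_of_real (lam \<alpha>) * E \<alpha> $$ (s div dB, t div dB) * F \<alpha> $$ (s mod dB, t mod dB))"
        by (subst R[rule_format]) (use l in \<open>auto simp: mult_add_less\<close>)
      finally show "\<rho> $$ (s, t) = ?K $$ (s, t)"
        using st E F by (simp add: kron hs_orthonormal_def mult.assoc)
    qed (use c in auto)
  qed
  thus ?thesis unfolding operator_schmidt_def by blast
qed

text \<open>The singular vectors of the realigned matrix are folded back into operators; orthonormal
  vectors become Hilbert-Schmidt orthonormal operators.\<close>

lemma operator_schmidt_exists:
  assumes \<rho>: "\<rho> \<in> carrier_mat (dA * dB) (dA * dB)"
  obtains r lam E F where "operator_schmidt dA dB \<rho> r lam E F"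
proof -
  obtain r lam q f where d: "\<And>\<alpha>. \<alpha> < r \<Longrightarrow> lam \<alpha> > (0::real)"
    "orthonormal_on (dA * dA) r q" "orthonormal_on (dB * dB) r f"
    "\<And>u y. u < dA * dA \<Longrightarrow> y < dB * dB \<Longrightarrow>
       realign dA dB \<rho> u y = (\<Sum>\<alpha><r. complex_of_real (lam \<alpha>) * q \<alpha> u * f \<alpha> y)"
    using singular_value_decomposition[of "dA * dA" "dB * dB" "realign dA dB \<rho>"] by blast
  define E where "E = (\<lambda>\<alpha>. mat dA dA (\<lambda>(i, j). q \<alpha> (i * dA + j)))"
  define F where "F = (\<lambda>\<alpha>. mat dB dB (\<lambda>(i, j). f \<alpha> (i * dB + j)))"
  have E: "E \<alpha> $$ (u div dA, u mod dA) = q \<alpha> u" if "u < dA * dA" for \<alpha> u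
    using that by (simp add: E_def div_mod_less)
  have F: "F \<alpha> $$ (u div dB, u mod dB) = f \<alpha> u" if "u < dB * dB" for \<alpha> u
    using that by (simp add: F_def div_mod_less)
  have "hs_orthonormal dA r E" "hs_orthonormal dB r F"
    using d(2,3) unfolding hs_orthonormal_iff orthonormal_on_def
    by (auto simp: E F) (auto simp: E_def F_def)
  hence "operator_schmidt dA dB \<rho> r lam E F"
    unfolding operator_schmidt_iff using d \<rho> by (auto simp: E F)
  thus thesis by (rule that)
qed

section \<open>Operator entanglement\<close>

text \<open>R R^dagger for the realigned matrix R; its nonzero eigenvalues are the squared Schmidt
  coefficients.\<close>

definition realigned_gram :: "nat \<Rightarrow> nat \<Rightarrow> complex mat \<Rightarrow> nat \<Rightarrow> nat \<Rightarrow> complex" where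
  "realigned_gram dA dB \<rho> u v = (\<Sum>y<dB * dB. realign dA dB \<rho> u y * cnj (realign dA dB \<rho> v y))"

text \<open>Indices are shifted by one: \<open>gram_power dA dB \<rho> k\<close> is the \<open>(k + 1)\<close>-st power. The zeroth
  power has to be avoided, since its trace is not the number of Schmidt coefficients.\<close>

primrec gram_power :: "nat \<Rightarrow> nat \<Rightarrow> complex mat \<Rightarrow> nat \<Rightarrow> nat \<Rightarrow> nat \<Rightarrow> complex" where
  "gram_power dA dB \<rho> 0 = realigned_gram dA dB \<rho>"
| "gram_power dA dB \<rho> (Suc k) =
     (\<lambda>u v. \<Sum>w<dA * dA. gram_power dA dB \<rho> k u w * realigned_gram dA dB \<rho> w v)"

definition schmidt_moment :: "nat \<Rightarrow> nat \<Rightarrow> complex mat \<Rightarrow> nat \<Rightarrow> real" where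
  "schmidt_moment dA dB \<rho> k = Re (\<Sum>u<dA * dA. gram_power dA dB \<rho> k u u)"

text \<open>The left singular vectors diagonalize the Gram matrix with eigenvalues
  \<open>(lam \<alpha>)\<^sup>2\<close>, so the traces of its powers are power sums. The left-hand
  side is computed from the entries of \<rho> alone; hence any two decompositions have the same
  power sums.\<close>

lemma schmidt_moment_eq:
  assumes "operator_schmidt dA dB \<rho> r lam E F"
  shows "schmidt_moment dA dB \<rho> k = (\<Sum>\<alpha><r. ((lam \<alpha>)\<^sup>2) ^ Suc k)"
proof -
  define q where "q = (\<lambda>\<alpha> u. E \<alpha> $$ (u div dA, u mod dA))"
  define f where "f = (\<lambda>\<alpha> u. F \<alpha> $$ (u div dB, u mod dB))"
  have q: "orthonormal_on (dA * dA) r q" and f: "orthonormal_on (dB * dB) r f"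
    and M: "\<And>u y. u < dA * dA \<Longrightarrow> y < dB * dB \<Longrightarrow>
       realign dA dB \<rho> u y = (\<Sum>\<alpha><r. complex_of_real (lam \<alpha>) * q \<alpha> u * f \<alpha> y)"
    using assms unfolding operator_schmidt_iff hs_orthonormal_iff q_def f_def by auto
  have G: "realigned_gram dA dB \<rho> u v = (\<Sum>\<alpha><r. complex_of_real ((lam \<alpha>)\<^sup>2) * q \<alpha> u * cnj (q \<alpha> v))"
    if uv: "u < dA * dA" "v < dA * dA" for u v
  proof -
    have "realigned_gram dA dB \<rho> u v = (\<Sum>y<dB * dB. \<Sum>\<alpha><r. \<Sum>\<beta><r.
        complex_of_real (lam \<alpha> * lam \<beta>) * q \<alpha> u * cnj (q \<beta> v) * (cnj (f \<beta> y) * f \<alpha> y))"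
      unfolding realigned_gram_def
      by (intro sum.cong refl) (simp add: M uv sum_product mult_ac)
    also have "\<dots> = (\<Sum>\<alpha><r. \<Sum>\<beta><r. \<Sum>y<dB * dB.
        complex_of_real (lam \<alpha> * lam \<beta>) * q \<alpha> u * cnj (q \<beta> v) * (cnj (f \<beta> y) * f \<alpha> y))"
      by (subst sum.swap, rule sum.cong[OF refl], rule sum.swap)
    also have "\<dots> = (\<Sum>\<alpha><r. \<Sum>\<beta><r. complex_of_real (lam \<alpha> * lam \<beta>) * q \<alpha> u * cnj (q \<beta> v) * (if \<beta> = \<alpha> then 1 else 0))"
      using f by (intro sum.cong refl) (simp add: orthonormal_on_def flip: sum_distrib_left)
    finally show ?thesis by (simp add: power2_eq_square)
  qed
  have P: "gram_power dA dB \<rho> k u v = (\<Sum>\<alpha><r. complex_of_real (((lam \<alpha>)\<^sup>2) ^ Suc k) * q \<alpha> u * cnj (q \<alpha> v))"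
    if uv: "u < dA * dA" "v < dA * dA" for u v
    using uv
  proof (induction k arbitrary: v)
    case 0
    thus ?case by (simp add: G)
  next
    case (Suc k)
    have "gram_power dA dB \<rho> (Suc k) u v = (\<Sum>w<dA * dA. \<Sum>\<alpha><r. \<Sum>\<beta><r.
        complex_of_real (((lam \<alpha>)\<^sup>2) ^ Suc k * (lam \<beta>)\<^sup>2) * q \<alpha> u * cnj (q \<beta> v) * (cnj (q \<alpha> w) * q \<beta> w))"
      unfolding gram_power.simps
      by (intro sum.cong refl) (simp add: G Suc sum_product del: of_real_power power_Suc, simp only: mult_ac)
    also have "\<dots> = (\<Sum>\<alpha><r. \<Sum>\<beta><r. \<Sum>w<dA * dA.
        complex_of_real (((lam \<alpha>)\<^sup>2) ^ Suc k * (lam \<beta>)\<^sup>2) * q \<alpha> u * cnj (q \<beta> v) * (cnj (q \<alpha> w) * q \<beta> w))"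
      by (subst sum.swap, rule sum.cong[OF refl], rule sum.swap)
    also have "\<dots> = (\<Sum>\<alpha><r. \<Sum>\<beta><r.
        complex_of_real (((lam \<alpha>)\<^sup>2) ^ Suc k * (lam \<beta>)\<^sup>2) * q \<alpha> u * cnj (q \<beta> v) * (if \<alpha> = \<beta> then 1 else 0))"
      using q by (intro sum.cong refl) (simp add: orthonormal_on_def flip: sum_distrib_left)
    also have "\<dots> = (\<Sum>\<alpha><r. complex_of_real (((lam \<alpha>)\<^sup>2) ^ Suc (Suc k)) * q \<alpha> u * cnj (q \<alpha> v))"
      by (simp only: sum_mult_delta finite_lessThan lessThan_iff if_True cong: sum.cong)
        (simp add: mult_ac)
    finally show ?case .
  qed
  have "(\<Sum>u<dA * dA. gram_power dA dB \<rho> k u u) =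
      (\<Sum>\<alpha><r. complex_of_real (((lam \<alpha>)\<^sup>2) ^ Suc k) * (\<Sum>u<dA * dA. cnj (q \<alpha> u) * q \<alpha> u))"
    by (simp add: P sum_distrib_left mult_ac del: of_real_power power_Suc) (rule sum.swap)
  also have "\<dots> = complex_of_real (\<Sum>\<alpha><r. ((lam \<alpha>)\<^sup>2) ^ Suc k)"
    using q by (simp add: orthonormal_on_def)
  finally show ?thesis unfolding schmidt_moment_def by (simp only: Re_complex_of_real)
qed

text \<open>For a Hermitian matrix this is tr (A^2), so for a state it is the purity.\<close>

definition hs_norm2 :: "complex mat \<Rightarrow> real" where
  "hs_norm2 A = (\<Sum>i<dim_row A. \<Sum>j<dim_col A. (cmod (A $$ (i, j)))\<^sup>2)"

lemma hs_norm2_nonneg: "hs_norm2 A \<ge> 0"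
  unfolding hs_norm2_def by (simp add: sum_nonneg)

text \<open>Realignment only permutes the entries, so it preserves the Hilbert-Schmidt norm.\<close>

lemma schmidt_moment_0:
  assumes "\<rho> \<in> carrier_mat (dA * dB) (dA * dB)"
  shows "schmidt_moment dA dB \<rho> 0 = hs_norm2 \<rho>"
proof -
  have "(\<Sum>u<dA * dA. gram_power dA dB \<rho> 0 u u) =
    complex_of_real (\<Sum>u<dA * dA. \<Sum>y<dB * dB. (cmod (realign dA dB \<rho> u y))\<^sup>2)"
    unfolding gram_power.simps realigned_gram_def by (simp only: of_real_sum complex_norm_square)
  hence "schmidt_moment dA dB \<rho> 0 = (\<Sum>u<dA * dA. \<Sum>y<dB * dB. (cmod (realign dA dB \<rho> u y))\<^sup>2)"
    unfolding schmidt_moment_def by (simp only: Re_complex_of_real)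
  also have "\<dots> = (\<Sum>i<dA. \<Sum>j<dA. \<Sum>k<dB. \<Sum>l<dB. (cmod (\<rho> $$ (i * dB + k, j * dB + l)))\<^sup>2)"
    unfolding sum_div_mod realign_def by (intro sum.cong refl) simp
  also have "\<dots> = (\<Sum>i<dA. \<Sum>k<dB. \<Sum>j<dA. \<Sum>l<dB. (cmod (\<rho> $$ (i * dB + k, j * dB + l)))\<^sup>2)"
    by (rule sum.cong[OF refl]) (rule sum.swap)
  also have "\<dots> = hs_norm2 \<rho>" using assms by (simp add: hs_norm2_def sum_div_mod)
  finally show ?thesis .
qed

section \<open>Entropy as a limit of polynomials, and its bound by the purity\<close>

lemma continuous_on_entropy:
  "continuous_on {0..K} (\<lambda>x. - (x * log 2 x))"
proof -
  \<comment> \<open>At 0 the product has the value 0, which agrees with this limit; so the function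
    is continuous up to the endpoint.\<close>
  have "((\<lambda>x::real. x * log 2 x) \<longlongrightarrow> 0) (at_right 0)" by real_asymp
  hence 0: "((\<lambda>x::real. x * log 2 x) \<longlongrightarrow> 0) (at 0 within {0..K})"
    by (rule tendsto_mono[rotated])
      (auto intro!: filter_leI simp: eventually_at_filter elim!: eventually_mono)
  have "continuous_on {0..K} (\<lambda>x. x * log 2 x)"
    unfolding continuous_on_eq_continuous_within
  proof
    fix x assume x: "x \<in> {0..K}"
    show "continuous (at x within {0..K}) (\<lambda>x. x * log 2 x)"
    proof (cases "x = 0")
      case True
      thus ?thesis using 0 by (simp add: continuous_within)
    next
      case False
      hence "x > 0" using x by simp
      hence "isCont (\<lambda>x. x * log 2 x) x" by (auto intro!: continuous_intros)
      thus ?thesis by (rule continuous_at_imp_continuous_at_within)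
    qed
  qed
  thus ?thesis by (rule continuous_on_minus)
qed

text \<open>This makes the entropy a limit of polynomials in the entries of the state, which gives both its
  independence of the chosen decomposition and its measurability.\<close>

lemma entropy_polynomial_approximation:
  obtains m :: "nat \<Rightarrow> nat" and c :: "nat \<Rightarrow> nat \<Rightarrow> real"
  where "\<And>x. x \<ge> 0 \<Longrightarrow> (\<lambda>k. \<Sum>i<m k. c k i * x ^ Suc i) \<longlonglongrightarrow> - (x * log 2 x)"
proof -
  have "\<exists>m c. \<forall>x\<in>{0..real k}. \<bar>(\<Sum>i<m. c i * x ^ Suc i) - (- (x * log 2 x))\<bar> < 1 / real (Suc k)"
    for k :: nat
  proof -
    \<comment> \<open>Half of the tolerance, because removing the constant term of the approximating
      polynomial costs a second error below \<open>e\<close>.\<close>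
    define e where "e = 1 / real (Suc k) / 2"
    have e: "e > 0" "1 / real (Suc k) = 2 * e" by (simp_all add: e_def field_simps)
    obtain g where g: "real_polynomial_function g"
      and ge: "\<And>x. x \<in> {0..real k} \<Longrightarrow> \<bar>- (x * log 2 x) - g x\<bar> < e"
      using Stone_Weierstrass_real_polynomial_function[OF compact_Icc[of 0 "real k"] continuous_on_entropy[of "real k"], of e] e(1)
      by auto
    obtain a n where gn: "g = (\<lambda>x. \<Sum>i\<le>n. a i * x ^ i)"
      using g unfolding real_polynomial_function_iff_sum by blast
    \<comment> \<open>The constant term is dropped because the Schmidt moments start with the first
      power. It equals \<open>g 0\<close>, which is small since the entropy function vanishes at
      0.\<close>
    have eq: "(\<Sum>i<n. a (Suc i) * x ^ Suc i) = g x - g 0" for x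
    proof -
      have "g x = a 0 + (\<Sum>i<n. a (Suc i) * x ^ Suc i)"
        unfolding gn by (subst sum.atMost_shift) simp
      moreover have "g 0 = a 0" unfolding gn by (subst sum.atMost_shift) simp
      ultimately show ?thesis by simp
    qed
    have "\<bar>g 0\<bar> < e" using ge[of 0] by simp
    have "\<forall>x\<in>{0..real k}. \<bar>(\<Sum>i<n. a (Suc i) * x ^ Suc i) - (- (x * log 2 x))\<bar> < 1 / real (Suc k)"
    proof
      fix x assume "x \<in> {0..real k}"
      from ge[OF this] \<open>\<bar>g 0\<bar> < e\<close> show "\<bar>(\<Sum>i<n. a (Suc i) * x ^ Suc i) - (- (x * log 2 x))\<bar> < 1 / real (Suc k)"
        unfolding eq e(2) by linarith
    qed
    thus ?thesis by (intro exI[of _ n] exI[of _ "\<lambda>i. a (Suc i)"]) 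
  qed
  then obtain m c where mc: "\<And>k x. x \<in> {0..real k} \<Longrightarrow>
      \<bar>(\<Sum>i<m k. c k i * x ^ Suc i) - (- (x * log 2 x))\<bar> < 1 / real (Suc k)"
    by metis
  show thesis
  proof (rule that[of c m])
    fix x :: real assume x: "x \<ge> 0"
    \<comment> \<open>The approximation on [0, k] applies as soon as k \<ge> x; the growing
      intervals reach every nonnegative x.\<close>
    show "(\<lambda>k. \<Sum>i<m k. c k i * x ^ Suc i) \<longlonglongrightarrow> - (x * log 2 x)"
    proof (rule LIM_zero_cancel, rule Lim_null_comparison)
      show "(\<lambda>k. 1 / real (Suc k)) \<longlonglongrightarrow> 0" by real_asymp
      show "\<forall>\<^sub>F k in sequentially. norm ((\<Sum>i<m k. c k i * x ^ Suc i) - (- (x * log 2 x))) \<le> 1 / real (Suc k)"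
        using eventually_ge_at_top[of "nat \<lceil>x\<rceil>"]
      proof eventually_elim
        case (elim k)
        hence "x \<in> {0..real k}" using x by (auto simp: nat_le_iff ceiling_le_iff)
        from mc[OF this] show ?case by simp
      qed
    qed
  qed
qed

text \<open>One choice of \<open>m\<close> and \<open>c\<close> serves all states and cuts. The
  approximations of the single summands add up to a combination of Schmidt moments, so the entropies
  of two decompositions of a state are limits of one and the same sequence. Hence the definite
  description denotes and may be evaluated on any decomposition.\<close>

lemma operator_entanglement_limit:
  obtains m :: "nat \<Rightarrow> nat" and c :: "nat \<Rightarrow> nat \<Rightarrow> real"
  where "\<And>n a \<rho>. a \<le> n \<Longrightarrow> \<rho> \<in> carrier_mat (2 ^ n) (2 ^ n) \<Longrightarrow>
    (\<lambda>k. \<Sum>i<m k. c k i * schmidt_moment (2 ^ a) (2 ^ (n - a)) \<rho> i) \<longlonglongrightarrow> operator_entanglement n a \<rho>"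
    "\<And>n a \<rho>. a \<le> n \<Longrightarrow> \<rho> \<in> carrier_mat (2 ^ n) (2 ^ n) \<Longrightarrow>
    \<exists>r lam E F. operator_schmidt (2 ^ a) (2 ^ (n - a)) \<rho> r lam E F \<and>
      operator_entanglement n a \<rho> = - (\<Sum>\<alpha><r. (lam \<alpha>)\<^sup>2 * log 2 ((lam \<alpha>)\<^sup>2))"
proof -
  obtain m :: "nat \<Rightarrow> nat" and c :: "nat \<Rightarrow> nat \<Rightarrow> real"
    where mc: "\<And>x. x \<ge> 0 \<Longrightarrow> (\<lambda>k. \<Sum>i<m k. c k i * x ^ Suc i) \<longlonglongrightarrow> - (x * log 2 x)"
    using entropy_polynomial_approximation by blast
  have lim: "(\<lambda>k. \<Sum>i<m k. c k i * schmidt_moment dA dB \<rho> i) \<longlonglongrightarrow> - (\<Sum>\<alpha><r. (lam \<alpha>)\<^sup>2 * log 2 ((lam \<alpha>)\<^sup>2))"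
    if s: "operator_schmidt dA dB \<rho> r lam E F" for dA dB \<rho> r lam E F
  proof -
    have "(\<Sum>i<m k. c k i * schmidt_moment dA dB \<rho> i) = (\<Sum>\<alpha><r. \<Sum>i<m k. c k i * ((lam \<alpha>)\<^sup>2) ^ Suc i)" for k
      unfolding schmidt_moment_eq[OF s] sum_distrib_left by (rule sum.swap)
    moreover have "(\<lambda>k. \<Sum>\<alpha><r. \<Sum>i<m k. c k i * ((lam \<alpha>)\<^sup>2) ^ Suc i) \<longlonglongrightarrow> (\<Sum>\<alpha><r. - ((lam \<alpha>)\<^sup>2 * log 2 ((lam \<alpha>)\<^sup>2)))"
      by (intro tendsto_sum mc) simp
    ultimately show ?thesis by (simp only: sum_negf)
  qed
  have ex: "\<exists>r lam E F. operator_schmidt (2 ^ a) (2 ^ (n - a)) \<rho> r lam E F \<and>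
      operator_entanglement n a \<rho> = - (\<Sum>\<alpha><r. (lam \<alpha>)\<^sup>2 * log 2 ((lam \<alpha>)\<^sup>2))"
    if "a \<le> n" "\<rho> \<in> carrier_mat (2 ^ n) (2 ^ n)" for n a \<rho>
  proof -
    have "\<rho> \<in> carrier_mat (2 ^ a * 2 ^ (n - a)) (2 ^ a * 2 ^ (n - a))"
      using that by (simp flip: power_add)
    then obtain r lam E F where s: "operator_schmidt (2 ^ a) (2 ^ (n - a)) \<rho> r lam E F"
      using operator_schmidt_exists by blast
    have "operator_entanglement n a \<rho> = - (\<Sum>\<alpha><r. (lam \<alpha>)\<^sup>2 * log 2 ((lam \<alpha>)\<^sup>2))"
      unfolding operator_entanglement_def
    proof (rule the_equality)
      fix S assume "\<exists>r lam E F. operator_schmidt (2 ^ a) (2 ^ (n - a)) \<rho> r lam E F \<and>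
        S = - (\<Sum>\<alpha><r. (lam \<alpha>)\<^sup>2 * log 2 ((lam \<alpha>)\<^sup>2))"
      then obtain r' lam' E' F' where s': "operator_schmidt (2 ^ a) (2 ^ (n - a)) \<rho> r' lam' E' F'"
        and S: "S = - (\<Sum>\<alpha><r'. (lam' \<alpha>)\<^sup>2 * log 2 ((lam' \<alpha>)\<^sup>2))" by blast
      show "S = - (\<Sum>\<alpha><r. (lam \<alpha>)\<^sup>2 * log 2 ((lam \<alpha>)\<^sup>2))"
        unfolding S by (rule LIMSEQ_unique[OF lim[OF s'] lim[OF s]])
    qed (use s in blast)
    with s show ?thesis by blast
  qed
  show thesis
  proof (rule that[of c m])
    fix n a :: nat and \<rho> :: "complex mat" assume "a \<le> n" "\<rho> \<in> carrier_mat (2 ^ n) (2 ^ n)"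
    from ex[OF this] show "\<exists>r lam E F. operator_schmidt (2 ^ a) (2 ^ (n - a)) \<rho> r lam E F \<and>
      operator_entanglement n a \<rho> = - (\<Sum>\<alpha><r. (lam \<alpha>)\<^sup>2 * log 2 ((lam \<alpha>)\<^sup>2))" .
    then obtain r lam E F where s: "operator_schmidt (2 ^ a) (2 ^ (n - a)) \<rho> r lam E F"
      and e: "operator_entanglement n a \<rho> = - (\<Sum>\<alpha><r. (lam \<alpha>)\<^sup>2 * log 2 ((lam \<alpha>)\<^sup>2))" by blast
    show "(\<lambda>k. \<Sum>i<m k. c k i * schmidt_moment (2 ^ a) (2 ^ (n - a)) \<rho> i) \<longlonglongrightarrow> operator_entanglement n a \<rho>"
      unfolding e by (rule lim[OF s])
  qed
qed

text \<open>The inequality ln y \<le> y - 1 at y = 1 / (x 4^n) bounds each term - x log x by the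
  share \<open>1 / ln 2 / 4 ^ n\<close> plus 2 n x. Orthonormality of the operators on A leaves at
  most 4^a \<le> 4^n terms, and the x add up to the purity.\<close>

lemma operator_entanglement_le:
  assumes "a \<le> n" "\<rho> \<in> carrier_mat (2 ^ n) (2 ^ n)"
  shows "operator_entanglement n a \<rho> \<le> 1 / ln 2 + 2 * real n * hs_norm2 \<rho>"
proof -
  obtain r lam E F where s: "operator_schmidt (2 ^ a) (2 ^ (n - a)) \<rho> r lam E F"
    and e: "operator_entanglement n a \<rho> = - (\<Sum>\<alpha><r. (lam \<alpha>)\<^sup>2 * log 2 ((lam \<alpha>)\<^sup>2))"
    using operator_entanglement_limit[of thesis] assms by blast
  have lam: "\<And>\<alpha>. \<alpha> < r \<Longrightarrow> lam \<alpha> > 0" and "orthonormal_on (2 ^ a * 2 ^ a) r (\<lambda>\<alpha> u. E \<alpha> $$ (u div 2 ^ a, u mod 2 ^ a))"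
    using s unfolding operator_schmidt_iff hs_orthonormal_iff by auto
  from orthonormal_card_le[OF this(2)] have "r \<le> 2 ^ a * 2 ^ a" .
  also have "\<dots> \<le> 2 ^ n * 2 ^ n" using assms(1) by (intro mult_mono power_increasing) auto
  finally have "real r \<le> real (2 ^ n * 2 ^ n)" by (simp only: of_nat_le_iff)
  hence r: "real r \<le> 4 ^ n" by (simp flip: power_mult_distrib)
  have bound: "- (x * log 2 x) \<le> 1 / ln 2 / 4 ^ n + 2 * real n * x" if x: "x > 0" for x :: real
  proof -
    have "ln (1 / (x * 4 ^ n)) \<le> 1 / (x * 4 ^ n) - 1" using x by (intro ln_le_minus_one) simp
    moreover have "ln (1 / (x * 4 ^ n)) = - ln x - 2 * real n * ln 2"
    proof -
      have "ln (4::real) = 2 * ln 2" using ln_realpow[of "2::real" 2] by simp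
      thus ?thesis using x by (simp add: ln_div ln_mult ln_realpow)
    qed
    ultimately have "x * (- ln x - 2 * real n * ln 2) \<le> x * (1 / (x * 4 ^ n))"
      using x by (intro mult_left_mono) auto
    hence "- (x * ln x) \<le> 1 / 4 ^ n + 2 * real n * x * ln 2" using x by (simp add: algebra_simps)
    hence "- (x * ln x) / ln 2 \<le> (1 / 4 ^ n + 2 * real n * x * ln 2) / ln 2" by (intro divide_right_mono) auto
    thus ?thesis by (simp add: log_def add_divide_distrib mult.commute)
  qed
  have "operator_entanglement n a \<rho> = (\<Sum>\<alpha><r. - ((lam \<alpha>)\<^sup>2 * log 2 ((lam \<alpha>)\<^sup>2)))"
    unfolding e by (simp add: sum_negf)
  also have "\<dots> \<le> (\<Sum>\<alpha><r. 1 / ln 2 / 4 ^ n + 2 * real n * (lam \<alpha>)\<^sup>2)"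
    using lam by (intro sum_mono bound) (simp add: less_imp_neq[symmetric])
  also have "\<dots> = real r * (1 / ln 2 / 4 ^ n) + 2 * real n * (\<Sum>\<alpha><r. (lam \<alpha>)\<^sup>2)"
    by (simp add: sum.distrib sum_distrib_left)
  also have "real r * (1 / ln 2 / 4 ^ n) \<le> 4 ^ n * (1 / ln 2 / 4 ^ n)"
    using r by (intro mult_right_mono) auto
  also have "(\<Sum>\<alpha><r. (lam \<alpha>)\<^sup>2) = hs_norm2 \<rho>"
  proof -
    have "\<rho> \<in> carrier_mat (2 ^ a * 2 ^ (n - a)) (2 ^ a * 2 ^ (n - a))"
      using assms by (simp flip: power_add)
    from schmidt_moment_0[OF this] show ?thesis using schmidt_moment_eq[OF s, of 0] by simp
  qed
  finally show ?thesis by simp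
qed

section \<open>Positive semidefinite matrices\<close>

lemma quadratic_form_eq:
  assumes "A \<in> carrier_mat d d" "v \<in> carrier_vec d"
  shows "(A *\<^sub>v v) \<bullet>c v = (\<Sum>i<d. \<Sum>j<d. A $$ (i, j) * v $ j * cnj (v $ i))"
  using assms by (auto simp: scalar_prod_def lessThan_atLeast0 sum_distrib_right intro!: sum.cong)

text \<open>Test vectors become arbitrary functions, so that they can be defined by cases and
  composed with index maps.\<close>

lemma pos_semidef_iff:
  "pos_semidef d A \<longleftrightarrow> A \<in> carrier_mat d d \<and>
     (\<forall>f :: nat \<Rightarrow> complex. 0 \<le> (\<Sum>i<d. \<Sum>j<d. A $$ (i, j) * f j * cnj (f i)))"
proof (cases "A \<in> carrier_mat d d")
  case True
  have "(\<forall>v\<in>carrier_vec d. 0 \<le> (A *\<^sub>v v) \<bullet>c v) \<longleftrightarrow>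
     (\<forall>f :: nat \<Rightarrow> complex. 0 \<le> (\<Sum>i<d. \<Sum>j<d. A $$ (i, j) * f j * cnj (f i)))" (is "?L \<longleftrightarrow> ?R")
  proof
    assume L: ?L
    show ?R
    proof
      fix f :: "nat \<Rightarrow> complex"
      have "0 \<le> (A *\<^sub>v vec d f) \<bullet>c vec d f" using L by simp
      also have "\<dots> = (\<Sum>i<d. \<Sum>j<d. A $$ (i, j) * f j * cnj (f i))"
        by (subst quadratic_form_eq[OF True]) auto
      finally show "0 \<le> (\<Sum>i<d. \<Sum>j<d. A $$ (i, j) * f j * cnj (f i))" .
    qed
  next
    assume ?R
    thus ?L by (auto simp: quadratic_form_eq[OF True])
  qed
  thus ?thesis using True unfolding pos_semidef_def by blast
qed (simp add: pos_semidef_def)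

lemma pos_semidef_form:
  "pos_semidef d A \<Longrightarrow> 0 \<le> (\<Sum>i<d. \<Sum>j<d. A $$ (i, j) * f j * cnj (f i))" for f :: "nat \<Rightarrow> complex"
  unfolding pos_semidef_iff by blast

lemma pos_semidef_carrier: "pos_semidef d A \<Longrightarrow> A \<in> carrier_mat d d"
  unfolding pos_semidef_def by blast

text \<open>The quadratic form at a vector supported on the two indices i and j, with entries x and
  y.\<close>

lemma pos_semidef_two:
  assumes A: "pos_semidef d A" and ij: "i < d" "j < d" "i \<noteq> j"
  shows "0 \<le> A $$ (i, i) * x * cnj x + A $$ (i, j) * y * cnj x + (A $$ (j, i) * x * cnj y + A $$ (j, j) * y * cnj y)"
proof -
  define f where "f = (\<lambda>k. if k = i then x else if k = j then y else 0)"
  have *: "(\<Sum>k<d. g k * f k) = g i * x + g j * y" "(\<Sum>k<d. g k * cnj (f k)) = g i * cnj x + g j * cnj y" for g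
  proof -
    have "(\<Sum>k<d. g k * f k) = (\<Sum>k\<in>{i, j}. g k * f k)"
      using ij by (intro sum.mono_neutral_right) (auto simp: f_def)
    thus "(\<Sum>k<d. g k * f k) = g i * x + g j * y" using ij by (simp add: f_def)
    have "(\<Sum>k<d. g k * cnj (f k)) = (\<Sum>k\<in>{i, j}. g k * cnj (f k))"
      using ij by (intro sum.mono_neutral_right) (auto simp: f_def)
    thus "(\<Sum>k<d. g k * cnj (f k)) = g i * cnj x + g j * cnj y" using ij by (simp add: f_def)
  qed
  have "(\<Sum>k<d. \<Sum>l<d. A $$ (k, l) * f l * cnj (f k)) = (\<Sum>k<d. (\<Sum>l<d. A $$ (k, l) * f l) * cnj (f k))"
    by (simp add: sum_distrib_right)
  also have "\<dots> = A $$ (i, i) * x * cnj x + A $$ (i, j) * y * cnj x + (A $$ (j, i) * x * cnj y + A $$ (j, j) * y * cnj y)"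
    unfolding * by (simp add: algebra_simps)
  finally show ?thesis using pos_semidef_form[OF A, of f] by simp
qed

lemma pos_semidef_diag:
  assumes A: "pos_semidef d A" and i: "i < d"
  shows "0 \<le> A $$ (i, i)"
proof -
  define f :: "nat \<Rightarrow> complex" where "f = (\<lambda>k. if k = i then 1 else 0)"
  have "(\<Sum>k<d. \<Sum>l<d. A $$ (k, l) * f l * cnj (f k)) = (\<Sum>k<d. \<Sum>l<d. if l = i then (if k = i then A $$ (i, i) else 0) else 0)"
    by (intro sum.cong refl) (auto simp: f_def)
  also have "\<dots> = A $$ (i, i)" using i by simp
  finally show ?thesis using pos_semidef_form[OF A, of f] by simp
qed

text \<open>Polarization: the form is real at the vectors with entries (1, 1) and (1, \<i>) in
  places i, j. The first fixes the imaginary part of the sum of the off-diagonal entries, the second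
  the real part of their difference.\<close>

lemma pos_semidef_hermitian:
  assumes A: "pos_semidef d A" and ij: "i < d" "j < d"
  shows "A $$ (j, i) = cnj (A $$ (i, j))"
proof (cases "i = j")
  case True
  thus ?thesis using pos_semidef_diag[OF A ij(1)] by (simp add: complex_eq_iff less_eq_complex_def)
next
  case False
  have "Im (A $$ (i, i)) = 0" "Im (A $$ (j, j)) = 0"
    using pos_semidef_diag[OF A ij(1)] pos_semidef_diag[OF A ij(2)] by (auto simp: less_eq_complex_def)
  thus ?thesis
    using pos_semidef_two[OF A ij False, of 1 1] pos_semidef_two[OF A ij False, of 1 \<i>]
    by (simp add: complex_eq_iff less_eq_complex_def)
qed

lemma pos_semidef_minor:
  assumes A: "pos_semidef d A" and ij: "i < d" "j < d"
  shows "(cmod (A $$ (i, j)))\<^sup>2 \<le> Re (A $$ (i, i)) * Re (A $$ (j, j))"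
proof (cases "i = j")
  case True
  have "A $$ (i, i) = complex_of_real (Re (A $$ (i, i)))"
    using pos_semidef_diag[OF A ij(1)] by (simp add: complex_eq_iff less_eq_complex_def)
  hence "cmod (A $$ (i, i)) = \<bar>Re (A $$ (i, i))\<bar>" by (metis norm_of_real)
  thus ?thesis using True by (simp add: power2_eq_square)
next
  case False
  define a b m where "a = Re (A $$ (i, i))" and "b = Re (A $$ (j, j))" and "m = (cmod (A $$ (i, j)))\<^sup>2"
  have a: "A $$ (i, i) = complex_of_real a" "a \<ge> 0" and b: "A $$ (j, j) = complex_of_real b" "b \<ge> 0"
    using pos_semidef_diag[OF A ij(1)] pos_semidef_diag[OF A ij(2)]
    by (auto simp: a_def b_def complex_eq_iff less_eq_complex_def)
  have m: "A $$ (i, j) * cnj (A $$ (i, j)) = complex_of_real m" "m \<ge> 0"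
    by (simp_all add: m_def complex_norm_square del: of_real_power)
  \<comment> \<open>The form at the vector with entries - t A_ij and s; the factor A_ij absorbs the
    phase and leaves a real form in t and s.\<close>
  have q: "0 \<le> a * m * t\<^sup>2 + b * s\<^sup>2 - 2 * m * t * s" for s t :: real
  proof -
    let ?c = "A $$ (i, j)"
    have "0 \<le> A $$ (i, i) * (- complex_of_real t * ?c) * cnj (- complex_of_real t * ?c) + ?c * complex_of_real s * cnj (- complex_of_real t * ?c)
       + (A $$ (j, i) * (- complex_of_real t * ?c) * cnj (complex_of_real s) + A $$ (j, j) * complex_of_real s * cnj (complex_of_real s))"
      by (rule pos_semidef_two[OF A ij False])
    also have "\<dots> = complex_of_real (a * t\<^sup>2) * (?c * cnj ?c) - complex_of_real (2 * t * s) * (?c * cnj ?c) + complex_of_real (b * s\<^sup>2)"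
      unfolding pos_semidef_hermitian[OF A ij] a b by (simp add: algebra_simps power2_eq_square)
    also have "\<dots> = complex_of_real (a * m * t\<^sup>2 + b * s\<^sup>2 - 2 * m * t * s)"
      unfolding m by (simp add: algebra_simps)
    finally show ?thesis by (simp add: less_eq_complex_def)
  qed
  have "m \<le> a * b"
  proof (cases "b = 0")
    case True
    \<comment> \<open>For b = 0 the form at t = 1, s = a + 1 equals - m (a + 2).\<close>
    have "m = 0" using q[of 1 "a + 1"] True m(2) a(2)
      by (simp add: algebra_simps) (smt (verit) mult_nonneg_nonneg)
    thus ?thesis using True by simp
  next
    case nb: False
    show ?thesis
    proof (cases "m = 0")
      case False
      have "0 \<le> m * b * (a * b - m)" using q[of b m] by (simp add: algebra_simps power2_eq_square)
      moreover have "m * b > 0" using False nb m(2) b(2) by simp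
      ultimately show ?thesis by (simp add: zero_le_mult_iff)
    qed (use a b in simp)
  qed
  thus ?thesis by (simp add: a_def b_def m_def)
qed

text \<open>The inequalities for the 2 x 2 minors, summed over all pairs of indices, give the square
  of the trace. For a state this bounds the purity by 1.\<close>

lemma pos_semidef_hs_norm2_le:
  assumes A: "pos_semidef d A"
  shows "hs_norm2 A \<le> (Re (mtrace A))\<^sup>2"
proof -
  have c: "A \<in> carrier_mat d d" using A by (rule pos_semidef_carrier)
  have "hs_norm2 A \<le> (\<Sum>i<d. \<Sum>j<d. Re (A $$ (i, i)) * Re (A $$ (j, j)))"
    unfolding hs_norm2_def using c pos_semidef_minor[OF A] by (auto intro!: sum_mono)
  also have "\<dots> = (Re (mtrace A))\<^sup>2"
    using c by (auto simp: mtrace_def power2_eq_square sum_product)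
  finally show ?thesis .
qed

section \<open>Single-qubit channels\<close>

definition mat_unit :: "nat \<Rightarrow> nat \<Rightarrow> nat \<Rightarrow> complex mat" where
  "mat_unit d a b = mat d d (\<lambda>(i, j). if i = a \<and> j = b then 1 else 0)"

lemma mat_unit_carrier [simp]: "mat_unit d a b \<in> carrier_mat d d"
  by (simp add: mat_unit_def)

lemma less_2_cases: "(i::nat) < 2 \<longleftrightarrow> i = 0 \<or> i = 1" by auto

lemma sum_lessThan_2: "(\<Sum>i<2. f i) = f 0 + f (1::nat)" for f :: "nat \<Rightarrow> 'a :: comm_monoid_add"
  by (simp add: numeral_2_eq_2)

lemma channel_carrier: "qubit_channel N \<Longrightarrow> X \<in> carrier_mat 2 2 \<Longrightarrow> N X \<in> carrier_mat 2 2"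
  unfolding qubit_channel_def by blast

lemma channel_entry:
  assumes N: "qubit_channel N" and A: "A \<in> carrier_mat 2 2" and xy: "x < 2" "y < 2"
  shows "N A $$ (x, y) = (\<Sum>a<2. \<Sum>b<2. A $$ (a, b) * N (mat_unit 2 a b) $$ (x, y))"
proof -
  let ?E = "\<lambda>a b. mat_unit 2 a b" and ?s = "\<lambda>a b. A $$ (a, b) \<cdot>\<^sub>m mat_unit 2 a b"
  have eq: "A = (?s 0 0 + ?s 0 1) + (?s 1 0 + ?s 1 1)"
    using A by (intro eq_matI) (auto simp: mat_unit_def less_2_cases)
  have add: "N (X + Y) = N X + N Y" if "X \<in> carrier_mat 2 2" "Y \<in> carrier_mat 2 2" for X Y
    using N that unfolding qubit_channel_def by blast
  have scale: "N (z \<cdot>\<^sub>m X) = z \<cdot>\<^sub>m N X" if "X \<in> carrier_mat 2 2" for X z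
    using N that unfolding qubit_channel_def by blast
  have "N A = (A $$ (0, 0) \<cdot>\<^sub>m N (?E 0 0) + A $$ (0, 1) \<cdot>\<^sub>m N (?E 0 1)) + (A $$ (1, 0) \<cdot>\<^sub>m N (?E 1 0) + A $$ (1, 1) \<cdot>\<^sub>m N (?E 1 1))"
    by (subst eq) (simp add: add scale)
  moreover have "N (?E a b) \<in> carrier_mat 2 2" for a b by (simp add: channel_carrier[OF N])
  hence "dim_row (N (?E a b)) = 2" "dim_col (N (?E a b)) = 2" for a b by auto
  ultimately show ?thesis using xy by (simp add: sum_lessThan_2)
qed

text \<open>The squared Hilbert-Schmidt norm of \<open>N\<close> as a linear map on operators,
  written in the basis of matrix units.\<close>

definition channel_norm :: "(complex mat \<Rightarrow> complex mat) \<Rightarrow> real" where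
  "channel_norm N = (\<Sum>a<2. \<Sum>b<2. hs_norm2 (N (mat_unit 2 a b)))"

text \<open>Orthonormality of a full family says that a square matrix has a left inverse; that this
  is also a right inverse is the completeness relation.\<close>

lemma orthonormal_complete:
  assumes q: "orthonormal_on D D q" and uv: "u < D" "v < D"
  shows "(\<Sum>\<alpha><D. q \<alpha> u * cnj (q \<alpha> v)) = (if u = v then 1 else 0)"
proof -
  define A where "A = mat D D (\<lambda>(\<alpha>, u). cnj (q \<alpha> u))"
  define B where "B = mat D D (\<lambda>(u, \<alpha>). q \<alpha> u)"
  have c: "A \<in> carrier_mat D D" "B \<in> carrier_mat D D" by (auto simp: A_def B_def)
  have "A * B = 1\<^sub>m D"
  proof (rule eq_matI)
    fix i j assume "i < dim_row (1\<^sub>m D :: complex mat)" "j < dim_col (1\<^sub>m D :: complex mat)"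
    hence ij: "i < D" "j < D" by auto
    show "(A * B) $$ (i, j) = 1\<^sub>m D $$ (i, j)"
      unfolding mult_index[OF c ij] using ij q by (auto simp: A_def B_def orthonormal_on_def)
  qed (use c in auto)
  hence "B * A = 1\<^sub>m D" using mat_mult_left_right_inverse[OF c] by simp
  moreover have "(B * A) $$ (u, v) = (\<Sum>\<alpha><D. q \<alpha> u * cnj (q \<alpha> v))"
    unfolding mult_index[OF c(2,1) uv] using uv by (auto simp: A_def B_def intro!: sum.cong)
  ultimately show ?thesis using uv by simp
qed

text \<open>After expanding \<open>P k\<close> in matrix units, the double sum over coefficients
  collapses by the completeness relation. The basis to be used consists of conjugated Pauli
  matrices, adapted to the normal form.\<close>

lemma channel_norm_orthonormal:
  assumes N: "qubit_channel N" and P: "hs_orthonormal 2 4 P"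
  shows "channel_norm N = (\<Sum>k<4. hs_norm2 (N (P k)))"
proof -
  let ?n = "\<lambda>u x y. N (mat_unit 2 (u div 2) (u mod 2)) $$ (x, y)"
  define p where "p = (\<lambda>k u. P k $$ (u div 2, u mod 2))"
  have Pc: "P k \<in> carrier_mat 2 2" if "k < 4" for k using P that by (simp add: hs_orthonormal_def)
  have p: "orthonormal_on 4 4 p" using P unfolding hs_orthonormal_iff p_def by simp
  have hsN: "hs_norm2 (N X) = (\<Sum>x<2. \<Sum>y<2. (cmod (N X $$ (x, y)))\<^sup>2)" if "X \<in> carrier_mat 2 2" for X
    using channel_carrier[OF N that] unfolding hs_norm2_def by auto
  have entry: "N (P k) $$ (x, y) = (\<Sum>u<4. p k u * ?n u x y)" if "k < 4" "x < 2" "y < 2" for k x y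
    using sum_div_mod[of "\<lambda>u. p k u * ?n u x y" 2 2] unfolding channel_entry[OF N Pc[OF that(1)] that(2,3)]
    by (simp add: p_def)
  have key: "(\<Sum>k<4. (cmod (N (P k) $$ (x, y)))\<^sup>2) = (\<Sum>u<4. (cmod (?n u x y))\<^sup>2)" if xy: "x < 2" "y < 2" for x y
  proof -
    have "complex_of_real (\<Sum>k<4. (cmod (N (P k) $$ (x, y)))\<^sup>2) =
        (\<Sum>k<4. \<Sum>u<4. \<Sum>v<4. ?n u x y * cnj (?n v x y) * (p k u * cnj (p k v)))"
      unfolding of_real_sum complex_norm_square
      by (intro sum.cong refl) (simp add: entry xy sum_product, simp only: mult_ac)
    also have "\<dots> = (\<Sum>u<4. \<Sum>v<4. \<Sum>k<4. ?n u x y * cnj (?n v x y) * (p k u * cnj (p k v)))"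
      by (subst sum.swap, rule sum.cong[OF refl], rule sum.swap)
    also have "\<dots> = (\<Sum>u<4. \<Sum>v<4. ?n u x y * cnj (?n v x y) * (if u = v then 1 else 0))"
      by (intro sum.cong refl) (simp add: orthonormal_complete[OF p] flip: sum_distrib_left)
    also have "\<dots> = (\<Sum>u<4. ?n u x y * cnj (?n u x y))"
      by (simp only: sum_mult_delta finite_lessThan) (auto intro!: sum.cong)
    also have "\<dots> = complex_of_real (\<Sum>u<4. (cmod (?n u x y))\<^sup>2)"
      by (simp only: of_real_sum complex_norm_square)
    finally show ?thesis by (simp only: of_real_eq_iff)
  qed
  have "(\<Sum>k<4. hs_norm2 (N (P k))) = (\<Sum>k<4. \<Sum>x<2. \<Sum>y<2. (cmod (N (P k) $$ (x, y)))\<^sup>2)"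
    by (intro sum.cong refl hsN Pc) auto
  also have "\<dots> = (\<Sum>x<2. \<Sum>y<2. \<Sum>k<4. (cmod (N (P k) $$ (x, y)))\<^sup>2)"
    by (subst sum.swap, rule sum.cong[OF refl], rule sum.swap)
  also have "\<dots> = (\<Sum>x<2. \<Sum>y<2. \<Sum>u<4. (cmod (?n u x y))\<^sup>2)" using key by simp
  also have "\<dots> = (\<Sum>u<4. \<Sum>x<2. \<Sum>y<2. (cmod (?n u x y))\<^sup>2)"
    by (rule sym, subst sum.swap, rule sum.cong[OF refl], rule sum.swap)
  also have "\<dots> = (\<Sum>u<2 * 2. hs_norm2 (N (mat_unit 2 (u div 2) (u mod 2))))" by (simp add: hsN)
  also have "\<dots> = channel_norm N" unfolding sum_div_mod channel_norm_def by simp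
  finally show ?thesis by simp
qed

lemma square_carrier [simp]:
  "A \<in> carrier_mat d d \<Longrightarrow> B \<in> carrier_mat d d \<Longrightarrow> A * B \<in> carrier_mat d d"
  "C \<in> carrier_mat d d \<Longrightarrow> mat_adjoint C \<in> carrier_mat d d"
  by auto

lemma mat_adjoint_mult:
  fixes A :: "complex mat"
  assumes "A \<in> carrier_mat m n" "B \<in> carrier_mat n k"
  shows "mat_adjoint (A * B) = mat_adjoint B * mat_adjoint A"
proof (rule eq_matI)
  fix i j assume "i < dim_row (mat_adjoint B * mat_adjoint A)" "j < dim_col (mat_adjoint B * mat_adjoint A)"
  hence ij: "i < k" "j < m" using assms by auto
  have "mat_adjoint (A * B) $$ (i, j) = cnj ((A * B) $$ (j, i))" using assms ij by (subst adjoint_index) auto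
  also have "\<dots> = (mat_adjoint B * mat_adjoint A) $$ (i, j)"
    unfolding mult_index[OF assms ij(2,1)]
    by (subst mult_index[of _ k n _ m]) (use assms ij in \<open>auto simp: mult.commute intro!: sum.cong\<close>)
  finally show "mat_adjoint (A * B) $$ (i, j) = (mat_adjoint B * mat_adjoint A) $$ (i, j)" .
qed (use assms in auto)

lemma mat_adjoint_adjoint [simp]: "mat_adjoint (mat_adjoint A) = A" for A :: "complex mat"
  by (rule eq_matI) auto

lemma unitaryD:
  assumes "unitary_mat d U"
  shows "U \<in> carrier_mat d d" "mat_adjoint U \<in> carrier_mat d d"
    "mat_adjoint U * U = 1\<^sub>m d" "U * mat_adjoint U = 1\<^sub>m d"
  using assms unfolding unitary_mat_def by auto

lemma unitary_mult:
  assumes "unitary_mat d U" "unitary_mat d V"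
  shows "unitary_mat d (U * V)"
proof -
  note U = unitaryD[OF assms(1)] and V = unitaryD[OF assms(2)]
  have "mat_adjoint V * mat_adjoint U * (U * V) = mat_adjoint V * (mat_adjoint U * U) * V"
    using U(1,2) V(1,2) by (simp add: assoc_mult_mat[of _ d d _ d _ d])
  moreover have "U * V * (mat_adjoint V * mat_adjoint U) = U * (V * mat_adjoint V) * mat_adjoint U"
    using U(1,2) V(1,2) by (simp add: assoc_mult_mat[of _ d d _ d _ d])
  ultimately show ?thesis unfolding unitary_mat_def mat_adjoint_mult[OF U(1) V(1)] using U V by auto
qed

lemma hs_inner_conjugate:
  assumes U: "unitary_mat d U" and A: "A \<in> carrier_mat d d" and B: "B \<in> carrier_mat d d"
  shows "mtrace (mat_adjoint (U * A * mat_adjoint U) * (U * B * mat_adjoint U)) = mtrace (mat_adjoint A * B)"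
proof -
  note U = unitaryD[OF U]
  note as = assoc_mult_mat[of _ d d _ d _ d]
  have "mat_adjoint (U * A * mat_adjoint U) * (U * B * mat_adjoint U) =
      U * mat_adjoint A * (mat_adjoint U * U) * B * mat_adjoint U"
    using U(1,2) A B by (simp add: mat_adjoint_mult[of _ d d _ d] as)
  also have "\<dots> = U * (mat_adjoint A * B * mat_adjoint U)" using U A B by (simp add: as)
  finally have eq: "mat_adjoint (U * A * mat_adjoint U) * (U * B * mat_adjoint U) =
      U * (mat_adjoint A * B * mat_adjoint U)" .
  have "mtrace (mat_adjoint (U * A * mat_adjoint U) * (U * B * mat_adjoint U)) =
      mtrace (mat_adjoint A * B * mat_adjoint U * U)"
    unfolding eq using U(1,2) A B by (intro mtrace_comm[of U d d]) auto
  also have "mat_adjoint A * B * mat_adjoint U * U = mat_adjoint A * B" using U A B by (simp add: as)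
  finally show ?thesis .
qed

lemma hs_norm2_trace: "A \<in> carrier_mat d d \<Longrightarrow> complex_of_real (hs_norm2 A) = mtrace (mat_adjoint A * A)"
  unfolding hs_inner_product[of A d A] sum_div_mod hs_norm2_def
  by (auto simp: complex_norm_square mult.commute simp del: of_real_power)

lemma hs_norm2_conjugate:
  assumes "unitary_mat d U" "A \<in> carrier_mat d d"
  shows "hs_norm2 (U * A * mat_adjoint U) = hs_norm2 A"
proof -
  have "U * A * mat_adjoint U \<in> carrier_mat d d" using assms unitaryD[OF assms(1)] by simp
  hence "complex_of_real (hs_norm2 (U * A * mat_adjoint U)) = complex_of_real (hs_norm2 A)"
    by (simp only: hs_norm2_trace[OF assms(2)] hs_norm2_trace hs_inner_conjugate[OF assms assms(2)])
  thus ?thesis by simp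
qed

section \<open>The normal form of a qubit channel\<close>

no_notation vec_index (infixl "$" 100)

definition bloch_vec :: "real^3 \<Rightarrow> complex mat" where
  "bloch_vec v = bloch (v $ 1) (v $ 2) (v $ 3)"

lemma bloch_carrier [simp]: "bloch x y z \<in> carrier_mat 2 2"
  by (auto simp: bloch_def pauli_X_def pauli_Y_def pauli_Z_def mat_of_rows_list_def)

lemma bloch_vec_carrier [simp]: "bloch_vec v \<in> carrier_mat 2 2"
  by (simp add: bloch_vec_def)

lemma bloch_index:
  "bloch x y z $$ (0, 0) = complex_of_real ((1 + z) / 2)"
  "bloch x y z $$ (0, 1) = Complex (x / 2) (- y / 2)"
  "bloch x y z $$ (1, 0) = Complex (x / 2) (y / 2)"
  "bloch x y z $$ (1, 1) = complex_of_real ((1 - z) / 2)"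
  by (auto simp: bloch_def pauli_X_def pauli_Y_def pauli_Z_def mat_of_rows_list_def complex_eq_iff)

lemma mat2_eqI:
  assumes "A \<in> carrier_mat 2 2" "B \<in> carrier_mat 2 2"
    "A $$ (0, 0) = B $$ (0, 0)" "A $$ (0, 1) = B $$ (0, 1)" "A $$ (1, 0) = B $$ (1, 0)" "A $$ (1, 1) = B $$ (1, 1)"
  shows "A = B"
  using assms by (intro eq_matI) (auto simp: less_2_cases)

lemma mult2_index:
  assumes "A \<in> carrier_mat 2 2" "B \<in> carrier_mat 2 2" "i < 2" "j < 2"
  shows "(A * B) $$ (i, j) = A $$ (i, 0) * B $$ (0, j) + A $$ (i, 1) * B $$ (1, j)"
  using mult_index[OF assms] by (simp add: sum_lessThan_2)

text \<open>Matrices of this shape are closed under products, adjoints and linear combinations, so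
  identities between 2 x 2 matrices reduce by rewriting to four scalar equations.\<close>

definition mat2 :: "complex \<Rightarrow> complex \<Rightarrow> complex \<Rightarrow> complex \<Rightarrow> complex mat" where
  "mat2 a b c d = mat 2 2 (\<lambda>(i, j). if i = 0 then if j = 0 then a else b else if j = 0 then c else d)"

lemma mat2_carrier [simp]: "mat2 a b c d \<in> carrier_mat 2 2"
  by (simp add: mat2_def)

lemma mat2_eta: "A \<in> carrier_mat 2 2 \<Longrightarrow> A = mat2 (A $$ (0, 0)) (A $$ (0, 1)) (A $$ (1, 0)) (A $$ (1, 1))"
  by (rule mat2_eqI) (auto simp: mat2_def)

lemma mat2_mult: "mat2 a b c d * mat2 a' b' c' d' = mat2 (a * a' + b * c') (a * b' + b * d') (c * a' + d * c') (c * b' + d * d')"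
  by (rule mat2_eqI; (simp del: index_mult_mat(1))?; subst mult2_index; simp add: mat2_def)

lemma mat2_adjoint: "mat_adjoint (mat2 a b c d) = mat2 (cnj a) (cnj c) (cnj b) (cnj d)"
  by (rule mat2_eqI) (auto simp: mat2_def)

lemma mat2_one: "1\<^sub>m 2 = mat2 1 0 0 1"
  by (rule mat2_eqI) (auto simp: mat2_def)

lemma bloch_mat2: "bloch x y z =
    mat2 (complex_of_real ((1 + z) / 2)) (Complex (x / 2) (- y / 2)) (Complex (x / 2) (y / 2)) (complex_of_real ((1 - z) / 2))"
  by (rule mat2_eqI) (simp_all add: bloch_index mat2_def del: One_nat_def)

section \<open>Rotations of the Bloch ball and their unitary lifts\<close>

definition rot_z :: "real \<Rightarrow> real^3^3" where
  "rot_z t = vector [vector [cos t, - sin t, 0], vector [sin t, cos t, 0], vector [0, 0, 1]]"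

definition rot_y :: "real \<Rightarrow> real^3^3" where
  "rot_y t = vector [vector [cos t, 0, sin t], vector [0, 1, 0], vector [- sin t, 0, cos t]]"

text \<open>The unitary lift is part of the notion. It confines the matrices to proper rotations,
  since no conjugation by a unitary induces a reflection. The singular value decomposition is
  therefore built from elementary rotations, whose lifts are explicit.\<close>

definition bloch_rotation :: "real^3^3 \<Rightarrow> bool" where
  "bloch_rotation R \<longleftrightarrow> transpose R ** R = Finite_Cartesian_Product.mat 1 \<and>
     (\<exists>U. unitary_mat 2 U \<and> (\<forall>v. U * bloch_vec v * mat_adjoint U = bloch_vec (R *v v)))"

lemma bloch_rotation_orth:
  assumes "bloch_rotation R"
  shows "transpose R ** R = Finite_Cartesian_Product.mat 1" "R ** transpose R = Finite_Cartesian_Product.mat 1"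
  using assms matrix_left_right_inverse unfolding bloch_rotation_def by blast+

lemma bloch_rotation_mult:
  assumes "bloch_rotation R" "bloch_rotation S"
  shows "bloch_rotation (R ** S)"
proof -
  obtain U V where U: "unitary_mat 2 U" "\<And>v. U * bloch_vec v * mat_adjoint U = bloch_vec (R *v v)"
    and V: "unitary_mat 2 V" "\<And>v. V * bloch_vec v * mat_adjoint V = bloch_vec (S *v v)"
    using assms unfolding bloch_rotation_def by blast
  note c = unitaryD(1,2)[OF U(1)] unitaryD(1,2)[OF V(1)]
  have "U * V * bloch_vec v * mat_adjoint (U * V) = bloch_vec (R ** S *v v)" for v
  proof -
    have "U * V * bloch_vec v * mat_adjoint (U * V) = U * (V * bloch_vec v * mat_adjoint V) * mat_adjoint U"
      using c by (simp add: mat_adjoint_mult[of _ 2 2 _ 2] assoc_mult_mat[of _ 2 2 _ 2 _ 2])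
    thus ?thesis by (simp add: U V matrix_vector_mul_assoc)
  qed
  moreover have "transpose (R ** S) ** (R ** S) = transpose S ** (transpose R ** R) ** S"
    by (simp add: matrix_transpose_mul matrix_mul_assoc)
  ultimately show ?thesis using unitary_mult[OF U(1) V(1)] bloch_rotation_orth(1)[OF assms(1)] bloch_rotation_orth(1)[OF assms(2)]
    unfolding bloch_rotation_def by auto
qed

lemma bloch_rotation_z: "bloch_rotation (rot_z t)"
  unfolding bloch_rotation_def
\<comment> \<open>The lift is exp(- \<i> t Z / 2), with half the angle because the conjugation
  applies each phase twice.\<close>
proof (intro conjI exI[of _ "mat2 (cis (- t / 2)) 0 0 (cis (t / 2))"] allI)
  show "transpose (rot_z t) ** rot_z t = Finite_Cartesian_Product.mat 1"
    by (simp only: Finite_Cartesian_Product.vec_eq_iff forall_3) (simp add: matrix_matrix_mult_def sum_3 Finite_Cartesian_Product.transpose_def rot_z_def Finite_Cartesian_Product.mat_def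
        power2_eq_square[symmetric])
  let ?U = "mat2 (cis (- t / 2)) 0 0 (cis (t / 2))"
  show "unitary_mat 2 ?U"
    unfolding unitary_mat_def by (simp add: mat2_adjoint mat2_mult mat2_one cis_cnj cis_mult)
  fix v :: "real^3"
  have c: "cis (- t / 2) * cis (- t / 2) = cis (- t)" "cis (t / 2) * cis (t / 2) = cis t"
    by (simp_all add: cis_mult)
  have d: "cis (- t / 2) * z * cis (- t / 2) = cis (- t) * z" "cis (t / 2) * z * cis (t / 2) = cis t * z" for z
    unfolding c[symmetric] by (simp_all only: mult_ac)
  have e: "cis (- t / 2) * z * cis (t / 2) = z" "cis (t / 2) * z * cis (- t / 2) = z" for z
    by (simp_all add: mult.commute[of _ z] mult.assoc cis_mult)
  have cn: "cnj (cis (- t / 2)) = cis (t / 2)" "cnj (cis (t / 2)) = cis (- t / 2)" by (simp_all add: cis_cnj)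
  have "?U * bloch_vec v * mat_adjoint ?U = mat2 (complex_of_real ((1 + v $ 3) / 2)) (cis (- t) * Complex (v $ 1 / 2) (- v $ 2 / 2))
      (cis t * Complex (v $ 1 / 2) (v $ 2 / 2)) (complex_of_real ((1 - v $ 3) / 2))"
    unfolding bloch_vec_def bloch_mat2 mat2_adjoint mat2_mult cn
    by (simp only: mult_zero_left mult_zero_right add_0_left add_0_right complex_cnj_zero d e)
  also have "\<dots> = bloch_vec (rot_z t *v v)"
    unfolding bloch_vec_def bloch_mat2 by (intro arg_cong4[where f = mat2])
      (simp_all add: matrix_vector_mult_def sum_3 rot_z_def complex_eq_iff algebra_simps add_divide_distrib diff_divide_distrib)
  finally show "?U * bloch_vec v * mat_adjoint ?U = bloch_vec (rot_z t *v v)" .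
qed

lemma bloch_rotation_y: "bloch_rotation (rot_y t)"
  unfolding bloch_rotation_def
\<comment> \<open>The lift exp(- \<i> t Y / 2) is a real rotation by half the angle.\<close>
proof (intro conjI exI[of _ "mat2 (complex_of_real (cos (t / 2))) (- complex_of_real (sin (t / 2))) (complex_of_real (sin (t / 2))) (complex_of_real (cos (t / 2)))"] allI)
  show "transpose (rot_y t) ** rot_y t = Finite_Cartesian_Product.mat 1"
    by (simp only: Finite_Cartesian_Product.vec_eq_iff forall_3) (simp add: matrix_matrix_mult_def sum_3 Finite_Cartesian_Product.transpose_def rot_y_def Finite_Cartesian_Product.mat_def
        power2_eq_square[symmetric])
  define c s where "c = cos (t / 2)" and "s = sin (t / 2)"
  have cs: "c * c + s * s = 1" "cos t = c * c - s * s" "sin t = 2 * s * c"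
    using cos_double[of "t / 2"] sin_double[of "t / 2"] sin_cos_squared_add3[of "t / 2"]
    by (simp_all add: c_def s_def power2_eq_square)
  let ?U = "mat2 (complex_of_real (cos (t / 2))) (- complex_of_real (sin (t / 2))) (complex_of_real (sin (t / 2))) (complex_of_real (cos (t / 2)))"
  show "unitary_mat 2 ?U"
    unfolding unitary_mat_def c_def[symmetric] s_def[symmetric]
    using cs(1) by (simp add: mat2_adjoint mat2_mult mat2_one flip: of_real_mult of_real_add)
      (simp add: add.commute)
  fix v :: "real^3"
  define H X Y Z where "H = (1 / 2 :: real)" and "X = v $ 1 / 2" and "Y = v $ 2 / 2" and "Z = v $ 3 / 2"
  have b: "bloch_vec v = mat2 (complex_of_real (H + Z)) (Complex X (- Y)) (Complex X Y) (complex_of_real (H - Z))"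
    unfolding bloch_vec_def bloch_mat2 H_def X_def Y_def Z_def by (simp add: add_divide_distrib diff_divide_distrib)
  have b': "bloch_vec (rot_y t *v v) =
      mat2 (complex_of_real (H + ((c * c - s * s) * Z - 2 * s * c * X)))
        (Complex ((c * c - s * s) * X + 2 * s * c * Z) (- Y))
        (Complex ((c * c - s * s) * X + 2 * s * c * Z) Y)
        (complex_of_real (H - ((c * c - s * s) * Z - 2 * s * c * X)))"
    unfolding bloch_vec_def bloch_mat2 H_def X_def Y_def Z_def
    by (intro arg_cong4[where f = mat2])
      (simp_all add: matrix_vector_mult_def sum_3 rot_y_def complex_eq_iff cs add_divide_distrib diff_divide_distrib)
  have h: "H * (c * c) + H * (s * s) = H" "Y * (c * c) + Y * (s * s) = Y"
    by (simp_all add: cs flip: distrib_left)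
  show "?U * bloch_vec v * mat_adjoint ?U = bloch_vec (rot_y t *v v)"
    unfolding c_def[symmetric] s_def[symmetric] b b' mat2_adjoint mat2_mult
  proof (intro arg_cong4[where f = mat2] complex_eqI)
  qed (insert h, simp_all add: algebra_simps)
qed

text \<open>Spherical coordinates: \<open>t\<close> is the polar angle and \<open>p\<close> the
  azimuth of \<open>w\<close>. At a pole the azimuth is undetermined and set to 0.\<close>

lemma bloch_rotation_onto_sphere:
  assumes "norm (w :: real^3) = 1"
  obtains R where "bloch_rotation R" "R *v axis 3 1 = w"
proof -
  have w: "(w $ 1)\<^sup>2 + (w $ 2)\<^sup>2 + (w $ 3)\<^sup>2 = 1"
    using assms by (simp add: norm_eq_1 inner_vec_def sum_3 power2_eq_square)
  define s where "s = sqrt ((w $ 1)\<^sup>2 + (w $ 2)\<^sup>2)"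
  have s2: "s\<^sup>2 = (w $ 1)\<^sup>2 + (w $ 2)\<^sup>2" by (simp add: s_def)
  have "(w $ 3)\<^sup>2 + s\<^sup>2 = 1" unfolding s2 using w by simp
  then obtain t where t: "w $ 3 = cos t" "s = sin t" using sincos_total_2pi by metis
  obtain p where p: "w $ 1 = s * cos p" "w $ 2 = s * sin p"
  proof (cases "s = 0")
    case True
    hence "w $ 1 = 0" "w $ 2 = 0" using s2 by (simp_all add: sum_power2_eq_zero_iff)
    thus thesis using True that[of 0] by simp
  next
    case False
    have "(w $ 1 / s)\<^sup>2 + (w $ 2 / s)\<^sup>2 = 1"
      unfolding power_divide add_divide_distrib[symmetric] s2[symmetric] using False by simp
    then obtain p where "w $ 1 / s = cos p" "w $ 2 / s = sin p" using sincos_total_2pi by metis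
    thus thesis using False by (intro that[of p]) (auto simp: field_simps)
  qed
  show thesis
  proof (rule that[of "rot_z p ** rot_y t"])
    show "bloch_rotation (rot_z p ** rot_y t)"
      by (intro bloch_rotation_mult bloch_rotation_z bloch_rotation_y)
    have "rot_y t *v axis 3 1 = vector [sin t, 0, cos t]"
      by (simp only: Finite_Cartesian_Product.vec_eq_iff forall_3)
        (simp add: matrix_vector_mult_def sum_3 rot_y_def axis_def)
    moreover have "rot_z p *v vector [sin t, 0, cos t] = w"
      by (simp only: Finite_Cartesian_Product.vec_eq_iff forall_3)
        (simp add: matrix_vector_mult_def sum_3 rot_z_def p t)
    ultimately show "rot_z p ** rot_y t *v axis 3 1 = w" by (simp flip: matrix_vector_mul_assoc)
  qed
qed

section \<open>Singular value decomposition of a real 3 x 3 matrix by rotations\<close>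

lemma quadratic_dominated_linear_zero:
  fixes b c :: real
  assumes "\<And>t. 2 * t * b + t\<^sup>2 * c \<le> 0"
  shows "b = 0"
proof (rule ccontr)
  assume b: "b \<noteq> 0"
  \<comment> \<open>At t = b / k the linear term 2 t b outweighs t^2 c, because the modulus of c is
    less than k.\<close>
  define k where "k = \<bar>c\<bar> + 1"
  have k: "k \<noteq> 0" by (simp add: k_def add_nonneg_eq_0_iff)
  have "2 * (b / k) * b + (b / k)\<^sup>2 * c = (b\<^sup>2 / k) * (2 + c / k)"
    using k by (simp add: power2_eq_square field_simps)
  moreover have "b\<^sup>2 / k > 0" using b by (simp add: k_def)
  moreover have "2 + c / k > 0"
  proof -
    have "k > 0" "- k \<le> c" by (auto simp: k_def)
    hence "- 1 \<le> c / k" by (simp add: field_simps)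
    thus ?thesis by simp
  qed
  ultimately have "2 * (b / k) * b + (b / k)\<^sup>2 * c > 0" by (simp only: mult_pos_pos)
  thus False using assms[of "b / k"] by simp
qed

text \<open>Let \<open>v\<close> maximize the norm of M v on the unit sphere. Along v + t w with w
  orthogonal to v the length changes only to second order in t, so the first-order change of the
  norm of the image must vanish; this is orthogonality of the images. A maximum of 0 forces M =
  0.\<close>

lemma maximal_stretch_direction:
  fixes M :: "real^3^3"
  obtains v where "norm v = 1" "\<And>w. v \<bullet> w = 0 \<Longrightarrow> (M *v v) \<bullet> (M *v w) = 0"
    "M *v v = 0 \<Longrightarrow> \<forall>w. M *v w = 0"
proof -
  have "compact (sphere 0 1 :: (real^3) set)" by simp
  moreover have "axis 1 1 \<in> (sphere 0 1 :: (real^3) set)" by (simp add: norm_axis_1)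
  hence "sphere 0 1 \<noteq> ({} :: (real^3) set)" by blast
  moreover have "continuous_on (sphere 0 1) (\<lambda>v. norm (M *v v))"
    by (intro continuous_intros linear_continuous_on matrix_vector_mul_bounded_linear)
  ultimately obtain v where v: "v \<in> sphere 0 1" and max: "\<And>w. w \<in> sphere 0 1 \<Longrightarrow> norm (M *v w) \<le> norm (M *v v)"
    using continuous_attains_sup[of "sphere 0 1 :: (real^3) set" "\<lambda>v. norm (M *v v)"] by blast
  have nv: "norm v = 1" using v by simp
  have bound: "norm (M *v w) \<le> norm (M *v v) * norm w" for w
  proof (cases "w = 0")
    case False
    have "norm (M *v ((1 / norm w) *\<^sub>R w)) \<le> norm (M *v v)" using False by (intro max) simp
    thus ?thesis using False by (simp add: matrix_vector_mult_scaleR field_simps)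
  qed simp
  show thesis
  proof (rule that[OF nv])
    fix w assume vw: "v \<bullet> w = 0"
    show "(M *v v) \<bullet> (M *v w) = 0"
    proof (rule quadratic_dominated_linear_zero)
      fix t :: real
      have "(norm (M *v (v + t *\<^sub>R w)))\<^sup>2 \<le> (norm (M *v v) * norm (v + t *\<^sub>R w))\<^sup>2"
        by (intro power_mono bound) simp
      also have "(norm (M *v v) * norm (v + t *\<^sub>R w))\<^sup>2 = (norm (M *v v))\<^sup>2 * (1 + t\<^sup>2 * (norm w)\<^sup>2)"
      proof -
        have "(norm (v + t *\<^sub>R w))\<^sup>2 = 1 + t\<^sup>2 * (norm w)\<^sup>2"
        proof -
          have "(norm (v + t *\<^sub>R w))\<^sup>2 = v \<bullet> v + 2 * t * (v \<bullet> w) + t\<^sup>2 * (w \<bullet> w)"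
            unfolding power2_norm_eq_inner
            by (simp add: inner_simps inner_commute[of w v] power2_eq_square algebra_simps)
          thus ?thesis using nv vw by (simp flip: power2_norm_eq_inner)
        qed
        thus ?thesis by (simp add: power_mult_distrib)
      qed
      also have "(norm (M *v (v + t *\<^sub>R w)))\<^sup>2 =
          (norm (M *v v))\<^sup>2 + 2 * t * ((M *v v) \<bullet> (M *v w)) + t\<^sup>2 * (norm (M *v w))\<^sup>2"
        unfolding power2_norm_eq_inner
        by (simp add: matrix_vector_right_distrib matrix_vector_mult_scaleR inner_simps
            inner_commute[of "M *v w" "M *v v"] power2_eq_square algebra_simps)
      finally show "2 * t * ((M *v v) \<bullet> (M *v w)) + t\<^sup>2 * ((norm (M *v w))\<^sup>2 - (norm (M *v v))\<^sup>2 * (norm w)\<^sup>2) \<le> 0"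
        by (simp add: algebra_simps)
    qed
  next
    assume M0: "M *v v = 0"
    show "\<forall>w. M *v w = 0"
    proof
      fix w show "M *v w = 0" using bound[of w] M0 by simp
    qed
  qed
qed

text \<open>A solution of tan t = x / y in a form that covers y = 0.\<close>

lemma angle_ratio: "\<exists>t. x * cos t = y * sin t" for x y :: real
proof (cases "x = 0 \<and> y = 0")
  case False
  define r where "r = sqrt (y\<^sup>2 + x\<^sup>2)"
  have r: "r\<^sup>2 = y\<^sup>2 + x\<^sup>2" "r \<noteq> 0" using False by (auto simp: r_def add_nonneg_eq_0_iff)
  have "(y / r)\<^sup>2 + (x / r)\<^sup>2 = 1"
    unfolding power_divide add_divide_distrib[symmetric] r(1)[symmetric] using r(2) by simp
  then obtain t where "y / r = cos t" "x / r = sin t" using sincos_total_2pi by metis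
  hence "x * cos t = x * (y / r)" "y * sin t = y * (x / r)" by simp_all
  thus ?thesis by (intro exI[of _ t]) simp
qed simp

text \<open>The two expressions are the off-diagonal entries of the block with rows (p, q) and (r,
  s) after a rotation on each side. Their sum involves the angles only through a + b and their
  difference only through a - b, so the two conditions decouple.\<close>

lemma planar_diagonalization:
  fixes p q r s :: real
  obtains a b where "cos a * (q * cos b - p * sin b) + sin a * (s * cos b - r * sin b) = 0"
    "cos a * (r * cos b + s * sin b) - sin a * (p * cos b + q * sin b) = 0"
proof -
  obtain x where x: "(q + r) * cos x = (p - s) * sin x" using angle_ratio by blast
  obtain y where y: "(r - q) * cos y = (p + s) * sin y" using angle_ratio by blast
  define a b where "a = (x + y) / 2" and "b = (x - y) / 2"
  have xy: "x = a + b" "y = a - b" by (simp_all add: a_def b_def field_simps)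
  have 1: "(q + r) * (cos a * cos b - sin a * sin b) = (p - s) * (sin a * cos b + cos a * sin b)"
    using x unfolding xy by (simp add: cos_add sin_add)
  have 2: "(r - q) * (cos a * cos b + sin a * sin b) = (p + s) * (sin a * cos b - cos a * sin b)"
    using y unfolding xy by (simp add: cos_diff sin_diff)
  show thesis
  proof (rule that[of a b])
    show "cos a * (q * cos b - p * sin b) + sin a * (s * cos b - r * sin b) = 0"
      using 1 2 by (simp add: algebra_simps)
    show "cos a * (r * cos b + s * sin b) - sin a * (p * cos b + q * sin b) = 0"
      using 1 2 by (simp add: algebra_simps)
  qed
qed

lemma transpose_rot_z: "Finite_Cartesian_Product.transpose (rot_z t) = rot_z (- t)"
  by (simp only: Finite_Cartesian_Product.vec_eq_iff forall_3)
    (simp add: Finite_Cartesian_Product.transpose_def rot_z_def)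

definition diag3 :: "real \<Rightarrow> real \<Rightarrow> real \<Rightarrow> real^3^3" where
  "diag3 a b c = vector [vector [a, 0, 0], vector [0, b, 0], vector [0, 0, c]]"

text \<open>\<open>S\<close> turns the third axis into a direction of maximal stretch and
  \<open>R\<close> turns it into the direction of the image. Third row and column then vanish off
  the diagonal, and the remaining 2 x 2 block is diagonalized by rotations about the third axis. The
  diagonal entries may have any sign.\<close>

lemma rotation_diagonalization:
  fixes M :: "real^3^3"
  obtains R S a b c where "bloch_rotation R" "bloch_rotation S" "transpose R ** M ** S = diag3 a b c"
proof -
  obtain v where v: "norm v = 1" and orth: "\<And>w. v \<bullet> w = 0 \<Longrightarrow> (M *v v) \<bullet> (M *v w) = 0"
    and zero: "M *v v = 0 \<Longrightarrow> \<forall>w. M *v w = 0"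
    using maximal_stretch_direction[of M] by metis
  define s where "s = norm (M *v v)"
  \<comment> \<open>If the image of v is 0, any unit vector can serve as its direction.\<close>
  obtain w where w: "norm w = 1" "M *v v = s *\<^sub>R w"
  proof (cases "s = 0")
    case True
    thus thesis using that[of "axis 1 1"] by (simp add: s_def norm_axis_1)
  next
    case False
    thus thesis using that[of "(1 / s) *\<^sub>R (M *v v)"] by (simp add: s_def)
  qed
  obtain S where S: "bloch_rotation S" "S *v axis 3 1 = v" using bloch_rotation_onto_sphere[OF v] .
  obtain R where R: "bloch_rotation R" "R *v axis 3 1 = w" using bloch_rotation_onto_sphere[OF w(1)] .
  define P where "P = transpose R ** M ** S"
  have ent: "P $ i $ j = (R *v axis i 1) \<bullet> (M *v (S *v axis j 1))" for i j
  proof -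
    have "P $ i $ j = axis i 1 \<bullet> (P *v axis j 1)"
      by (simp add: inner_axis' matrix_vector_mult_basis column_def)
    also have "P *v axis j 1 = transpose R *v (M *v (S *v axis j 1))"
      unfolding P_def by (simp add: matrix_vector_mul_assoc matrix_mul_assoc)
    also have "axis i 1 \<bullet> \<dots> = (R *v axis i 1) \<bullet> (M *v (S *v axis j 1))"
      by (metis dot_lmul_matrix inner_commute transpose_matrix_vector vector_transpose_matrix transpose_transpose)
    finally show ?thesis .
  qed
  have Rinv: "(R *v x) \<bullet> (R *v y) = x \<bullet> y" if "bloch_rotation R" for R :: "real^3^3" and x y
  proof -
    have "orthogonal_matrix R" using bloch_rotation_orth[OF that] unfolding orthogonal_matrix_def by blast
    hence "orthogonal_transformation ((*v) R)" by (simp add: orthogonal_transformation_matrix)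
    thus ?thesis by (simp add: orthogonal_transformation_def)
  qed
  have ax: "axis i 1 \<bullet> (axis j 1 :: real^3) = (if i = j then 1 else 0)" for i j
    by (simp add: inner_axis_axis)
  have col: "P $ i $ 3 = 0" if "i \<noteq> 3" for i
    unfolding ent S w using that Rinv[OF R(1), of "axis i 1" "axis 3 1"] by (simp add: R ax)
  \<comment> \<open>Maximality enters here: the image of v is orthogonal to the images of the
    orthogonal complement of v. This says nothing about w when that image is 0, but then M =
    0.\<close>
  have row: "P $ 3 $ j = 0" if "j \<noteq> 3" for j
  proof (cases "s = 0")
    case True
    hence "M *v v = 0" by (simp add: s_def)
    thus ?thesis unfolding ent using zero by simp
  next
    case False
    have "v \<bullet> (S *v axis j 1) = 0"
      unfolding S(2)[symmetric] Rinv[OF S(1)] using that by (auto simp: ax)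
    from orth[OF this] have "s * (w \<bullet> (M *v (S *v axis j 1))) = 0" by (simp add: w)
    thus ?thesis unfolding ent R using False by simp
  qed
  obtain a b where ab: "cos a * (P $ 1 $ 2 * cos b - P $ 1 $ 1 * sin b) + sin a * (P $ 2 $ 2 * cos b - P $ 2 $ 1 * sin b) = 0"
    "cos a * (P $ 2 $ 1 * cos b + P $ 2 $ 2 * sin b) - sin a * (P $ 1 $ 1 * cos b + P $ 1 $ 2 * sin b) = 0"
    using planar_diagonalization .
  define Q where "Q = transpose (rot_z a) ** P ** rot_z b"
  have Q: "Q = diag3 (Q $ 1 $ 1) (Q $ 2 $ 2) (Q $ 3 $ 3)"
  proof -
    have "Q $ 1 $ 3 = 0" "Q $ 2 $ 3 = 0" "Q $ 3 $ 1 = 0" "Q $ 3 $ 2 = 0"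
      unfolding Q_def transpose_rot_z using col[of 1] col[of 2] row[of 1] row[of 2]
      by (simp_all add: matrix_matrix_mult_def sum_3 rot_z_def)
    moreover have "Q $ 1 $ 2 = 0" "Q $ 2 $ 1 = 0"
      unfolding Q_def transpose_rot_z using col[of 1] col[of 2] row[of 1] row[of 2] ab
      by (simp_all add: matrix_matrix_mult_def sum_3 rot_z_def algebra_simps)
    ultimately show ?thesis
      by (simp only: Finite_Cartesian_Product.vec_eq_iff forall_3) (simp add: diag3_def)
  qed
  show thesis
  proof (rule that)
    show "bloch_rotation (R ** rot_z a)" "bloch_rotation (S ** rot_z b)"
      by (intro bloch_rotation_mult R S bloch_rotation_z)+
    have "transpose (R ** rot_z a) ** M ** (S ** rot_z b) = Q"
      unfolding Q_def P_def by (simp add: matrix_transpose_mul matrix_mul_assoc)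
    thus "transpose (R ** rot_z a) ** M ** (S ** rot_z b) = diag3 (Q $ 1 $ 1) (Q $ 2 $ 2) (Q $ 3 $ 3)"
      using Q by simp
  qed
qed

lemma bloch_rotation_signs:
  "bloch_rotation (diag3 1 1 1)" "bloch_rotation (diag3 (- 1) (- 1) 1)"
  "bloch_rotation (diag3 (- 1) 1 (- 1))" "bloch_rotation (diag3 1 (- 1) (- 1))"
proof -
  have e: "diag3 1 1 1 = rot_z 0" "diag3 (- 1) (- 1) 1 = rot_z pi" "diag3 (- 1) 1 (- 1) = rot_y pi"
    "diag3 1 (- 1) (- 1) = rot_z pi ** rot_y pi"
    by (simp_all only: Finite_Cartesian_Product.vec_eq_iff forall_3)
      (simp_all add: diag3_def rot_z_def rot_y_def matrix_matrix_mult_def sum_3)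
  show "bloch_rotation (diag3 1 1 1)" "bloch_rotation (diag3 (- 1) (- 1) 1)"
    "bloch_rotation (diag3 (- 1) 1 (- 1))" "bloch_rotation (diag3 1 (- 1) (- 1))"
    unfolding e by (intro bloch_rotation_mult bloch_rotation_z bloch_rotation_y)+
qed

lemma diag3_mult: "diag3 a b c ** diag3 a' b' c' = diag3 (a * a') (b * b') (c * c')"
  by (simp only: Finite_Cartesian_Product.vec_eq_iff forall_3)
    (simp add: diag3_def matrix_matrix_mult_def sum_3)

definition same_sign3 :: "real \<Rightarrow> real \<Rightarrow> real \<Rightarrow> bool" where
  "same_sign3 a b c \<longleftrightarrow> a \<ge> 0 \<and> b \<ge> 0 \<and> c \<ge> 0 \<or> a \<le> 0 \<and> b \<le> 0 \<and> c \<le> 0"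

text \<open>A rotation can flip signs only in pairs. One of the four even sign patterns makes the
  three entries all nonnegative or all nonpositive, while the sign of their product cannot be
  changed; this is the origin of the sign condition in the normal form.\<close>

lemma rotation_diagonalization_same_sign:
  fixes M :: "real^3^3"
  obtains R S a b c where "bloch_rotation R" "bloch_rotation S"
    "transpose R ** M ** S = diag3 a b c" "same_sign3 a b c"
proof -
  obtain R S a b c where RS: "bloch_rotation R" "bloch_rotation S" "transpose R ** M ** S = diag3 a b c"
    using rotation_diagonalization .
  have "\<exists>x y z. bloch_rotation (diag3 x y z) \<and> same_sign3 (a * x) (b * y) (c * z)"
  proof -
    have "same_sign3 (a * 1) (b * 1) (c * 1) \<or> same_sign3 (a * (- 1)) (b * (- 1)) (c * 1) \<or>
       same_sign3 (a * (- 1)) (b * 1) (c * (- 1)) \<or> same_sign3 (a * 1) (b * (- 1)) (c * (- 1))"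
      unfolding same_sign3_def by (simp; linarith)
    thus ?thesis using bloch_rotation_signs by blast
  qed
  then obtain x y z where T: "bloch_rotation (diag3 x y z)" "same_sign3 (a * x) (b * y) (c * z)" by blast
  show thesis
  proof (rule that[OF RS(1) bloch_rotation_mult[OF RS(2) T(1)] _ T(2)])
    have "transpose R ** M ** (S ** diag3 x y z) = (transpose R ** M ** S) ** diag3 x y z"
      by (simp add: matrix_mul_assoc)
    thus "transpose R ** M ** (S ** diag3 x y z) = diag3 (a * x) (b * y) (c * z)" by (simp add: RS diag3_mult)
  qed
qed

section \<open>Affine action of a channel on Bloch vectors\<close>

lemma mat2_smult: "x \<cdot>\<^sub>m mat2 a b c d = mat2 (x * a) (x * b) (x * c) (x * d)"
  by (rule mat2_eqI) (auto simp: mat2_def)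

lemma mat2_add: "mat2 a b c d + mat2 a' b' c' d' = mat2 (a + a') (b + b') (c + c') (d + d')"
  by (rule mat2_eqI) (auto simp: mat2_def)

lemma mtrace_mat2: "mtrace (mat2 a b c d) = a + d"
  by (simp add: mtrace_def mat2_def sum_lessThan_2)

lemma hs_norm2_mat2: "hs_norm2 (mat2 a b c d) = (cmod a)\<^sup>2 + (cmod b)\<^sup>2 + (cmod c)\<^sup>2 + (cmod d)\<^sup>2"
  by (simp add: hs_norm2_def mat2_def sum_lessThan_2)

text \<open>Complete positivity with an ancilla of dimension 1.\<close>

lemma channel_pos_semidef:
  assumes N: "qubit_channel N" and X: "pos_semidef 2 X"
  shows "pos_semidef 2 (N X)"
proof -
  have Xc: "X \<in> carrier_mat 2 2" using X by (rule pos_semidef_carrier)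
  have "apply_local 1 N 1 X = N X"
  proof (rule eq_matI)
    show "dim_row (apply_local 1 N 1 X) = dim_row (N X)" "dim_col (apply_local 1 N 1 X) = dim_col (N X)"
      using channel_carrier[OF N Xc] by (auto simp: apply_local_def)
    fix i j assume "i < dim_row (N X)" "j < dim_col (N X)"
    hence ij: "i < 2" "j < 2" using channel_carrier[OF N Xc] by auto
    have "mat 2 2 (\<lambda>(b, c). X $$ (b, c)) = X" using Xc by (intro eq_matI) auto
    thus "apply_local 1 N 1 X $$ (i, j) = N X $$ (i, j)" using ij by (simp add: apply_local_def)
  qed
  moreover have "pos_semidef (1 * 2) (apply_local 1 N 1 X)"
    using N X unfolding qubit_channel_def by (metis mult_1)
  ultimately show ?thesis by simp
qed

lemma bloch_vec_mat2: "bloch_vec v = mat2 (complex_of_real ((1 + v $ 3) / 2)) (Complex (v $ 1 / 2) (- v $ 2 / 2))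
    (Complex (v $ 1 / 2) (v $ 2 / 2)) (complex_of_real ((1 - v $ 3) / 2))"
  unfolding bloch_vec_def bloch_mat2 ..

lemma mat2_pos_semidefI:
  assumes "\<And>x y. 0 \<le> a * x * cnj x + b * y * cnj x + (c * x * cnj y + d * y * cnj y)"
  shows "pos_semidef 2 (mat2 a b c d)"
  unfolding pos_semidef_iff using assms by (simp add: sum_lessThan_2) (simp add: mat2_def)

lemma complex_mult_cnj_nonneg: "0 \<le> z * cnj z"
  by (simp add: less_eq_complex_def complex_mult_cnj)

text \<open>The maximally mixed state and one pure state on each axis form an affine basis of the
  Bloch space, so a channel is determined by their images. Each quadratic form is a nonnegative
  combination of squared moduli.\<close>

lemma bloch_pos_semidef:
  "pos_semidef 2 (bloch_vec 0)" "pos_semidef 2 (bloch_vec (axis 1 1))"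
  "pos_semidef 2 (bloch_vec (axis 2 1))" "pos_semidef 2 (bloch_vec (axis 3 1))"
proof -
  have h: "0 \<le> (1 / 2 :: complex)" by (simp add: less_eq_complex_def)
  have i: "Complex 0 (1 / 2) = \<i> / 2" "Complex 0 (- (1 / 2)) = - \<i> / 2" "Complex (1 / 2) 0 = 1 / 2"
    by (simp_all add: complex_eq_iff)
  show "pos_semidef 2 (bloch_vec 0)" unfolding bloch_vec_mat2
  proof (rule mat2_pos_semidefI)
    fix x y :: complex
    have "0 \<le> 1 / 2 * (x * cnj x) + 1 / 2 * (y * cnj y)"
      by (intro add_nonneg_nonneg mult_nonneg_nonneg h complex_mult_cnj_nonneg)
    thus "0 \<le> complex_of_real ((1 + (0 :: real^3) $ 3) / 2) * x * cnj x + Complex ((0 :: real^3) $ 1 / 2) (- (0 :: real^3) $ 2 / 2) * y * cnj x +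
       (Complex ((0 :: real^3) $ 1 / 2) ((0 :: real^3) $ 2 / 2) * x * cnj y + complex_of_real ((1 - (0 :: real^3) $ 3) / 2) * y * cnj y)"
      by (simp add: Complex_eq mult.assoc)
  qed
  have "bloch_vec (axis 1 1) = mat2 (1 / 2) (1 / 2) (1 / 2) (1 / 2)"
    "bloch_vec (axis 2 1) = mat2 (1 / 2) (- \<i> / 2) (\<i> / 2) (1 / 2)"
    "bloch_vec (axis 3 1) = mat2 1 0 0 0"
    unfolding bloch_vec_mat2 by (intro arg_cong4[where f = mat2]; simp add: axis_def complex_eq_iff)+
  moreover have "pos_semidef 2 (mat2 (1 / 2) (1 / 2) (1 / 2) (1 / 2))"
  proof (rule mat2_pos_semidefI)
    fix x y :: complex
    have "0 \<le> 1 / 2 * ((x + y) * cnj (x + y))" by (intro mult_nonneg_nonneg h complex_mult_cnj_nonneg)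
    thus "0 \<le> 1 / 2 * x * cnj x + 1 / 2 * y * cnj x + (1 / 2 * x * cnj y + 1 / 2 * y * cnj y)"
      by (simp add: algebra_simps)
  qed
  moreover have "pos_semidef 2 (mat2 (1 / 2) (- \<i> / 2) (\<i> / 2) (1 / 2))"
  proof (rule mat2_pos_semidefI)
    fix x y :: complex
    have "0 \<le> 1 / 2 * ((x - \<i> * y) * cnj (x - \<i> * y))" by (intro mult_nonneg_nonneg h complex_mult_cnj_nonneg)
    thus "0 \<le> 1 / 2 * x * cnj x + - \<i> / 2 * y * cnj x + (\<i> / 2 * x * cnj y + 1 / 2 * y * cnj y)"
      by (simp add: algebra_simps)
  qed
  moreover have "pos_semidef 2 (mat2 1 0 0 0)"
    by (rule mat2_pos_semidefI) (simp add: complex_mult_cnj_nonneg)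
  ultimately show "pos_semidef 2 (bloch_vec (axis 1 1))" "pos_semidef 2 (bloch_vec (axis 2 1))"
    "pos_semidef 2 (bloch_vec (axis 3 1))" by simp_all
qed

lemma mtrace_bloch_vec: "mtrace (bloch_vec v) = 1"
  by (simp add: bloch_vec_mat2 mtrace_mat2 complex_eq_iff add_divide_distrib diff_divide_distrib)

lemma pos_semidef_trace_one_bloch:
  assumes A: "pos_semidef 2 A" and t: "mtrace A = 1"
  obtains v where "A = bloch_vec v"
proof -
  have c: "A \<in> carrier_mat 2 2" using A by (rule pos_semidef_carrier)
  have d: "Im (A $$ (0, 0)) = 0" "Im (A $$ (1, 1)) = 0"
    using pos_semidef_diag[OF A, of 0] pos_semidef_diag[OF A, of 1] by (auto simp: less_eq_complex_def)
  have h: "A $$ (1, 0) = cnj (A $$ (0, 1))" using pos_semidef_hermitian[OF A, of 0 1] by simp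
  have tr: "A $$ (0, 0) + A $$ (1, 1) = 1"
    using t c mtrace_mat2 mat2_eta[OF c] by metis
  define v :: "real^3" where "v = vector [2 * Re (A $$ (0, 1)), - 2 * Im (A $$ (0, 1)), 2 * Re (A $$ (0, 0)) - 1]"
  have "A = bloch_vec v"
    unfolding bloch_vec_mat2 mat2_eta[OF c, symmetric]
    by (subst mat2_eta[OF c], intro arg_cong4[where f = mat2])
      (use d h tr in \<open>simp_all add: v_def complex_eq_iff\<close>)
  thus thesis by (rule that)
qed

lemma bloch_vec_affine:
  assumes "a < 2" "b < 2"
  shows "bloch_vec (p0 + x *\<^sub>R (p1 - p0) + y *\<^sub>R (p2 - p0) + z *\<^sub>R (p3 - p0)) $$ (a, b) =
     bloch_vec p0 $$ (a, b) + of_real x * (bloch_vec p1 $$ (a, b) - bloch_vec p0 $$ (a, b))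
       + of_real y * (bloch_vec p2 $$ (a, b) - bloch_vec p0 $$ (a, b))
       + of_real z * (bloch_vec p3 $$ (a, b) - bloch_vec p0 $$ (a, b))"
  using assms unfolding less_2_cases
  by (elim disjE; simp only: bloch_vec_def bloch_index; simp add: complex_eq_iff field_simps)

text \<open>Positivity and trace preservation make the images of the four basic states Bloch
  matrices again. The rest is linearity: every Bloch matrix, also for a vector outside the ball, is
  a real affine combination of the four.\<close>

lemma channel_bloch_affine:
  assumes N: "qubit_channel N"
  obtains M :: "real^3^3" and t :: "real^3" where "\<And>v. N (bloch_vec v) = bloch_vec (M *v v + t)"
proof -
  have "\<exists>w. N (bloch_vec v) = bloch_vec w" if "pos_semidef 2 (bloch_vec v)" for v
  proof -
    have "mtrace (N (bloch_vec v)) = 1"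
      using N mtrace_bloch_vec unfolding qubit_channel_def by simp
    thus ?thesis using pos_semidef_trace_one_bloch[OF channel_pos_semidef[OF N that]] by metis
  qed
  then obtain c0 c1 c2 c3 where c: "N (bloch_vec 0) = bloch_vec c0" "N (bloch_vec (axis 1 1)) = bloch_vec c1"
    "N (bloch_vec (axis 2 1)) = bloch_vec c2" "N (bloch_vec (axis 3 1)) = bloch_vec c3"
    using bloch_pos_semidef by metis
  \<comment> \<open>Column j is the image of the j-th axis state minus the image of the
    centre.\<close>
  define M :: "real^3^3" where "M = (\<chi> i j. ((if j = 1 then c1 else if j = 2 then c2 else c3) - c0) $ i)"
  show thesis
  proof (rule that[of M c0])
    fix v :: "real^3"
    have v: "v = 0 + v $ 1 *\<^sub>R (axis 1 1 - 0) + v $ 2 *\<^sub>R (axis 2 1 - 0) + v $ 3 *\<^sub>R (axis 3 1 - 0)"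
      by (simp only: Finite_Cartesian_Product.vec_eq_iff forall_3) (simp add: axis_def)
    have Mv: "M *v v + c0 = c0 + v $ 1 *\<^sub>R (c1 - c0) + v $ 2 *\<^sub>R (c2 - c0) + v $ 3 *\<^sub>R (c3 - c0)"
      by (simp only: Finite_Cartesian_Product.vec_eq_iff forall_3)
        (simp add: M_def matrix_vector_mult_def sum_3 mult.commute)
    show "N (bloch_vec v) = bloch_vec (M *v v + c0)"
    proof (rule eq_matI)
      fix x y assume "x < dim_row (bloch_vec (M *v v + c0))" "y < dim_col (bloch_vec (M *v v + c0))"
      hence xy: "x < 2" "y < 2" using bloch_vec_carrier[of "M *v v + c0"] by auto
      let ?n = "\<lambda>a b. N (mat_unit 2 a b) $$ (x, y)"
      have *: "bloch_vec v $$ (a, b) =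
         bloch_vec 0 $$ (a, b) + of_real (v $ 1) * (bloch_vec (axis 1 1) $$ (a, b) - bloch_vec 0 $$ (a, b))
           + of_real (v $ 2) * (bloch_vec (axis 2 1) $$ (a, b) - bloch_vec 0 $$ (a, b))
           + of_real (v $ 3) * (bloch_vec (axis 3 1) $$ (a, b) - bloch_vec 0 $$ (a, b))"
        if "a < 2" "b < 2" for a b
        by (subst v, rule bloch_vec_affine[OF that])
      have "N (bloch_vec v) $$ (x, y) = N (bloch_vec 0) $$ (x, y)
           + of_real (v $ 1) * (N (bloch_vec (axis 1 1)) $$ (x, y) - N (bloch_vec 0) $$ (x, y))
           + of_real (v $ 2) * (N (bloch_vec (axis 2 1)) $$ (x, y) - N (bloch_vec 0) $$ (x, y))
           + of_real (v $ 3) * (N (bloch_vec (axis 3 1)) $$ (x, y) - N (bloch_vec 0) $$ (x, y))"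
        unfolding channel_entry[OF N bloch_vec_carrier xy]
        by (simp add: sum_lessThan_2 * del: One_nat_def) (simp add: algebra_simps)
      thus "N (bloch_vec v) $$ (x, y) = bloch_vec (M *v v + c0) $$ (x, y)"
        unfolding c Mv bloch_vec_affine[OF xy] .
    qed (use channel_carrier[OF N, of "bloch_vec v"] carrier_matD[OF bloch_vec_carrier] in auto)
  qed
qed

text \<open>Conjugation by the lifts \<open>U\<close> of \<open>R\<close> and \<open>V\<close> of
  \<open>S\<close> replaces the Bloch matrix M by its diagonal form and the translation t by its
  image under the transpose of \<open>R\<close>.\<close>

lemma normal_form_exists:
  assumes N: "qubit_channel N"
  obtains U V DX DY DZ tX tY tZ where "normal_form N U V (DX, DY, DZ) (tX, tY, tZ)"
proof -
  obtain M t where Mt: "\<And>v. N (bloch_vec v) = bloch_vec (M *v v + t)" using channel_bloch_affine[OF N] by blast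
  obtain R S a b c where RS: "bloch_rotation R" "bloch_rotation S"
    "transpose R ** M ** S = diag3 a b c" "same_sign3 a b c"
    using rotation_diagonalization_same_sign .
  obtain U V where U: "unitary_mat 2 U" "\<And>v. U * bloch_vec v * mat_adjoint U = bloch_vec (R *v v)"
    and V: "unitary_mat 2 V" "\<And>v. V * bloch_vec v * mat_adjoint V = bloch_vec (S *v v)"
    using RS(1,2) unfolding bloch_rotation_def by blast
  note u = unitaryD[OF U(1)] and v = unitaryD[OF V(1)]
  note as = assoc_mult_mat[of _ 2 2 _ 2 _ 2]
  have cancel: "mat_adjoint U * (U * A * mat_adjoint U) * U = A" "U * (mat_adjoint U * A * U) * mat_adjoint U = A"
    "V * (mat_adjoint V * A * V) * mat_adjoint V = A" if A: "A \<in> carrier_mat 2 2" for A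
  proof -
    have "mat_adjoint U * (U * A * mat_adjoint U) * U = (mat_adjoint U * U) * A * (mat_adjoint U * U)"
      using u(1,2) A by (simp add: as)
    also have "\<dots> = A" using u A by simp
    finally show "mat_adjoint U * (U * A * mat_adjoint U) * U = A" .
    have "U * (mat_adjoint U * A * U) * mat_adjoint U = (U * mat_adjoint U) * A * (U * mat_adjoint U)"
      using u(1,2) A by (simp add: as)
    also have "\<dots> = A" using u A by simp
    finally show "U * (mat_adjoint U * A * U) * mat_adjoint U = A" .
    have "V * (mat_adjoint V * A * V) * mat_adjoint V = (V * mat_adjoint V) * A * (V * mat_adjoint V)"
      using v(1,2) A by (simp add: as)
    also have "\<dots> = A" using v A by simp
    finally show "V * (mat_adjoint V * A * V) * mat_adjoint V = A" .
  qed
  have Uadj: "mat_adjoint U * bloch_vec w * U = bloch_vec (transpose R *v w)" for w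
  proof -
    have "R *v (transpose R *v w) = w"
      by (simp only: matrix_vector_mul_assoc bloch_rotation_orth(2)[OF RS(1)] matrix_vector_mul_lid)
    hence "bloch_vec w = U * bloch_vec (transpose R *v w) * mat_adjoint U" by (simp add: U)
    thus ?thesis using cancel(1)[OF bloch_vec_carrier] by simp
  qed
  define N' where "N' = (\<lambda>X. mat_adjoint U * N (V * X * mat_adjoint V) * U)"
  define t' where "t' = transpose R *v t"
  have nf1: "N X = U * N' (mat_adjoint V * X * V) * mat_adjoint U" if "X \<in> carrier_mat 2 2" for X
    unfolding N'_def using that by (simp add: cancel channel_carrier[OF N])
  have nf2: "N' (bloch x y z) = bloch (a * x + t' $ 1) (b * y + t' $ 2) (c * z + t' $ 3)" for x y z
  proof -
    define p :: "real^3" where "p = vector [x, y, z]"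
    have p: "bloch x y z = bloch_vec p" by (simp add: p_def bloch_vec_def)
    have "N' (bloch x y z) = bloch_vec (transpose R *v (M *v (S *v p) + t))"
      unfolding N'_def p V Mt Uadj ..
    also have "transpose R *v (M *v (S *v p) + t) = (transpose R ** M ** S) *v p + t'"
      by (simp add: matrix_vector_right_distrib t'_def matrix_vector_mul_assoc matrix_mul_assoc)
    also have "bloch_vec \<dots> = bloch (a * x + t' $ 1) (b * y + t' $ 2) (c * z + t' $ 3)"
      unfolding RS(3) bloch_vec_def
      by (simp add: diag3_def matrix_vector_mult_def sum_3 p_def)
    finally show ?thesis .
  qed
  have "normal_form N U V (a, b, c) (t' $ 1, t' $ 2, t' $ 3)"
    unfolding normal_form_def using U(1) V(1) RS(4) nf1 nf2 unfolding same_sign3_def by auto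
  thus thesis by (rule that)
qed

section \<open>The channel norm in terms of the normal form\<close>

lemma conjugate_linear:
  fixes A B U :: "complex mat"
  assumes "A \<in> carrier_mat d d" "B \<in> carrier_mat d d" "U \<in> carrier_mat d d"
  shows "U * (x \<cdot>\<^sub>m A + y \<cdot>\<^sub>m B) * mat_adjoint U = x \<cdot>\<^sub>m (U * A * mat_adjoint U) + y \<cdot>\<^sub>m (U * B * mat_adjoint U)"
proof -
  have "U * (x \<cdot>\<^sub>m A + y \<cdot>\<^sub>m B) = x \<cdot>\<^sub>m (U * A) + y \<cdot>\<^sub>m (U * B)"
    using assms by (simp add: mult_add_distrib_mat[of _ d d _ d] mult_smult_distrib[of _ d d _ d])
  moreover have "(x \<cdot>\<^sub>m (U * A) + y \<cdot>\<^sub>m (U * B)) * mat_adjoint U = x \<cdot>\<^sub>m (U * A * mat_adjoint U) + y \<cdot>\<^sub>m (U * B * mat_adjoint U)"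
    using assms by (simp add: add_mult_distrib_mat[of _ d d _ _ d] mult_smult_assoc_mat[of _ d d _ d])
  ultimately show ?thesis by simp
qed

lemma channel_linear:
  assumes N: "qubit_channel N" and "A \<in> carrier_mat 2 2" "B \<in> carrier_mat 2 2"
  shows "N (x \<cdot>\<^sub>m A + y \<cdot>\<^sub>m B) = x \<cdot>\<^sub>m N A + y \<cdot>\<^sub>m N B"
proof -
  have "x \<cdot>\<^sub>m A \<in> carrier_mat 2 2" "y \<cdot>\<^sub>m B \<in> carrier_mat 2 2" using assms by auto
  thus ?thesis using assms unfolding qubit_channel_def by simp
qed

text \<open>The norm is evaluated in the basis of the Pauli matrices and the identity, divided by
  sqrt 2 and conjugated by \<open>V\<close>. The identity contributes 1 + |t|^2 and each Pauli
  matrix the square of its entry of D; the outer \<open>U\<close> preserves Hilbert-Schmidt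
  norms.\<close>

lemma normal_form_channel_norm:
  assumes N: "qubit_channel N" and nf: "normal_form N U V (DX, DY, DZ) (tX, tY, tZ)"
  shows "channel_norm N = 1 + (tX\<^sup>2 + tY\<^sup>2 + tZ\<^sup>2 + DX\<^sup>2 + DY\<^sup>2 + DZ\<^sup>2)"
proof -
  from nf obtain N' where U: "unitary_mat 2 U" and V: "unitary_mat 2 V"
    and N': "\<And>X. X \<in> carrier_mat 2 2 \<Longrightarrow> N X = U * N' (mat_adjoint V * X * V) * mat_adjoint U"
    and D: "\<And>x y z. N' (bloch x y z) = bloch (DX * x + tX) (DY * y + tY) (DZ * z + tZ)"
    unfolding normal_form_def by auto
  note u = unitaryD[OF U] and v = unitaryD[OF V]
  \<comment> \<open>The normal form is known on Bloch matrices only, so the basis is expressed by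
    them: \<open>p 0\<close> is sqrt 2 times the centre, and \<open>p k\<close> for k = 1, 2, 3 is
    sqrt 2 times the k-th axis state minus the centre. The weight of the centre that is subtracted
    is \<open>w k\<close>.\<close>
  define q where "q = complex_of_real (sqrt 2)"
  define w where "w = (\<lambda>k. if k = (0::nat) then 0 else - q)"
  define e where "e = (\<lambda>j k. if j = (k::nat) then 1 else (0::real))"
  define p where "p = (\<lambda>k. q \<cdot>\<^sub>m bloch (e 1 k) (e 2 k) (e 3 k) + w k \<cdot>\<^sub>m bloch 0 0 0)"
  have pc: "p k \<in> carrier_mat 2 2" for k unfolding p_def by simp
  have cq: "cnj q = q" by (simp add: q_def)
  have qq: "q * q = 2" by (simp add: q_def flip: of_real_mult)
  have p_eq: "p 0 = mat2 (q / 2) 0 0 (q / 2)" "p 1 = mat2 0 (q / 2) (q / 2) 0"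
    "p 2 = mat2 0 (- \<i> * q / 2) (\<i> * q / 2) 0" "p 3 = mat2 (q / 2) 0 0 (- q / 2)"
    unfolding p_def bloch_mat2 mat2_smult mat2_add
    by (intro arg_cong4[where f = mat2]; simp add: e_def w_def Complex_eq field_simps)+
  have k4: "k < 4 \<longleftrightarrow> k = 0 \<or> k = 1 \<or> k = 2 \<or> k = (3::nat)" for k by auto
  have orth: "mtrace (mat_adjoint (p k) * p l) = (if k = l then 1 else 0)" if "k < 4" "l < 4" for k l
    using that unfolding k4
    by (elim disjE; simp add: p_eq[unfolded One_nat_def] mat2_adjoint mat2_mult mtrace_mat2 cq qq)
  define P where "P = (\<lambda>k. V * p k * mat_adjoint V)"
  have "hs_orthonormal 2 4 P"
    unfolding hs_orthonormal_def P_def using pc v orth by (simp add: hs_inner_conjugate[OF V pc pc])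
  hence cn: "channel_norm N = (\<Sum>k<4. hs_norm2 (N (P k)))" by (rule channel_norm_orthonormal[OF N])
  have NV: "N (V * bloch x y z * mat_adjoint V) = U * bloch (DX * x + tX) (DY * y + tY) (DZ * z + tZ) * mat_adjoint U" for x y z
  proof -
    have "mat_adjoint V * (V * bloch x y z * mat_adjoint V) * V = (mat_adjoint V * V) * bloch x y z * (mat_adjoint V * V)"
      using v(1,2) bloch_carrier[of x y z] by (simp add: assoc_mult_mat[of _ 2 2 _ 2 _ 2])
    also have "\<dots> = bloch x y z"
      unfolding v(3) using bloch_carrier by (simp add: left_mult_one_mat[of _ 2 2] right_mult_one_mat[of _ 2 2])
    finally have c: "mat_adjoint V * (V * bloch x y z * mat_adjoint V) * V = bloch x y z" .
    have "N (V * bloch x y z * mat_adjoint V) = U * N' (mat_adjoint V * (V * bloch x y z * mat_adjoint V) * V) * mat_adjoint U"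
      using v(1,2) by (intro N') simp
    thus ?thesis by (simp only: c D)
  qed
  have hN: "hs_norm2 (N (P k)) = hs_norm2 (q \<cdot>\<^sub>m bloch (DX * e 1 k + tX) (DY * e 2 k + tY) (DZ * e 3 k + tZ) + w k \<cdot>\<^sub>m bloch tX tY tZ)" for k
  proof -
    have "N (P k) = U * (q \<cdot>\<^sub>m bloch (DX * e 1 k + tX) (DY * e 2 k + tY) (DZ * e 3 k + tZ) + w k \<cdot>\<^sub>m bloch tX tY tZ) * mat_adjoint U"
      unfolding P_def p_def using u v by (simp add: conjugate_linear[of _ 2] channel_linear[OF N] NV)
    thus ?thesis by (simp add: hs_norm2_conjugate[OF U])
  qed
  have Q: "q \<cdot>\<^sub>m bloch (DX * e 1 0 + tX) (DY * e 2 0 + tY) (DZ * e 3 0 + tZ) + w 0 \<cdot>\<^sub>m bloch tX tY tZ =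
      mat2 (q * complex_of_real ((1 + tZ) / 2)) (q * Complex (tX / 2) (- tY / 2)) (q * Complex (tX / 2) (tY / 2)) (q * complex_of_real ((1 - tZ) / 2))"
    "q \<cdot>\<^sub>m bloch (DX * e 1 1 + tX) (DY * e 2 1 + tY) (DZ * e 3 1 + tZ) + w 1 \<cdot>\<^sub>m bloch tX tY tZ =
      mat2 0 (q * complex_of_real (DX / 2)) (q * complex_of_real (DX / 2)) 0"
    "q \<cdot>\<^sub>m bloch (DX * e 1 2 + tX) (DY * e 2 2 + tY) (DZ * e 3 2 + tZ) + w 2 \<cdot>\<^sub>m bloch tX tY tZ =
      mat2 0 (q * (- \<i> * complex_of_real (DY / 2))) (q * (\<i> * complex_of_real (DY / 2))) 0"
    "q \<cdot>\<^sub>m bloch (DX * e 1 3 + tX) (DY * e 2 3 + tY) (DZ * e 3 3 + tZ) + w 3 \<cdot>\<^sub>m bloch tX tY tZ =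
      mat2 (q * complex_of_real (DZ / 2)) 0 0 (- q * complex_of_real (DZ / 2))"
    unfolding bloch_mat2 mat2_smult mat2_add
    by (intro arg_cong4[where f = mat2]; simp add: e_def w_def Complex_eq field_simps)+
  have q2: "(cmod q)\<^sup>2 = 2" by (simp add: q_def)
  have cr: "(cmod (complex_of_real x))\<^sup>2 = x\<^sup>2" "(cmod (Complex x y))\<^sup>2 = x\<^sup>2 + y\<^sup>2" for x y
    by (simp_all add: complex_norm)
  have "{..<4::nat} = {0, 1, 2, 3}" by auto
  hence "channel_norm N = hs_norm2 (N (P 0)) + hs_norm2 (N (P 1)) + hs_norm2 (N (P 2)) + hs_norm2 (N (P 3))"
    unfolding cn by simp
  also have "\<dots> = 1 + (tX\<^sup>2 + tY\<^sup>2 + tZ\<^sup>2 + DX\<^sup>2 + DY\<^sup>2 + DZ\<^sup>2)"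
    unfolding hN Q hs_norm2_mat2 norm_mult power_mult_distrib q2 cr norm_ii norm_minus_cancel
    by (simp add: power2_eq_square field_simps)
  finally show ?thesis .
qed

lemma channel_norm_contraction_coefficient:
  assumes N: "qubit_channel N"
  shows "channel_norm N = 1 + 3 * contraction_coefficient N"
proof -
  obtain U V DX DY DZ tX tY tZ where nf: "normal_form N U V (DX, DY, DZ) (tX, tY, tZ)"
    using normal_form_exists[OF N] .
  have "contraction_coefficient N = (channel_norm N - 1) / 3"
    unfolding contraction_coefficient_def
  proof (rule the_equality)
    show "\<exists>U V DX DY DZ tX tY tZ. normal_form N U V (DX, DY, DZ) (tX, tY, tZ) \<and>
      (channel_norm N - 1) / 3 = (tX\<^sup>2 + tY\<^sup>2 + tZ\<^sup>2 + DX\<^sup>2 + DY\<^sup>2 + DZ\<^sup>2) / 3"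
      using nf normal_form_channel_norm[OF N nf] by (metis add_diff_cancel_left')
    fix c assume "\<exists>U V DX DY DZ tX tY tZ. normal_form N U V (DX, DY, DZ) (tX, tY, tZ) \<and>
      c = (tX\<^sup>2 + tY\<^sup>2 + tZ\<^sup>2 + DX\<^sup>2 + DY\<^sup>2 + DZ\<^sup>2) / 3"
    thus "c = (channel_norm N - 1) / 3" using normal_form_channel_norm[OF N] by fastforce
  qed
  thus ?thesis by simp
qed

section \<open>Second moments of unitary 2-designs\<close>

lemma space_unitary_borel: "space (unitary_borel d) = {U. unitary_mat d U}"
  by (simp add: unitary_borel_def)

lemma measurable_unitary_entry:
  assumes "i < d" "j < d"
  shows "(\<lambda>U. U $$ (i, j)) \<in> borel_measurable (unitary_borel d)"
proof -
  let ?P = "PiM ({..<d} \<times> {..<d}) (\<lambda>_. borel :: complex measure)"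
  have "(\<lambda>U. \<lambda>p\<in>{..<d} \<times> {..<d}. U $$ p) \<in> measurable (unitary_borel d) ?P"
    unfolding unitary_borel_def by (rule measurable_vimage_algebra1) (auto simp: space_PiM)
  from measurable_compose[OF this measurable_component_singleton[of "(i, j)"]]
  show ?thesis using assms by simp
qed

lemma sum_delta_times: "(\<Sum>a<d. (if a = b then f a else 0) * g a) = (if b < d then f b * g b else 0)"
  for f g :: "nat \<Rightarrow> complex"
proof -
  have "(\<Sum>a<d. (if a = b then f a else 0) * g a) = (\<Sum>a<d. if a = b then f a * g a else 0)"
    by (intro sum.cong) auto
  thus ?thesis by simp
qed

lemma unitary_row_norm:
  assumes U: "unitary_mat d U" and i: "i < d"
  shows "(\<Sum>j<d. (cmod (U $$ (i, j)))\<^sup>2) = 1"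
proof -
  note u = unitaryD[OF U]
  have "complex_of_real (\<Sum>j<d. (cmod (U $$ (i, j)))\<^sup>2) = (\<Sum>j<d. U $$ (i, j) * mat_adjoint U $$ (j, i))"
    using u(1) i by (auto simp: complex_norm_square simp del: of_real_power)
  also have "\<dots> = (U * mat_adjoint U) $$ (i, i)" using mult_index[OF u(1,2) i i] by simp
  also have "\<dots> = complex_of_real 1" using u i by simp
  finally show ?thesis by (simp only: of_real_eq_iff)
qed

lemma unitary_entry_le_1:
  assumes U: "unitary_mat d U" and ij: "i < d" "j < d"
  shows "cmod (U $$ (i, j)) \<le> 1"
proof -
  have "(cmod (U $$ (i, j)))\<^sup>2 \<le> (\<Sum>j<d. (cmod (U $$ (i, j)))\<^sup>2)"
    using ij by (intro member_le_sum) auto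
  thus ?thesis unfolding unitary_row_norm[OF U ij(1)] by (simp add: power_le_one_iff abs_square_le_1)
qed

lemma conjugate_entry:
  assumes U: "U \<in> carrier_mat d d" and B: "B \<in> carrier_mat d d" and xy: "x < d" "y < d"
  shows "(U * B * mat_adjoint U) $$ (x, y) = (\<Sum>a<d. \<Sum>b<d. U $$ (x, a) * B $$ (a, b) * cnj (U $$ (y, b)))"
proof -
  have "(U * B * mat_adjoint U) $$ (x, y) = (\<Sum>b<d. (U * B) $$ (x, b) * mat_adjoint U $$ (b, y))"
    using U B xy by (intro mult_index[of _ d d _ d]) auto
  also have "\<dots> = (\<Sum>b<d. \<Sum>a<d. U $$ (x, a) * B $$ (a, b) * cnj (U $$ (y, b)))"
    using U xy by (auto simp: mult_index[OF U B] sum_distrib_right simp del: index_mult_mat(1) intro!: sum.cong)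
  finally show ?thesis by (subst sum.swap)
qed

lemma measurable_cnj [measurable]: "cnj \<in> borel_measurable borel"
  by (intro borel_measurable_continuous_onI continuous_intros)

text \<open>Common ground of the design and of Haar measure: integrability of the moments and their
  expansion in the entries of U rest only on U being unitary.\<close>

locale unitary_probability = prob_space \<nu> for \<nu> :: "complex mat measure" and d :: nat +
  assumes sets_eq: "sets \<nu> = sets (unitary_borel d)"
begin

lemma space_eq: "space \<nu> = {U. unitary_mat d U}"
  using sets_eq_imp_space_eq[OF sets_eq] by (simp add: space_unitary_borel)

lemma entry_measurable [measurable]:
  assumes "i < d" "j < d"
  shows "(\<lambda>U. U $$ (i, j)) \<in> borel_measurable \<nu>"
  using measurable_unitary_entry[OF assms] by (simp cong: measurable_cong_sets add: sets_eq)

definition entry4 :: "nat \<Rightarrow> nat \<Rightarrow> nat \<Rightarrow> nat \<Rightarrow> nat \<Rightarrow> nat \<Rightarrow> nat \<Rightarrow> nat \<Rightarrow> complex mat \<Rightarrow> complex" where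
  "entry4 x a y b x' a' y' b' U = U $$ (x, a) * U $$ (y, b) * cnj (U $$ (x', a')) * cnj (U $$ (y', b'))"

lemma integrable_entry4:
  assumes "x < d" "a < d" "y < d" "b < d" "x' < d" "a' < d" "y' < d" "b' < d"
  shows "integrable \<nu> (entry4 x a y b x' a' y' b')"
proof (rule integrable_const_bound[of _ 1])
  show "entry4 x a y b x' a' y' b' \<in> borel_measurable \<nu>"
    unfolding entry4_def[abs_def] using assms by measurable
  show "AE U in \<nu>. norm (entry4 x a y b x' a' y' b' U) \<le> 1"
  proof (rule AE_I2)
    fix U assume "U \<in> space \<nu>"
    hence U: "unitary_mat d U" by (simp add: space_eq)
    show "norm (entry4 x a y b x' a' y' b' U) \<le> 1"
      unfolding entry4_def norm_mult complex_mod_cnj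
      using unitary_entry_le_1[OF U] assms by (intro mult_le_one mult_nonneg_nonneg) auto
  qed
qed

text \<open>In the conjugated factor the entry of U at (y', b') loses its conjugation and the one at
  (x', a') acquires it. This explains the order of the arguments of \<open>entry4\<close>, which has
  the two plain entries in front.\<close>

lemma conjugate_product_expand:
  assumes U: "unitary_mat d U" and B: "B \<in> carrier_mat d d" and l: "x < d" "y < d" "x' < d" "y' < d"
  shows "(U * B * mat_adjoint U) $$ (x, y) * cnj ((U * B * mat_adjoint U) $$ (x', y')) =
    (\<Sum>a<d. \<Sum>b<d. \<Sum>a'<d. \<Sum>b'<d. B $$ (a, b) * cnj (B $$ (a', b')) * entry4 x a y' b' y b x' a' U)"
  unfolding conjugate_entry[OF unitaryD(1)[OF U] B l(1,2)] conjugate_entry[OF unitaryD(1)[OF U] B l(3,4)]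
  unfolding cnj_sum sum_distrib_right unfolding sum_distrib_left entry4_def
  by (simp only: complex_cnj_mult complex_cnj_cnj mult_ac)

definition conj_moment :: "complex mat \<Rightarrow> nat \<Rightarrow> nat \<Rightarrow> nat \<Rightarrow> nat \<Rightarrow> complex" where
  "conj_moment B x y x' y' =
     (LINT U|\<nu>. (U * B * mat_adjoint U) $$ (x, y) * cnj ((U * B * mat_adjoint U) $$ (x', y')))"

lemma integrable_conj_moment:
  assumes B: "B \<in> carrier_mat d d" and l: "x < d" "y < d" "x' < d" "y' < d"
  shows "integrable \<nu> (\<lambda>U. (U * B * mat_adjoint U) $$ (x, y) * cnj ((U * B * mat_adjoint U) $$ (x', y')))"
proof -
  have "integrable \<nu> (\<lambda>U. \<Sum>a<d. \<Sum>b<d. \<Sum>a'<d. \<Sum>b'<d. B $$ (a, b) * cnj (B $$ (a', b')) * entry4 x a y' b' y b x' a' U)"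
    using l by (intro Bochner_Integration.integrable_sum integrable_mult_right integrable_entry4) auto
  thus ?thesis
    by (rule Bochner_Integration.integrable_cong[THEN iffD1, rotated -1])
      (auto simp: space_eq conjugate_product_expand[OF _ B l])
qed

lemma conj_moment_eq:
  assumes B: "B \<in> carrier_mat d d" and l: "x < d" "y < d" "x' < d" "y' < d"
  shows "conj_moment B x y x' y' = (\<Sum>a<d. \<Sum>b<d. \<Sum>a'<d. \<Sum>b'<d.
     B $$ (a, b) * cnj (B $$ (a', b')) * (LINT U|\<nu>. entry4 x a y' b' y b x' a' U))"
proof -
  have "conj_moment B x y x' y' = (LINT U|\<nu>. (\<Sum>a<d. \<Sum>b<d. \<Sum>a'<d. \<Sum>b'<d.
     B $$ (a, b) * cnj (B $$ (a', b')) * entry4 x a y' b' y b x' a' U))"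
    unfolding conj_moment_def by (intro Bochner_Integration.integral_cong refl) (simp add: space_eq conjugate_product_expand[OF _ B l])
  also have "\<dots> = (\<Sum>a<d. \<Sum>b<d. \<Sum>a'<d. \<Sum>b'<d.
     B $$ (a, b) * cnj (B $$ (a', b')) * (LINT U|\<nu>. entry4 x a y' b' y b x' a' U))"
    using l by (subst Bochner_Integration.integral_sum;
        (intro Bochner_Integration.integrable_sum integrable_mult_right integrable_entry4 sum.cong refl)?; simp?)+
  finally show ?thesis .
qed

text \<open>A matrix unit as argument isolates one monomial of degree 2 in the entries of U and 2 in
  their conjugates. Equal twirls therefore mean equal expectations of all these monomials.\<close>

lemma twirl2_unit:
  assumes l: "x < d" "a < d" "y < d" "b < d" "x' < d" "a' < d" "y' < d" "b' < d"
  shows "twirl2 d \<nu> (mat_unit (d * d) (a * d + b) (a' * d + b')) $$ (x * d + y, x' * d + y') =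
    (LINT U|\<nu>. entry4 x a y b x' a' y' b' U)"
proof -
  have L: "x * d + y < d * d" "a * d + b < d * d" "x' * d + y' < d * d" "a' * d + b' < d * d"
    using l by (auto intro: mult_add_less)
  have "(kron U U * mat_unit (d * d) (a * d + b) (a' * d + b') * mat_adjoint (kron U U)) $$ (x * d + y, x' * d + y') =
      entry4 x a y b x' a' y' b' U" if "U \<in> space \<nu>" for U
  proof -
    have U: "U \<in> carrier_mat d d" using that unitaryD(1) by (auto simp: space_eq)
    have k: "kron U U \<in> carrier_mat (d * d) (d * d)" using U by (auto simp: kron_def)
    have ki: "kron U U $$ (i * d + j, i' * d + j') = U $$ (i, i') * U $$ (j, j')"
      if "i < d" "j < d" "i' < d" "j' < d" for i j i' j'
      using U that by (auto simp: kron_def mult_add_less)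
    have "(kron U U * mat_unit (d * d) (a * d + b) (a' * d + b') * mat_adjoint (kron U U)) $$ (x * d + y, x' * d + y') =
      (\<Sum>u<d*d. \<Sum>v<d*d. if v = a' * d + b' then (if u = a * d + b then kron U U $$ (x * d + y, u) * cnj (kron U U $$ (x' * d + y', v)) else 0) else 0)"
      unfolding conjugate_entry[OF k mat_unit_carrier L(1,3)]
      by (intro sum.cong refl) (auto simp: mat_unit_def)
    also have "\<dots> = kron U U $$ (x * d + y, a * d + b) * cnj (kron U U $$ (x' * d + y', a' * d + b'))"
      using L by simp
    finally show ?thesis using l by (simp add: ki entry4_def)
  qed
  thus ?thesis unfolding twirl2_def using L by (auto intro!: Bochner_Integration.integral_cong)
qed

end

lemma design_conj_moment:
  assumes \<nu>: "unitary_probability \<nu> d" and \<mu>: "unitary_probability \<mu> d"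
    and tw: "\<forall>X\<in>carrier_mat (d * d) (d * d). twirl2 d \<nu> X = twirl2 d \<mu> X"
    and B: "B \<in> carrier_mat d d" and l: "x < d" "y < d" "x' < d" "y' < d"
  shows "unitary_probability.conj_moment \<nu> B x y x' y' = unitary_probability.conj_moment \<mu> B x y x' y'"
proof -
  have "(LINT U|\<nu>. unitary_probability.entry4 x a y' b' y b x' a' U) =
     (LINT U|\<mu>. unitary_probability.entry4 x a y' b' y b x' a' U)"
    if "a < d" "b < d" "a' < d" "b' < d" for a b a' b'
    using unitary_probability.twirl2_unit[OF \<nu>, of x a y' b' y b x' a'] unitary_probability.twirl2_unit[OF \<mu>, of x a y' b' y b x' a'] tw that l
    by simp
  thus ?thesis
    unfolding unitary_probability.conj_moment_eq[OF \<nu> B l] unitary_probability.conj_moment_eq[OF \<mu> B l]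
    by (intro sum.cong refl) auto
qed

lemma measurable_left_mult:
  assumes \<mu>: "unitary_probability \<mu> d" and V: "unitary_mat d V"
  shows "(\<lambda>U. V * U) \<in> measurable \<mu> (unitary_borel d)"
proof -
  interpret unitary_probability \<mu> d by fact
  have Vc: "V \<in> carrier_mat d d" using V by (rule unitaryD(1))
  show ?thesis
    unfolding unitary_borel_def
  proof (rule measurable_vimage_algebra2)
    show "(\<lambda>U. V * U) \<in> space \<mu> \<rightarrow> {U. unitary_mat d U}"
      using unitary_mult[OF V] by (auto simp: space_eq)
    show "(\<lambda>U. \<lambda>p\<in>{..<d} \<times> {..<d}. (V * U) $$ p) \<in> measurable \<mu> (PiM ({..<d} \<times> {..<d}) (\<lambda>_. borel))"
    proof (rule measurable_restrict)
      fix p assume "p \<in> {..<d} \<times> {..<d}"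
      then obtain i j where p: "p = (i, j)" "i < d" "j < d" by auto
      have "(\<lambda>U. \<Sum>l<d. V $$ (i, l) * U $$ (l, j)) \<in> borel_measurable \<mu>"
        using p by (intro borel_measurable_sum borel_measurable_times borel_measurable_const entry_measurable) auto
      thus "(\<lambda>U. (V * U) $$ p) \<in> borel_measurable \<mu>"
        by (rule measurable_cong[THEN iffD1, rotated])
          (use p in \<open>auto simp: space_eq mult_index[OF Vc unitaryD(1)] simp del: index_mult_mat(1)\<close>)
    qed
  qed
qed

locale haar_probability = unitary_probability \<nu> d for \<nu> d +
  assumes haar: "haar_unitary d \<nu>"
begin

lemma left_invariance:
  assumes V: "unitary_mat d V" and B: "B \<in> carrier_mat d d" and l: "x < d" "y < d" "x' < d" "y' < d"
  shows "conj_moment B x y x' y' =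
    (LINT U|\<nu>. ((V * U) * B * mat_adjoint (V * U)) $$ (x, y) * cnj (((V * U) * B * mat_adjoint (V * U)) $$ (x', y')))"
proof -
  let ?f = "\<lambda>U. (U * B * mat_adjoint U) $$ (x, y) * cnj ((U * B * mat_adjoint U) $$ (x', y'))"
  have "?f \<in> borel_measurable \<nu>" using integrable_conj_moment[OF B l] by (rule borel_measurable_integrable)
  hence f: "?f \<in> borel_measurable (unitary_borel d)" by (simp cong: measurable_cong_sets add: sets_eq)
  have "distr \<nu> (unitary_borel d) (\<lambda>U. V * U) = \<nu>" using haar V unfolding haar_unitary_def by blast
  hence "conj_moment B x y x' y' = integral\<^sup>L (distr \<nu> (unitary_borel d) (\<lambda>U. V * U)) ?f"
    by (simp add: conj_moment_def)
  also have "\<dots> = (LINT U|\<nu>. ?f (V * U))"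
    by (rule integral_distr[OF measurable_left_mult[OF unitary_probability_axioms V] f])
  finally show ?thesis .
qed

lemma conjugate_conjugate:
  fixes U V B :: "complex mat"
  assumes "U \<in> carrier_mat d d" "V \<in> carrier_mat d d" "B \<in> carrier_mat d d"
  shows "(V * U) * B * mat_adjoint (V * U) = V * (U * B * mat_adjoint U) * mat_adjoint V"
  using assms by (simp add: mat_adjoint_mult[of _ d d _ d] assoc_mult_mat[of _ d d _ d _ d])

text \<open>Left multiplication by the monomial matrix with \<phi> i at position (i, \<pi> i)
  relabels the indices of U B U^dagger by \<pi> and attaches phases; Haar measure does not see
  it.\<close>

lemma monomial_invariance:
  assumes \<pi>: "bij_betw \<pi> {..<d} {..<d}" and \<phi>: "\<And>i. \<phi> i * cnj (\<phi> i) = 1"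
    and B: "B \<in> carrier_mat d d" and l: "x < d" "y < d" "x' < d" "y' < d"
  shows "conj_moment B x y x' y' =
    \<phi> x * cnj (\<phi> y) * cnj (\<phi> x') * \<phi> y' * conj_moment B (\<pi> x) (\<pi> y) (\<pi> x') (\<pi> y')"
proof -
  define V where "V = mat d d (\<lambda>(i, j). if j = \<pi> i then \<phi> i else 0)"
  have Vc: "V \<in> carrier_mat d d" by (simp add: V_def)
  have \<pi>d: "\<pi> i < d" if "i < d" for i using bij_betwE[OF \<pi>] that by auto
  have inj: "\<pi> i = \<pi> j \<longleftrightarrow> i = j" if "i < d" "j < d" for i j
    using \<pi> that unfolding bij_betw_def inj_on_def by auto
  have VV: "V * mat_adjoint V = 1\<^sub>m d"
  proof (rule eq_matI)
    fix i j assume "i < dim_row (1\<^sub>m d :: complex mat)" "j < dim_col (1\<^sub>m d :: complex mat)"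
    hence ij: "i < d" "j < d" by auto
    have "(V * mat_adjoint V) $$ (i, j) = (\<Sum>k<d. (if k = \<pi> i then \<phi> i else 0) * (if k = \<pi> j then cnj (\<phi> j) else 0))"
      using ij Vc by (subst mult_index[of _ d d _ d]) (auto simp: V_def intro!: sum.cong)
    also have "\<dots> = \<phi> i * (if \<pi> i = \<pi> j then cnj (\<phi> j) else 0)"
      using sum_delta_times[of "\<pi> i" "\<lambda>_. \<phi> i" "\<lambda>k. if k = \<pi> j then cnj (\<phi> j) else 0" d] \<pi>d[OF ij(1)] by simp
    also have "\<dots> = 1\<^sub>m d $$ (i, j)" using ij inj \<phi> by auto
    finally show "(V * mat_adjoint V) $$ (i, j) = 1\<^sub>m d $$ (i, j)" .
  qed (use Vc in auto)
  have V: "unitary_mat d V"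
    unfolding unitary_mat_def using Vc VV mat_mult_left_right_inverse[OF Vc _ VV] by auto
  have e: "(V * Z * mat_adjoint V) $$ (u, v) = \<phi> u * cnj (\<phi> v) * Z $$ (\<pi> u, \<pi> v)"
    if Z: "Z \<in> carrier_mat d d" and uv: "u < d" "v < d" for Z u v
  proof -
    have "(V * Z * mat_adjoint V) $$ (u, v) =
      (\<Sum>a<d. \<Sum>b<d. if b = \<pi> v then (if a = \<pi> u then \<phi> u * Z $$ (a, b) * cnj (\<phi> v) else 0) else 0)"
      unfolding conjugate_entry[OF Vc Z uv] using uv by (intro sum.cong refl) (auto simp: V_def)
    thus ?thesis using \<pi>d uv by (simp add: mult_ac)
  qed
  have "conj_moment B x y x' y' = (LINT U|\<nu>. (\<phi> x * cnj (\<phi> y) * cnj (\<phi> x') * \<phi> y') *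
      ((U * B * mat_adjoint U) $$ (\<pi> x, \<pi> y) * cnj ((U * B * mat_adjoint U) $$ (\<pi> x', \<pi> y'))))"
    unfolding left_invariance[OF V B l]
  proof (rule Bochner_Integration.integral_cong[OF refl])
    fix U assume "U \<in> space \<nu>"
    hence U: "U \<in> carrier_mat d d" using unitaryD(1) by (auto simp: space_eq)
    hence Z: "U * B * mat_adjoint U \<in> carrier_mat d d" using B by simp
    show "((V * U) * B * mat_adjoint (V * U)) $$ (x, y) * cnj (((V * U) * B * mat_adjoint (V * U)) $$ (x', y')) =
      (\<phi> x * cnj (\<phi> y) * cnj (\<phi> x') * \<phi> y') *
      ((U * B * mat_adjoint U) $$ (\<pi> x, \<pi> y) * cnj ((U * B * mat_adjoint U) $$ (\<pi> x', \<pi> y')))"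
      unfolding conjugate_conjugate[OF U Vc B] e[OF Z l(1,2)] e[OF Z l(3,4)] by simp
  qed
  thus ?thesis by (simp add: conj_moment_def)
qed

lemma conj_moment_eq_0:
  assumes B: "B \<in> carrier_mat d d" and l: "x < d" "y < d" "x' < d" "y' < d"
    and ne: "\<not> (x = y \<and> x' = y')" "\<not> (x = x' \<and> y = y')"
  shows "conj_moment B x y x' y' = 0"
proof -
  \<comment> \<open>The phase \<i> rather than -1: for x = y' and y = x' two signs would cancel,
    while \<i> squares to -1.\<close>
  define \<phi> where "\<phi> = (\<lambda>(z :: nat) i. if i = z then \<i> else (1 :: complex))"
  have "conj_moment B x y x' y' = \<phi> z x * cnj (\<phi> z y) * cnj (\<phi> z x') * \<phi> z y' * conj_moment B x y x' y'" for z
  proof (rule monomial_invariance[OF _ _ B l, of "\<lambda>i. i"])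
    show "bij_betw (\<lambda>i. i) {..<d} {..<d}" by (simp add: bij_betw_def inj_on_def)
    show "\<phi> z i * cnj (\<phi> z i) = 1" for i by (simp add: \<phi>_def)
  qed
  moreover have "\<exists>z. \<phi> z x * cnj (\<phi> z y) * cnj (\<phi> z x') * \<phi> z y' \<noteq> 1"
  proof (cases "x = x'")
    case True
    hence "y \<noteq> y'" using ne by auto
    thus ?thesis using True by (intro exI[of _ y']) (auto simp: \<phi>_def complex_eq_iff)
  next
    case False
    show ?thesis
    proof (cases "x = y")
      case True
      thus ?thesis using False ne by (intro exI[of _ x']) (auto simp: \<phi>_def complex_eq_iff)
    next
      case False
      thus ?thesis using \<open>x \<noteq> x'\<close> by (intro exI[of _ x]) (auto simp: \<phi>_def complex_eq_iff)
    qed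
  qed
  ultimately show ?thesis by (metis mult_cancel_right1)
qed

lemma conj_moment_permute:
  assumes B: "B \<in> carrier_mat d d" and d: "2 \<le> d" and ab: "a < d" "b < d" "a \<noteq> b"
  shows "conj_moment B 0 0 1 1 = conj_moment B a a b b" "conj_moment B 0 1 0 1 = conj_moment B a b a b"
    "conj_moment B 0 0 0 0 = conj_moment B a a a a"
proof -
  \<comment> \<open>A product of two transpositions with 0 mapped to a and 1 to b: \<open>t\<close>
    takes 1 to the index that \<open>s\<close> sends to b and leaves 0 alone.\<close>
  define s where "s = (\<lambda>i::nat. if i = 0 then a else if i = a then 0 else i)"
  define t where "t = (\<lambda>i::nat. if i = 1 then s b else if i = s b then 1 else i)"
  have ss: "s (s i) = i" for i by (auto simp: s_def)
  have tt: "t (t i) = i" for i by (auto simp: t_def)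
  have sd: "s i < d" if "i < d" for i using that ab d by (auto simp: s_def)
  have td: "t i < d" if "i < d" for i using that sd[OF ab(2)] d by (auto simp: t_def)
  have bij: "bij_betw (\<lambda>i. s (t i)) {..<d} {..<d}"
    by (rule bij_betwI[where g = "\<lambda>i. t (s i)"]) (use sd td ss tt in auto)
  have "s b \<noteq> 0" using ab(3) ss[of b] by (auto simp: s_def split: if_splits)
  hence v: "s (t 0) = a" "s (t 1) = b" using ss[of b] by (auto simp: t_def) (auto simp: s_def)
  note m = monomial_invariance[OF bij, of "\<lambda>_. 1", OF _ B, unfolded v]
  show "conj_moment B 0 0 1 1 = conj_moment B a a b b" "conj_moment B 0 1 0 1 = conj_moment B a b a b"
    "conj_moment B 0 0 0 0 = conj_moment B a a a a"
    using m[of 0 0 1 1] m[of 0 1 0 1] m[of 0 0 0 0] d v by simp_all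
qed

text \<open>Phases and permutations leave three unknown moments of Z = U B U^dagger: those of Z_00
  with itself, of Z_01 with itself, and of Z_00 with Z_11. A Hadamard rotation of the first two
  levels turns Z_01 into (Z_00 - Z_01 + Z_10 - Z_11) / 2, and invariance of the moment of Z_01 is
  the missing relation.\<close>

lemma conj_moment_rotation:
  assumes B: "B \<in> carrier_mat d d" and d: "2 \<le> d"
  shows "conj_moment B 0 0 0 0 = conj_moment B 0 0 1 1 + conj_moment B 0 1 0 1"
proof -
  define h where "h = complex_of_real (1 / sqrt 2)"
  have hh: "h * h = 1 / 2" "cnj h = h" by (simp_all add: h_def flip: of_real_mult)
  define V where "V = mat d d (\<lambda>(i, j). if i < 2 \<and> j < 2 then (if i = 1 \<and> j = 1 then - h else h) else if i = j then 1 else 0)"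
  have Vc: "V \<in> carrier_mat d d" by (simp add: V_def)
  have sum2: "(\<Sum>k<d. f k) = f 0 + f 1" if "\<And>k. 2 \<le> k \<Longrightarrow> k < d \<Longrightarrow> f k = 0" for f :: "nat \<Rightarrow> complex"
  proof -
    have "(\<Sum>k<d. f k) = (\<Sum>k<2. f k)" using d that by (intro sum.mono_neutral_right) auto
    thus ?thesis by (simp add: sum_lessThan_2)
  qed
  have VV: "V * mat_adjoint V = 1\<^sub>m d"
  proof (rule eq_matI)
    fix i j assume "i < dim_row (1\<^sub>m d :: complex mat)" "j < dim_col (1\<^sub>m d :: complex mat)"
    hence ij: "i < d" "j < d" by auto
    have *: "(V * mat_adjoint V) $$ (i, j) = (\<Sum>k<d. V $$ (i, k) * cnj (V $$ (j, k)))"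
      using ij Vc by (subst mult_index[of _ d d _ d]) (auto intro!: sum.cong)
    show "(V * mat_adjoint V) $$ (i, j) = 1\<^sub>m d $$ (i, j)"
    proof (cases "i < 2")
      case True
      have "(V * mat_adjoint V) $$ (i, j) = V $$ (i, 0) * cnj (V $$ (j, 0)) + V $$ (i, 1) * cnj (V $$ (j, 1))"
        unfolding * using True ij by (intro sum2) (auto simp: V_def)
      thus ?thesis using True ij d hh by (auto simp: V_def less_2_cases mult.commute)
    next
      case False
      have "(V * mat_adjoint V) $$ (i, j) = (\<Sum>k<d. (if k = i then 1 else 0) * cnj (V $$ (j, k)))"
        unfolding * using False ij by (intro sum.cong refl) (auto simp: V_def)
      also have "\<dots> = cnj (V $$ (j, i))" using sum_delta_times[of i "\<lambda>_. 1" _ d] ij by simp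
      finally show ?thesis using False ij by (auto simp: V_def)
    qed
  qed (use Vc in auto)
  have V: "unitary_mat d V"
    unfolding unitary_mat_def using Vc VV mat_mult_left_right_inverse[OF Vc _ VV] by auto
  have e: "(V * Z * mat_adjoint V) $$ (0, 1) = 1 / 2 * (Z $$ (0, 0) - Z $$ (0, 1) + Z $$ (1, 0) - Z $$ (1, 1))"
    if Z: "Z \<in> carrier_mat d d" for Z
  proof -
    have "(V * Z * mat_adjoint V) $$ (0, 1) = (\<Sum>a<d. \<Sum>b<d. V $$ (0, a) * Z $$ (a, b) * cnj (V $$ (1, b)))"
      using d by (intro conjugate_entry[OF Vc Z]) auto
    also have "\<dots> = (\<Sum>b<d. V $$ (0, 0) * Z $$ (0, b) * cnj (V $$ (1, b))) + (\<Sum>b<d. V $$ (0, 1) * Z $$ (1, b) * cnj (V $$ (1, b)))"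
      using d by (intro sum2) (auto simp: V_def)
    also have "\<dots> = (V $$ (0, 0) * Z $$ (0, 0) * cnj (V $$ (1, 0)) + V $$ (0, 0) * Z $$ (0, 1) * cnj (V $$ (1, 1)))
        + (V $$ (0, 1) * Z $$ (1, 0) * cnj (V $$ (1, 0)) + V $$ (0, 1) * Z $$ (1, 1) * cnj (V $$ (1, 1)))"
      using d by (intro arg_cong2[where f = "(+)"] sum2) (auto simp: V_def)
    also have "\<dots> = h * h * (Z $$ (0, 0) - Z $$ (0, 1) + Z $$ (1, 0) - Z $$ (1, 1))"
      using d hh(2) by (simp add: V_def algebra_simps)
    finally show ?thesis by (simp add: hh)
  qed
  have d01: "0 < d" "1 < d" using d by auto
  let ?z = "\<lambda>U i j. (U * B * mat_adjoint U) $$ (i, j)"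
  have i: "integrable \<nu> (\<lambda>U. ?z U x y * cnj (?z U x' y'))" if "x < 2" "y < 2" "x' < 2" "y' < 2" for x y x' y'
    using integrable_conj_moment[OF B] that d by simp
  have "conj_moment B 0 1 0 1 = (LINT U|\<nu>. 1 / 4 * (
      (?z U 0 0 * cnj (?z U 0 0) - ?z U 0 0 * cnj (?z U 0 1) + ?z U 0 0 * cnj (?z U 1 0) - ?z U 0 0 * cnj (?z U 1 1))
      - (?z U 0 1 * cnj (?z U 0 0) - ?z U 0 1 * cnj (?z U 0 1) + ?z U 0 1 * cnj (?z U 1 0) - ?z U 0 1 * cnj (?z U 1 1))
      + (?z U 1 0 * cnj (?z U 0 0) - ?z U 1 0 * cnj (?z U 0 1) + ?z U 1 0 * cnj (?z U 1 0) - ?z U 1 0 * cnj (?z U 1 1))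
      - (?z U 1 1 * cnj (?z U 0 0) - ?z U 1 1 * cnj (?z U 0 1) + ?z U 1 1 * cnj (?z U 1 0) - ?z U 1 1 * cnj (?z U 1 1))))"
    unfolding left_invariance[OF V B d01 d01]
    proof (rule Bochner_Integration.integral_cong[OF refl])
      fix U assume "U \<in> space \<nu>"
      hence U: "U \<in> carrier_mat d d" using unitaryD(1) by (auto simp: space_eq)
      hence Z: "U * B * mat_adjoint U \<in> carrier_mat d d" using B by simp
      have r: "(1 / 2 * (p - q + r - s)) * cnj (1 / 2 * (p - q + r - s)) = 1 / 4 * (
        (p * cnj p - p * cnj q + p * cnj r - p * cnj s) - (q * cnj p - q * cnj q + q * cnj r - q * cnj s)
        + (r * cnj p - r * cnj q + r * cnj r - r * cnj s) - (s * cnj p - s * cnj q + s * cnj r - s * cnj s))" for p q r s :: complex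
        by (simp add: field_simps)
      show "((V * U) * B * mat_adjoint (V * U)) $$ (0, 1) * cnj (((V * U) * B * mat_adjoint (V * U)) $$ (0, 1)) = 1 / 4 * (
      (?z U 0 0 * cnj (?z U 0 0) - ?z U 0 0 * cnj (?z U 0 1) + ?z U 0 0 * cnj (?z U 1 0) - ?z U 0 0 * cnj (?z U 1 1))
      - (?z U 0 1 * cnj (?z U 0 0) - ?z U 0 1 * cnj (?z U 0 1) + ?z U 0 1 * cnj (?z U 1 0) - ?z U 0 1 * cnj (?z U 1 1))
      + (?z U 1 0 * cnj (?z U 0 0) - ?z U 1 0 * cnj (?z U 0 1) + ?z U 1 0 * cnj (?z U 1 0) - ?z U 1 0 * cnj (?z U 1 1))
      - (?z U 1 1 * cnj (?z U 0 0) - ?z U 1 1 * cnj (?z U 0 1) + ?z U 1 1 * cnj (?z U 1 0) - ?z U 1 1 * cnj (?z U 1 1)))"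
        unfolding conjugate_conjugate[OF U Vc B] e[OF Z] by (rule r)
    qed
  also have "\<dots> = 1 / 4 * (
      (conj_moment B 0 0 0 0 - conj_moment B 0 0 0 1 + conj_moment B 0 0 1 0 - conj_moment B 0 0 1 1)
      - (conj_moment B 0 1 0 0 - conj_moment B 0 1 0 1 + conj_moment B 0 1 1 0 - conj_moment B 0 1 1 1)
      + (conj_moment B 1 0 0 0 - conj_moment B 1 0 0 1 + conj_moment B 1 0 1 0 - conj_moment B 1 0 1 1)
      - (conj_moment B 1 1 0 0 - conj_moment B 1 1 0 1 + conj_moment B 1 1 1 0 - conj_moment B 1 1 1 1))"
    unfolding conj_moment_def using i by simp
  also have "\<dots> = 1 / 4 * (conj_moment B 0 0 0 0 - conj_moment B 0 0 1 1 + conj_moment B 0 1 0 1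
      + conj_moment B 1 0 1 0 - conj_moment B 1 1 0 0 + conj_moment B 1 1 1 1)"
    using d by (simp add: conj_moment_eq_0[OF B])
  also have "\<dots> = 1 / 2 * (conj_moment B 0 0 0 0 - conj_moment B 0 0 1 1 + conj_moment B 0 1 0 1)"
    using conj_moment_permute[OF B d, of 1 0] d by simp
  finally show ?thesis by (simp add: field_simps)
qed

lemma conj_moment_form:
  assumes B: "B \<in> carrier_mat d d" and d: "2 \<le> d" and l: "x < d" "y < d" "x' < d" "y' < d"
  shows "conj_moment B x y x' y' =
    conj_moment B 0 0 1 1 * (if x = y \<and> x' = y' then 1 else 0) +
    conj_moment B 0 1 0 1 * (if x = x' \<and> y = y' then 1 else 0)"
proof -
  consider "x = y" "x' = y'" "x \<noteq> x'" | "x = x'" "y = y'" "x \<noteq> y" | "x = y" "x' = y'" "x = x'"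
    | "\<not> (x = y \<and> x' = y')" "\<not> (x = x' \<and> y = y')" by blast
  thus ?thesis
  proof cases
    case 1 thus ?thesis using conj_moment_permute(1)[OF B d, of x x'] l by auto
  next
    case 2 thus ?thesis using conj_moment_permute(2)[OF B d, of x y] l by auto
  next
    case 3
    obtain b where "b < d" "x \<noteq> b" using d by (metis One_nat_def Suc_1 Suc_le_lessD less_imp_Suc_add lessI less_trans zero_neq_one)
    thus ?thesis using 3 conj_moment_permute(3)[OF B d, of x b] l conj_moment_rotation[OF B d] by auto
  next
    case 4 thus ?thesis using conj_moment_eq_0[OF B l] by auto
  qed
qed

end

text \<open>Hilbert-Schmidt norm and trace are constant under conjugation. These two invariants
  supply two linear equations for the two moments that are still unknown.\<close>

lemma (in unitary_probability) conj_moment_sums: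
  assumes B: "B \<in> carrier_mat d d"
  shows "(\<Sum>x<d. \<Sum>y<d. conj_moment B x y x y) = complex_of_real (hs_norm2 B)"
    and "(\<Sum>x<d. \<Sum>y<d. conj_moment B x x y y) = complex_of_real ((cmod (mtrace B))\<^sup>2)"
proof -
  let ?Z = "\<lambda>U. U * B * mat_adjoint U"
  have "(\<Sum>x<d. \<Sum>y<d. conj_moment B x y x y) = (LINT U|\<nu>. (\<Sum>x<d. \<Sum>y<d. ?Z U $$ (x, y) * cnj (?Z U $$ (x, y))))"
    unfolding conj_moment_def
    by (subst Bochner_Integration.integral_sum; (intro Bochner_Integration.integrable_sum integrable_conj_moment B sum.cong refl)?; simp?;
      subst Bochner_Integration.integral_sum; (intro integrable_conj_moment B sum.cong refl)?; simp?)
  also have "\<dots> = (LINT U|\<nu>. complex_of_real (hs_norm2 B))"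
  proof (rule Bochner_Integration.integral_cong[OF refl])
    fix U assume "U \<in> space \<nu>"
    hence U: "unitary_mat d U" by (simp add: space_eq)
    have c: "?Z U \<in> carrier_mat d d" using unitaryD(1)[OF U] B by simp
    have "(\<Sum>x<d. \<Sum>y<d. ?Z U $$ (x, y) * cnj (?Z U $$ (x, y))) = complex_of_real (hs_norm2 (?Z U))"
      unfolding hs_norm2_def of_real_sum complex_norm_square carrier_matD[OF c] ..
    thus "(\<Sum>x<d. \<Sum>y<d. ?Z U $$ (x, y) * cnj (?Z U $$ (x, y))) = complex_of_real (hs_norm2 B)"
      by (simp add: hs_norm2_conjugate[OF U B])
  qed
  also have "\<dots> = complex_of_real (hs_norm2 B)" using prob_space by simp
  finally show "(\<Sum>x<d. \<Sum>y<d. conj_moment B x y x y) = complex_of_real (hs_norm2 B)" .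
  have "(\<Sum>x<d. \<Sum>y<d. conj_moment B x x y y) = (LINT U|\<nu>. (\<Sum>x<d. \<Sum>y<d. ?Z U $$ (x, x) * cnj (?Z U $$ (y, y))))"
    unfolding conj_moment_def
    by (subst Bochner_Integration.integral_sum; (intro Bochner_Integration.integrable_sum integrable_conj_moment B sum.cong refl)?; simp?;
      subst Bochner_Integration.integral_sum; (intro integrable_conj_moment B sum.cong refl)?; simp?)
  also have "\<dots> = (LINT U|\<nu>. complex_of_real ((cmod (mtrace B))\<^sup>2))"
  proof (rule Bochner_Integration.integral_cong[OF refl])
    fix U assume "U \<in> space \<nu>"
    hence U: "unitary_mat d U" by (simp add: space_eq)
    note u = unitaryD[OF U]
    have Z: "?Z U \<in> carrier_mat d d" using u(1) B by simp
    have "mtrace (?Z U) = mtrace (mat_adjoint U * (U * B))"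
      using u(1,2) B by (intro mtrace_comm[of _ d d]) auto
    also have "mat_adjoint U * (U * B) = mat_adjoint U * U * B"
      using u(1,2) B by (simp add: assoc_mult_mat[of _ d d _ d _ d])
    also have "\<dots> = B" using u B by simp
    finally have "mtrace B = (\<Sum>x<d. ?Z U $$ (x, x))" using Z unfolding mtrace_def by auto
    thus "(\<Sum>x<d. \<Sum>y<d. ?Z U $$ (x, x) * cnj (?Z U $$ (y, y))) = complex_of_real ((cmod (mtrace B))\<^sup>2)"
      unfolding complex_norm_square by (simp add: sum_product)
  qed
  also have "\<dots> = complex_of_real ((cmod (mtrace B))\<^sup>2)" using prob_space by simp
  finally show "(\<Sum>x<d. \<Sum>y<d. conj_moment B x x y y) = complex_of_real ((cmod (mtrace B))\<^sup>2)" .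
qed

lemma design_unitary_probability: "unitary_2_design d \<nu> \<Longrightarrow> unitary_probability \<nu> d"
  unfolding unitary_2_design_def unitary_probability_def unitary_probability_axioms_def by blast

lemma design_moment_form:
  assumes des: "unitary_2_design d \<nu>" and d: "2 \<le> d" and B: "B \<in> carrier_mat d d"
  obtains A C where "\<And>x y x' y'. x < d \<Longrightarrow> y < d \<Longrightarrow> x' < d \<Longrightarrow> y' < d \<Longrightarrow>
      unitary_probability.conj_moment \<nu> B x y x' y' =
        C * (if x = y \<and> x' = y' then 1 else 0) + A * (if x = x' \<and> y = y' then 1 else 0)"
    "of_nat d * C + of_nat d * of_nat d * A = complex_of_real (hs_norm2 B)"
    "of_nat d * of_nat d * C + of_nat d * A = complex_of_real ((cmod (mtrace B))\<^sup>2)"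
proof -
  have \<nu>: "unitary_probability \<nu> d" using des by (rule design_unitary_probability)
  obtain \<mu> where h: "haar_unitary d \<mu>" and tw: "\<forall>X\<in>carrier_mat (d * d) (d * d). twirl2 d \<nu> X = twirl2 d \<mu> X"
    using des unfolding unitary_2_design_def by blast
  have \<mu>: "unitary_probability \<mu> d"
    using h unfolding haar_unitary_def unitary_probability_def unitary_probability_axioms_def by blast
  have "haar_probability \<mu> d" using h \<mu> unfolding haar_probability_def haar_probability_axioms_def by blast
  note form = haar_probability.conj_moment_form[OF this B d]
  define A where "A = unitary_probability.conj_moment \<mu> B 0 1 0 1"
  define C where "C = unitary_probability.conj_moment \<mu> B 0 0 1 1"
  have *: "unitary_probability.conj_moment \<nu> B x y x' y' =
        C * (if x = y \<and> x' = y' then 1 else 0) + A * (if x = x' \<and> y = y' then 1 else 0)"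
    if "x < d" "y < d" "x' < d" "y' < d" for x y x' y'
    unfolding A_def C_def design_conj_moment[OF \<nu> \<mu> tw B that] by (rule form[OF that])
  have "complex_of_real (hs_norm2 B) = (\<Sum>x<d. \<Sum>y<d. C * (if x = y then 1 else 0) + A)"
    unfolding unitary_probability.conj_moment_sums(1)[OF \<nu> B, symmetric] by (intro sum.cong refl) (auto simp: *)
  also have "\<dots> = of_nat d * C + of_nat d * of_nat d * A"
    by (simp add: sum.distrib algebra_simps)
  finally have 1: "of_nat d * C + of_nat d * of_nat d * A = complex_of_real (hs_norm2 B)" by simp
  have "complex_of_real ((cmod (mtrace B))\<^sup>2) = (\<Sum>x<d. \<Sum>y<d. C + A * (if x = y then 1 else 0))"
    unfolding unitary_probability.conj_moment_sums(2)[OF \<nu> B, symmetric] by (intro sum.cong refl) (auto simp: *)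
  also have "\<dots> = of_nat d * of_nat d * C + of_nat d * A"
    by (simp add: sum.distrib algebra_simps)
  finally have 2: "of_nat d * of_nat d * C + of_nat d * A = complex_of_real ((cmod (mtrace B))\<^sup>2)" by simp
  show thesis by (rule that[OF * 1 2])
qed

text \<open>Each \<open>s\<close> stands for a linear functional of U B U^dagger with coefficients
  \<open>K s\<close>. Solving the two linear equations in dimension 4 produces the denominator 60 =
  4 (4^2 - 1).\<close>

lemma design_quadratic_moment:
  fixes K :: "'s \<Rightarrow> nat \<Rightarrow> nat \<Rightarrow> complex"
  assumes des: "unitary_2_design 4 \<nu>" and B: "B \<in> carrier_mat 4 4" and S: "finite S"
  defines "f \<equiv> \<lambda>U. \<Sum>s\<in>S. (cmod (\<Sum>x<4. \<Sum>y<4. K s x y * (U * B * mat_adjoint U) $$ (x, y)))\<^sup>2"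
  shows "integrable \<nu> f"
    and "(LINT U|\<nu>. f U) =
      (4 * (cmod (mtrace B))\<^sup>2 - hs_norm2 B) / 60 * (\<Sum>s\<in>S. (cmod (\<Sum>x<4. K s x x))\<^sup>2) +
      (4 * hs_norm2 B - (cmod (mtrace B))\<^sup>2) / 60 * (\<Sum>s\<in>S. \<Sum>x<4. \<Sum>y<4. (cmod (K s x y))\<^sup>2)"
proof -
  interpret unitary_probability \<nu> 4 using des by (rule design_unitary_probability)
  let ?z = "\<lambda>U x y x' y'. (U * B * mat_adjoint U) $$ (x, y) * cnj ((U * B * mat_adjoint U) $$ (x', y'))"
  let ?F = "\<lambda>U. \<Sum>s\<in>S. \<Sum>x<4. \<Sum>y<4. \<Sum>x'<4. \<Sum>y'<4. K s x y * cnj (K s x' y') * ?z U x y x' y'"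
  have fF: "complex_of_real (f U) = ?F U" for U
    unfolding f_def of_real_sum complex_norm_square cnj_sum sum_distrib_right
    unfolding sum_distrib_left by (simp only: complex_cnj_mult mult_ac)
  have intF: "integrable \<nu> ?F"
    by (intro Bochner_Integration.integrable_sum integrable_mult_right integrable_conj_moment B) auto
  have "integrable \<nu> (\<lambda>U. Re (?F U))" using intF by (rule integrable_Re)
  moreover have "(\<lambda>U. Re (?F U)) = f" unfolding fF[symmetric] by simp
  ultimately show int: "integrable \<nu> f" by simp
  obtain A C where form: "\<And>x y x' y'. x < 4 \<Longrightarrow> y < 4 \<Longrightarrow> x' < 4 \<Longrightarrow> y' < 4 \<Longrightarrow>
      conj_moment B x y x' y' = C * (if x = y \<and> x' = y' then 1 else 0) + A * (if x = x' \<and> y = y' then 1 else 0)"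
    and 1: "of_nat 4 * C + of_nat 4 * of_nat 4 * A = complex_of_real (hs_norm2 B)"
    and 2: "of_nat 4 * of_nat 4 * C + of_nat 4 * A = complex_of_real ((cmod (mtrace B))\<^sup>2)"
    by (rule design_moment_form[OF des _ B]) (simp, blast intro: that)
  have A: "A = complex_of_real ((4 * hs_norm2 B - (cmod (mtrace B))\<^sup>2) / 60)"
  proof -
    have "60 * A = 4 * (of_nat 4 * C + of_nat 4 * of_nat 4 * A) - (of_nat 4 * of_nat 4 * C + of_nat 4 * A)" by simp
    thus ?thesis unfolding 1 2 by (simp add: field_simps)
  qed
  have C: "C = complex_of_real ((4 * (cmod (mtrace B))\<^sup>2 - hs_norm2 B) / 60)"
  proof -
    have "60 * C = 4 * (of_nat 4 * of_nat 4 * C + of_nat 4 * A) - (of_nat 4 * C + of_nat 4 * of_nat 4 * A)" by simp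
    thus ?thesis unfolding 1 2 by (simp add: field_simps)
  qed
  have "complex_of_real (LINT U|\<nu>. f U) = (LINT U|\<nu>. ?F U)"
    unfolding fF[symmetric] by simp
  also have "\<dots> = (\<Sum>s\<in>S. \<Sum>x<4. \<Sum>y<4. \<Sum>x'<4. \<Sum>y'<4. K s x y * cnj (K s x' y') * (LINT U|\<nu>. ?z U x y x' y'))"
    by (subst Bochner_Integration.integral_sum;
        (intro Bochner_Integration.integrable_sum integrable_mult_right integrable_conj_moment B sum.cong refl)?; simp?)+
  also have "\<dots> = (\<Sum>s\<in>S. \<Sum>x<4. \<Sum>y<4. \<Sum>x'<4. \<Sum>y'<4.
      C * ((if y = x then K s x y else 0) * (if y' = x' then cnj (K s x' y') else 0)) +
      A * (if y' = y then (if x' = x then K s x y * cnj (K s x' y') else 0) else 0))"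
    by (intro sum.cong refl) (auto simp: form simp flip: conj_moment_def simp: algebra_simps)
  also have "\<dots> = (\<Sum>s\<in>S. C * ((\<Sum>x<4. K s x x) * cnj (\<Sum>x<4. K s x x)) + A * (\<Sum>x<4. \<Sum>y<4. K s x y * cnj (K s x y)))"
  proof (rule sum.cong[OF refl])
    fix s
    have "(\<Sum>x<4. \<Sum>y<4. \<Sum>x'<4. \<Sum>y'<4.
        C * ((if y = x then K s x y else 0) * (if y' = x' then cnj (K s x' y') else 0)) +
        A * (if y' = y then (if x' = x then K s x y * cnj (K s x' y') else 0) else 0)) =
      C * ((\<Sum>x<4. \<Sum>y<4. if y = x then K s x y else 0) * (\<Sum>x'<4. \<Sum>y'<4. if y' = x' then cnj (K s x' y') else 0)) +
      A * (\<Sum>x<4. \<Sum>y<4. \<Sum>x'<4. \<Sum>y'<4. if y' = y then (if x' = x then K s x y * cnj (K s x' y') else 0) else 0)"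
      unfolding sum.distrib sum_distrib_left[symmetric] sum_distrib_right[symmetric] ..
    also have "\<dots> = C * ((\<Sum>x<4. K s x x) * cnj (\<Sum>x<4. K s x x)) + A * (\<Sum>x<4. \<Sum>y<4. K s x y * cnj (K s x y))"
      by simp
    finally show "(\<Sum>x<4. \<Sum>y<4. \<Sum>x'<4. \<Sum>y'<4.
        C * ((if y = x then K s x y else 0) * (if y' = x' then cnj (K s x' y') else 0)) +
        A * (if y' = y then (if x' = x then K s x y * cnj (K s x' y') else 0) else 0)) =
      C * ((\<Sum>x<4. K s x x) * cnj (\<Sum>x<4. K s x x)) + A * (\<Sum>x<4. \<Sum>y<4. K s x y * cnj (K s x y))" .
  qed
  also have "\<dots> = C * complex_of_real (\<Sum>s\<in>S. (cmod (\<Sum>x<4. K s x x))\<^sup>2) +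
      A * complex_of_real (\<Sum>s\<in>S. \<Sum>x<4. \<Sum>y<4. (cmod (K s x y))\<^sup>2)"
    unfolding of_real_sum complex_norm_square by (simp only: sum.distrib sum_distrib_left)
  finally have "complex_of_real (LINT U|\<nu>. f U) = complex_of_real (
      (4 * (cmod (mtrace B))\<^sup>2 - hs_norm2 B) / 60 * (\<Sum>s\<in>S. (cmod (\<Sum>x<4. K s x x))\<^sup>2) +
      (4 * hs_norm2 B - (cmod (mtrace B))\<^sup>2) / 60 * (\<Sum>s\<in>S. \<Sum>x<4. \<Sum>y<4. (cmod (K s x y))\<^sup>2))"
    unfolding A C by (simp only: of_real_add of_real_mult)
  thus "(LINT U|\<nu>. f U) =
      (4 * (cmod (mtrace B))\<^sup>2 - hs_norm2 B) / 60 * (\<Sum>s\<in>S. (cmod (\<Sum>x<4. K s x x))\<^sup>2) +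
      (4 * hs_norm2 B - (cmod (mtrace B))\<^sup>2) / 60 * (\<Sum>s\<in>S. \<Sum>x<4. \<Sum>y<4. (cmod (K s x y))\<^sup>2)"
    by (simp only: of_real_eq_iff)
qed

section \<open>Second moment of a noisy two-qubit gate\<close>

type_synonym kernel = "nat \<Rightarrow> nat \<Rightarrow> nat \<Rightarrow> nat \<Rightarrow> complex"

text \<open>In every kernel the first two indices belong to the output matrix, the last two to the
  input matrix.\<close>

definition channel_kernel :: "(complex mat \<Rightarrow> complex mat) \<Rightarrow> kernel" where
  "channel_kernel N r s x y = N (mat_unit 2 x y) $$ (r, s)"

text \<open>The tensor square of the map; a two-qubit index is 2 i + j.\<close>

definition pair_kernel :: "kernel \<Rightarrow> kernel" where
  "pair_kernel k r s x y = k (r div 2) (s div 2) (x div 2) (y div 2) * k (r mod 2) (s mod 2) (x mod 2) (y mod 2)"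

lemma sum4_div_mod: "(\<Sum>u<4. f (u div 2) * g (u mod 2)) = (\<Sum>i<2. f i) * (\<Sum>j<2. g j)"
  for f g :: "nat \<Rightarrow> 'a :: comm_semiring_1"
  using sum_div_mod[of "\<lambda>u. f (u div 2) * g (u mod 2)" 2 2] by (simp add: sum_product)

lemma sum4_div_mod2:
  fixes f g :: "nat \<Rightarrow> nat \<Rightarrow> 'a :: comm_semiring_1"
  shows "(\<Sum>u<4. \<Sum>v<4. f (u div 2) (v div 2) * g (u mod 2) (v mod 2)) =
     (\<Sum>i<2. \<Sum>j<2. f i j) * (\<Sum>i<2. \<Sum>j<2. g i j)"
  unfolding sum4_div_mod by (rule sum4_div_mod)

lemma channel_norm_kernel:
  assumes N: "qubit_channel N"
  shows "channel_norm N = (\<Sum>r<2. \<Sum>s<2. \<Sum>x<2. \<Sum>y<2. (cmod (channel_kernel N r s x y))\<^sup>2)"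
proof -
  have h: "hs_norm2 (N (mat_unit 2 x y)) = (\<Sum>r<2. \<Sum>s<2. (cmod (channel_kernel N r s x y))\<^sup>2)" for x y
    using channel_carrier[OF N, of "mat_unit 2 x y"] unfolding hs_norm2_def channel_kernel_def by auto
  show ?thesis unfolding channel_norm_def h by (simp add: sum_lessThan_2)
qed

lemma channel_identity_kernel:
  assumes N: "qubit_channel N"
  shows "hs_norm2 (N (1\<^sub>m 2)) = (\<Sum>r<2. \<Sum>s<2. (cmod (\<Sum>x<2. channel_kernel N r s x x))\<^sup>2)"
proof -
  have "N (1\<^sub>m 2) \<in> carrier_mat 2 2" by (rule channel_carrier[OF N]) simp
  hence "hs_norm2 (N (1\<^sub>m 2)) = (\<Sum>r<2. \<Sum>s<2. (cmod (N (1\<^sub>m 2) $$ (r, s)))\<^sup>2)"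
    unfolding hs_norm2_def by auto
  moreover have "N (1\<^sub>m 2) $$ (r, s) = (\<Sum>x<2. channel_kernel N r s x x)" if "r < 2" "s < 2" for r s
    using channel_entry[OF N one_carrier_mat that] by (simp add: sum_lessThan_2 channel_kernel_def)
  ultimately show ?thesis by simp
qed

lemma pair_kernel_norm:
  assumes N: "qubit_channel N"
  shows "(\<Sum>r<4. \<Sum>s<4. \<Sum>x<4. \<Sum>y<4. (cmod (pair_kernel (channel_kernel N) r s x y))\<^sup>2) = (channel_norm N)\<^sup>2"
proof -
  define F where "F = (\<lambda>r s. \<Sum>x<2. \<Sum>y<2. (cmod (channel_kernel N r s x y))\<^sup>2)"
  have "(\<Sum>x<4. \<Sum>y<4. (cmod (pair_kernel (channel_kernel N) r s x y))\<^sup>2) = F (r div 2) (s div 2) * F (r mod 2) (s mod 2)" for r s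
    using sum4_div_mod2[of "\<lambda>x y. (cmod (channel_kernel N (r div 2) (s div 2) x y))\<^sup>2"
        "\<lambda>x y. (cmod (channel_kernel N (r mod 2) (s mod 2) x y))\<^sup>2"]
    by (simp add: pair_kernel_def norm_mult power_mult_distrib F_def)
  thus ?thesis using sum4_div_mod2[of F F] unfolding channel_norm_kernel[OF N]
    by (simp add: F_def power2_eq_square)
qed

lemma pair_kernel_identity:
  assumes N: "qubit_channel N"
  shows "(\<Sum>r<4. \<Sum>s<4. (cmod (\<Sum>x<4. pair_kernel (channel_kernel N) r s x x))\<^sup>2) = (hs_norm2 (N (1\<^sub>m 2)))\<^sup>2"
proof -
  define F where "F = (\<lambda>r s. (cmod (\<Sum>x<2. channel_kernel N r s x x))\<^sup>2)"
  have "(cmod (\<Sum>x<4. pair_kernel (channel_kernel N) r s x x))\<^sup>2 = F (r div 2) (s div 2) * F (r mod 2) (s mod 2)" for r s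
    using sum4_div_mod[of "\<lambda>x. channel_kernel N (r div 2) (s div 2) x x"
        "\<lambda>x. channel_kernel N (r mod 2) (s mod 2) x x"]
    by (simp add: pair_kernel_def norm_mult power_mult_distrib F_def)
  thus ?thesis using sum4_div_mod2[of F F] unfolding channel_identity_kernel[OF N]
    by (simp add: F_def power2_eq_square)
qed

text \<open>The image has trace 2, and among 2 x 2 matrices of trace 2 the identity has the least
  Hilbert-Schmidt norm, by Cauchy-Schwarz on the diagonal.\<close>

lemma channel_identity_norm_ge:
  assumes N: "qubit_channel N"
  shows "2 \<le> hs_norm2 (N (1\<^sub>m 2))"
proof -
  let ?A = "N (1\<^sub>m 2)"
  have c: "?A \<in> carrier_mat 2 2" by (rule channel_carrier[OF N]) simp
  have "mtrace ?A = mtrace (1\<^sub>m 2)" using N unfolding qubit_channel_def by simp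
  hence tr: "?A $$ (0, 0) + ?A $$ (1, 1) = 2" using c by (auto simp: mtrace_def sum_lessThan_2)
  have "hs_norm2 ?A = (\<Sum>x<2. \<Sum>y<2. (cmod (?A $$ (x, y)))\<^sup>2)" using c unfolding hs_norm2_def by auto
  hence "hs_norm2 ?A \<ge> (cmod (?A $$ (0, 0)))\<^sup>2 + (cmod (?A $$ (1, 1)))\<^sup>2" by (simp add: sum_lessThan_2)
  moreover have "2 \<le> cmod (?A $$ (0, 0)) + cmod (?A $$ (1, 1))"
    using norm_triangle_ineq[of "?A $$ (0, 0)" "?A $$ (1, 1)"] unfolding tr by simp
  hence "2\<^sup>2 \<le> (cmod (?A $$ (0, 0)) + cmod (?A $$ (1, 1)))\<^sup>2" by (intro power_mono) auto
  moreover have "(cmod (?A $$ (0, 0)) + cmod (?A $$ (1, 1)))\<^sup>2 \<le> 2 * ((cmod (?A $$ (0, 0)))\<^sup>2 + (cmod (?A $$ (1, 1)))\<^sup>2)"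
    using zero_le_power2[of "cmod (?A $$ (0, 0)) - cmod (?A $$ (1, 1))"] by (simp add: power2_eq_square algebra_simps)
  ultimately show ?thesis by simp
qed

lemma norm_add_square_le: "(cmod (a + b))\<^sup>2 \<le> 2 * (cmod a)\<^sup>2 + 2 * (cmod b)\<^sup>2"
proof -
  have "(cmod (a + b))\<^sup>2 \<le> (cmod a + cmod b)\<^sup>2" by (intro power_mono norm_triangle_ineq) simp
  also have "\<dots> \<le> 2 * (cmod a)\<^sup>2 + 2 * (cmod b)\<^sup>2"
    using zero_le_power2[of "cmod a - cmod b"] by (simp add: power2_eq_square algebra_simps)
  finally show ?thesis .
qed

text \<open>N(1) is the sum of two of the four images that make up the channel norm; the factor 2 is
  the price of squaring a sum of two terms.\<close>

lemma channel_identity_norm_le: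
  assumes N: "qubit_channel N"
  shows "hs_norm2 (N (1\<^sub>m 2)) \<le> 2 * channel_norm N"
proof -
  let ?k = "channel_kernel N"
  have "hs_norm2 (N (1\<^sub>m 2)) \<le> (\<Sum>r<2. \<Sum>s<2. 2 * (cmod (?k r s 0 0))\<^sup>2 + 2 * (cmod (?k r s 1 1))\<^sup>2)"
    unfolding channel_identity_kernel[OF N] by (intro sum_mono) (simp add: sum_lessThan_2 norm_add_square_le del: One_nat_def)
  also have "\<dots> \<le> (\<Sum>r<2. \<Sum>s<2. 2 * (\<Sum>x<2. \<Sum>y<2. (cmod (?k r s x y))\<^sup>2))"
    by (intro sum_mono) (simp add: sum_lessThan_2)
  also have "\<dots> = 2 * channel_norm N" unfolding channel_norm_kernel[OF N] by (simp only: sum_distrib_left)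
  finally show ?thesis .
qed

text \<open>The two coefficients arise by regrouping the second moment of a design, taken for the
  kernel of N \<otimes> N, according to |tr B|^2 and the squared Hilbert-Schmidt norm of B.\<close>

definition pair_trace_coeff :: "(complex mat \<Rightarrow> complex mat) \<Rightarrow> real" where
  "pair_trace_coeff N = (4 * (hs_norm2 (N (1\<^sub>m 2)))\<^sup>2 - (channel_norm N)\<^sup>2) / 60"

definition pair_norm_coeff :: "(complex mat \<Rightarrow> complex mat) \<Rightarrow> real" where
  "pair_norm_coeff N = (4 * (channel_norm N)\<^sup>2 - (hs_norm2 (N (1\<^sub>m 2)))\<^sup>2) / 60"

text \<open>Here a is the square of \<open>hs_norm2 (N (1\<^sub>m 2))\<close> and b the square of
  the channel norm. The sum is (a + b) / 20 \<le> b / 4, and b < 4 is exactly what a contraction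
  coefficient below 1/3 provides.\<close>

lemma pair_coeff_bounds:
  fixes a b :: real
  assumes "b < 4" "4 \<le> a" "a \<le> 4 * b"
  shows "0 \<le> (4 * a - b) / 60" "0 \<le> (4 * b - a) / 60" "(4 * a - b) / 60 + (4 * b - a) / 60 < 1"
  using assms by (simp_all add: field_simps)

lemma pair_coeffs:
  assumes N: "qubit_channel N" and c: "contraction_coefficient N < 1 / 3"
  shows "pair_trace_coeff N \<ge> 0" "pair_norm_coeff N \<ge> 0" "pair_trace_coeff N + pair_norm_coeff N < 1"
proof -
  let ?h = "hs_norm2 (N (1\<^sub>m 2))" and ?c = "channel_norm N"
  have c2: "?c < 2" using c channel_norm_contraction_coefficient[OF N] by simp
  have h: "2 \<le> ?h" "?h \<le> 2 * ?c" by (rule channel_identity_norm_ge[OF N] channel_identity_norm_le[OF N])+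
  have "2\<^sup>2 \<le> ?h\<^sup>2" using h by (intro power_mono) auto
  moreover have "?h\<^sup>2 \<le> (2 * ?c)\<^sup>2" using h by (intro power_mono) auto
  moreover have "?c\<^sup>2 < 2\<^sup>2" using c2 h by (intro power_strict_mono) auto
  ultimately have "?c\<^sup>2 < 4" "4 \<le> ?h\<^sup>2" "?h\<^sup>2 \<le> 4 * ?c\<^sup>2" by (simp_all add: power_mult_distrib)
  from pair_coeff_bounds[OF this]
  show "pair_trace_coeff N \<ge> 0" "pair_norm_coeff N \<ge> 0" "pair_trace_coeff N + pair_norm_coeff N < 1"
    unfolding pair_trace_coeff_def pair_norm_coeff_def by blast+
qed

theorem pair_moment:
  assumes N: "qubit_channel N" and des: "unitary_2_design 4 \<nu>" and B: "B \<in> carrier_mat 4 4"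
  defines "f \<equiv> \<lambda>U. \<Sum>r<4. \<Sum>s<4. (cmod (\<Sum>x<4. \<Sum>y<4.
      pair_kernel (channel_kernel N) r s x y * (U * B * mat_adjoint U) $$ (x, y)))\<^sup>2"
  shows "integrable \<nu> f"
    and "(LINT U|\<nu>. f U) = pair_trace_coeff N * (cmod (mtrace B))\<^sup>2 + pair_norm_coeff N * hs_norm2 B"
proof -
  let ?k = "pair_kernel (channel_kernel N)"
  let ?S = "{..<4::nat} \<times> {..<4::nat}"
  have pairs: "(\<Sum>p\<in>?S. g (fst p) (snd p)) = (\<Sum>r<4. \<Sum>s<4. g r s)" for g :: "nat \<Rightarrow> nat \<Rightarrow> real"
    by (simp add: sum.cartesian_product case_prod_beta)
  have f: "f = (\<lambda>U. \<Sum>p\<in>?S. (cmod (\<Sum>x<4. \<Sum>y<4. ?k (fst p) (snd p) x y * (U * B * mat_adjoint U) $$ (x, y)))\<^sup>2)"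
    unfolding f_def by (subst pairs) (rule refl)
  note q = design_quadratic_moment[OF des B, of ?S "\<lambda>p. ?k (fst p) (snd p)"]
  show "integrable \<nu> f" unfolding f by (rule q(1)) simp
  have "(\<Sum>p\<in>?S. (cmod (\<Sum>x<4. ?k (fst p) (snd p) x x))\<^sup>2) = (hs_norm2 (N (1\<^sub>m 2)))\<^sup>2"
    unfolding pair_kernel_identity[OF N, symmetric] by (rule pairs)
  moreover have "(\<Sum>p\<in>?S. \<Sum>x<4. \<Sum>y<4. (cmod (?k (fst p) (snd p) x y))\<^sup>2) = (channel_norm N)\<^sup>2"
    unfolding pair_kernel_norm[OF N, symmetric] by (rule pairs)
  ultimately show "(LINT U|\<nu>. f U) = pair_trace_coeff N * (cmod (mtrace B))\<^sup>2 + pair_norm_coeff N * hs_norm2 B"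
    unfolding f q(2)[OF finite_cartesian_product[OF finite_lessThan finite_lessThan]]
    by (simp add: pair_trace_coeff_def pair_norm_coeff_def field_simps)
qed

section \<open>Local maps on operators\<close>

text \<open>A basis index is read as \<open>(x * d + b) * q + y\<close> with digit \<open>b < d\<close> and \<open>y < q\<close>: a
  \<open>d\<close>-level system followed by systems of total dimension \<open>q\<close>. Of two disjoint blocks with
  parameters \<open>d, q\<close> and \<open>d', q'\<close>, the second one is the less significant if \<open>d' * q'\<close> divides
  \<open>q\<close>.\<close>

definition digit :: "nat \<Rightarrow> nat \<Rightarrow> nat \<Rightarrow> nat" where
  "digit d q r = r div q mod d"

definition put_digit :: "nat \<Rightarrow> nat \<Rightarrow> nat \<Rightarrow> nat \<Rightarrow> nat" where
  "put_digit d q r b = (r div (d * q) * d + b) * q + r mod q"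

lemma digit_less: "0 < d \<Longrightarrow> digit d q r < d"
  by (simp add: digit_def)

lemma split_digits: "r = (r div (d * q) * d + digit d q r) * q + r mod q"
proof -
  have "r div q = r div (d * q) * d + digit d q r"
    unfolding digit_def by (metis div_mult2_eq div_mult_mod_eq mult.commute)
  thus ?thesis by (metis div_mult_mod_eq)
qed

text \<open>Free of division and subtraction in \<open>put_digit\<close>: identities between several
  replacements then follow by linear arithmetic.\<close>

lemma put_digit_shift: "put_digit d q r b + digit d q r * q = r + b * q"
  by (subst (3) split_digits[of r d q]) (simp add: put_digit_def algebra_simps)

lemma put_digit_same [simp]: "put_digit d q r (digit d q r) = r"
  using put_digit_shift[of d q r "digit d q r"] by simp

lemma digits_of_composite:
  assumes "b < d" "y < q"
  shows "digit d q ((x * d + b) * q + y) = b" "put_digit d q ((x * d + b) * q + y) c = (x * d + c) * q + y"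
    "((x * d + b) * q + y) div (d * q) = x" "((x * d + b) * q + y) mod q = y"
    "((x * d + b) * q + y) div q = x * d + b"
proof -
  have q: "((x * d + b) * q + y) div q = x * d + b" "((x * d + b) * q + y) mod q = y" using assms by auto
  moreover have dq: "((x * d + b) * q + y) div (d * q) = x"
  proof -
    have "((x * d + b) * q + y) div (q * d) = x" unfolding div_mult2_eq q using assms by simp
    thus ?thesis by (simp add: mult.commute)
  qed
  ultimately show "digit d q ((x * d + b) * q + y) = b" "put_digit d q ((x * d + b) * q + y) c = (x * d + c) * q + y"
    "((x * d + b) * q + y) div (d * q) = x" "((x * d + b) * q + y) mod q = y"
    "((x * d + b) * q + y) div q = x * d + b"
    using assms by (auto simp: digit_def put_digit_def)
qed

lemma put_digit_decomp:
  assumes "0 < q" "b < d"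
  shows "digit d q (put_digit d q r b) = b" "put_digit d q (put_digit d q r b) c = put_digit d q r c"
    "put_digit d q r b div (d * q) = r div (d * q)" "put_digit d q r b mod q = r mod q"
  unfolding put_digit_def[of d q r b] using digits_of_composite[of b d "r mod q" q "r div (d * q)"] assms
  by (auto simp: put_digit_def[of d q r c])

lemma put_digit_less:
  assumes D: "d * q dvd D" and r: "r < D" and b: "b < d"
  shows "put_digit d q r b < D"
proof -
  obtain p where p: "D = d * q * p" using D by (rule dvdE)
  have q: "0 < q" "0 < d" using p r b by (auto intro: gr0I)
  have "r div (d * q) < p" using r q unfolding p by (simp add: less_mult_imp_div_less mult.commute)
  hence "r div (d * q) * d + b < p * d" using b by (rule mult_add_less)
  hence "put_digit d q r b < p * d * q" unfolding put_digit_def using q by (intro mult_add_less[of _ "p * d"]) auto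
  thus ?thesis by (simp add: p mult_ac)
qed

text \<open>As d' q' divides q, changing the lower digit preserves r div q and changing the upper
  one preserves r modulo d' q', so neither replacement affects the other digit. Each one shifts r by
  an amount that depends only on its own digit, whence the order is immaterial.\<close>

lemma put_digit_disjoint:
  assumes q: "d' * q' dvd q" "0 < q" and b: "b < d" "b' < d'"
  shows "digit d q (put_digit d' q' r b') = digit d q r"
    "digit d' q' (put_digit d q r b) = digit d' q' r"
    "put_digit d q (put_digit d' q' r b') b = put_digit d' q' (put_digit d q r b) b'"
proof -
  obtain m where m: "q = d' * q' * m" using q(1) by (rule dvdE)
  have q': "0 < q'" using q(2) m by (auto intro: gr0I)
  have "put_digit d' q' r b' div q = r div q"
    unfolding m div_mult2_eq[of _ "d' * q'"] put_digit_decomp(3)[OF q' b(2)] ..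
  thus 1: "digit d q (put_digit d' q' r b') = digit d q r" by (simp add: digit_def)
  have dig: "digit d' q' x = x mod (d' * q') div q'" for x
    using mod_mult2_eq[of x q' d'] q' by (simp add: digit_def mult.commute)
  have "put_digit d q r b mod (d' * q') = r mod (d' * q')"
    by (metis q(1) mod_mod_cancel put_digit_decomp(4)[OF q(2) b(1)])
  thus 2: "digit d' q' (put_digit d q r b) = digit d' q' r" unfolding dig by simp
  show "put_digit d q (put_digit d' q' r b') b = put_digit d' q' (put_digit d q r b) b'"
    using put_digit_shift[of d q "put_digit d' q' r b'" b] put_digit_shift[of d' q' r b']
      put_digit_shift[of d' q' "put_digit d q r b" b'] put_digit_shift[of d q r b] 1 2 by simp
qed

text \<open>id \<otimes> K \<otimes> id for a kernel on a d-level digit. Gates, noise and resets are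
  all of this form, so commutation, norm and trace can be treated once for all of them.\<close>

definition loc :: "nat \<Rightarrow> nat \<Rightarrow> nat \<Rightarrow> kernel \<Rightarrow> complex mat \<Rightarrow> complex mat" where
  "loc D d q k X = mat D D (\<lambda>(r, s). \<Sum>b<d. \<Sum>c<d.
     k (digit d q r) (digit d q s) b c * X $$ (put_digit d q r b, put_digit d q s c))"

lemma loc_carrier [simp]: "loc D d q k X \<in> carrier_mat D D"
  by (simp add: loc_def)

lemma loc_index:
  "r < D \<Longrightarrow> s < D \<Longrightarrow> loc D d q k X $$ (r, s) =
     (\<Sum>b<d. \<Sum>c<d. k (digit d q r) (digit d q s) b c * X $$ (put_digit d q r b, put_digit d q s c))"
  by (simp add: loc_def)

lemma loc_commute:
  assumes D: "d * q dvd D" "0 < D" and q: "d' * q' dvd q"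
  shows "loc D d q k (loc D d' q' k' X) = loc D d' q' k' (loc D d q k X)"
proof (rule eq_matI)
  fix r s assume "r < dim_row (loc D d' q' k' (loc D d q k X))" "s < dim_col (loc D d' q' k' (loc D d q k X))"
  hence rs: "r < D" "s < D" by (auto simp: loc_def)
  have q0: "0 < q" using D by (auto intro: gr0I)
  have "q dvd D" using D(1) by (rule dvd_mult_right)
  hence D': "d' * q' dvd D" using q dvd_trans by blast
  have "loc D d q k (loc D d' q' k' X) $$ (r, s) = (\<Sum>b<d. \<Sum>c<d. \<Sum>b'<d'. \<Sum>c'<d'.
      k (digit d q r) (digit d q s) b c * (k' (digit d' q' r) (digit d' q' s) b' c' *
        X $$ (put_digit d' q' (put_digit d q r b) b', put_digit d' q' (put_digit d q s c) c')))"
    unfolding loc_index[OF rs] sum_distrib_left[symmetric]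
    using D(1) rs by (intro sum.cong refl) (auto simp: loc_index put_digit_less put_digit_disjoint(2)[OF q q0, where b' = 0] sum_distrib_left)
  also have "\<dots> = (\<Sum>b'<d'. \<Sum>c'<d'. \<Sum>b<d. \<Sum>c<d.
      k (digit d q r) (digit d q s) b c * (k' (digit d' q' r) (digit d' q' s) b' c' *
        X $$ (put_digit d' q' (put_digit d q r b) b', put_digit d' q' (put_digit d q s c) c')))"
    by (subst (2) sum.swap, subst sum.swap, subst (3) sum.swap, subst (2) sum.swap) (rule refl)
  also have "\<dots> = loc D d' q' k' (loc D d q k X) $$ (r, s)"
    unfolding loc_index[OF rs]
    using D' rs by (intro sum.cong refl) (auto simp: loc_index put_digit_less put_digit_disjoint[OF q q0] sum_distrib_left mult_ac)
  finally show "loc D d q k (loc D d' q' k' X) $$ (r, s) = loc D d' q' k' (loc D d q k X) $$ (r, s)" .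
qed (auto simp: loc_def)

lemma digit_pair: "digit 4 q r div 2 = digit 2 (2 * q) r" "digit 4 q r mod 2 = digit 2 q r"
proof -
  have "r div q mod 4 = 2 * (r div q div 2 mod 2) + r div q mod 2" using mod_mult2_eq[of "r div q" 2 2] by simp
  thus "digit 4 q r div 2 = digit 2 (2 * q) r" "digit 4 q r mod 2 = digit 2 q r"
    unfolding digit_def by (simp_all add: div_mult2_eq[symmetric] mult.commute)
qed

lemma put_digit_pair:
  assumes "0 < q" "b < 2" "c < 2"
  shows "put_digit 2 q (put_digit 2 (2 * q) r b) c = put_digit 4 q r (b * 2 + c)"
proof -
  have 1: "digit 2 q (put_digit 2 (2 * q) r b) = digit 2 q r"
    using put_digit_disjoint(2)[of 2 q "2 * q" b 2 0 r] assms by simp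
  have "digit 4 q r = digit 2 (2 * q) r * 2 + digit 2 q r"
    using div_mult_mod_eq[of "digit 4 q r" 2] digit_pair[of q r] by simp
  thus ?thesis
    using put_digit_shift[of 2 q "put_digit 2 (2 * q) r b" c] put_digit_shift[of 2 "2 * q" r b] put_digit_shift[of 4 q r "b * 2 + c"]
    unfolding 1 by (simp add: algebra_simps)
qed

text \<open>This merges the noise on two neighbouring qubits into one map on the four-level digit on
  which their gate acts.\<close>

lemma loc_pair:
  assumes D: "4 * q dvd D" "0 < D"
  shows "loc D 2 (2 * q) k (loc D 2 q k X) = loc D 4 q (pair_kernel k) X"
proof (rule eq_matI)
  fix r s assume "r < dim_row (loc D 4 q (pair_kernel k) X)" "s < dim_col (loc D 4 q (pair_kernel k) X)"
  hence rs: "r < D" "s < D" by (auto simp: loc_def)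
  have q0: "0 < q" using D by (auto intro: gr0I)
  have D2: "2 * (2 * q) dvd D" using D by (simp add: mult.assoc[symmetric])
  have low: "digit 2 q (put_digit 2 (2 * q) r b) = digit 2 q r" if "b < 2" for r b
    using put_digit_disjoint(2)[of 2 q "2 * q" b 2 0 r] q0 that by simp
  let ?F = "\<lambda>b b' c c'. k (digit 2 (2 * q) r) (digit 2 (2 * q) s) b c * k (digit 2 q r) (digit 2 q s) b' c' *
      X $$ (put_digit 4 q r (b * 2 + b'), put_digit 4 q s (c * 2 + c'))"
  have "loc D 2 (2 * q) k (loc D 2 q k X) $$ (r, s) = (\<Sum>b<2. \<Sum>c<2. \<Sum>b'<2. \<Sum>c'<2. ?F b b' c c')"
    unfolding loc_index[OF rs] using D2 rs q0
    by (intro sum.cong refl) (auto simp: loc_index put_digit_less low put_digit_pair sum_distrib_left mult.assoc)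
  also have "\<dots> = (\<Sum>b<2. \<Sum>b'<2. \<Sum>c<2. \<Sum>c'<2. ?F b b' c c')"
    by (rule sum.cong[OF refl], rule sum.swap)
  also have "\<dots> = (\<Sum>u<2 * 2. \<Sum>v<2 * 2. pair_kernel k (digit 4 q r) (digit 4 q s) u v * X $$ (put_digit 4 q r u, put_digit 4 q s v))"
    unfolding sum_div_mod by (intro sum.cong refl) (simp add: pair_kernel_def digit_pair)
  also have "\<dots> = loc D 4 q (pair_kernel k) X $$ (r, s)" unfolding loc_index[OF rs] by simp
  finally show "loc D 2 (2 * q) k (loc D 2 q k X) $$ (r, s) = loc D 4 q (pair_kernel k) X $$ (r, s)" .
qed (auto simp: loc_def)

lemma apply_local_eq_loc:
  assumes N: "qubit_channel N" and D: "D = p * 2 * q" and X: "X \<in> carrier_mat D D"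
  shows "apply_local p N q X = loc D 2 q (channel_kernel N) X"
proof (rule eq_matI)
  fix r s assume "r < dim_row (loc D 2 q (channel_kernel N) X)" "s < dim_col (loc D 2 q (channel_kernel N) X)"
  hence rs: "r < D" "s < D" by (auto simp: loc_def)
  let ?B = "mat 2 2 (\<lambda>(b, c). X $$ ((r div (2 * q) * 2 + b) * q + r mod q, (s div (2 * q) * 2 + c) * q + s mod q))"
  have "apply_local p N q X $$ (r, s) = N ?B $$ (digit 2 q r, digit 2 q s)"
    using rs unfolding D by (simp add: apply_local_def digit_def)
  also have "\<dots> = (\<Sum>a<2. \<Sum>b<2. ?B $$ (a, b) * N (mat_unit 2 a b) $$ (digit 2 q r, digit 2 q s))"
    by (rule channel_entry[OF N]) (simp_all add: digit_less)
  also have "\<dots> = loc D 2 q (channel_kernel N) X $$ (r, s)"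
    unfolding loc_index[OF rs] by (intro sum.cong refl) (simp add: put_digit_def channel_kernel_def mult.commute)
  finally show "apply_local p N q X $$ (r, s) = loc D 2 q (channel_kernel N) X $$ (r, s)" .
qed (auto simp: loc_def apply_local_def D)

definition conj_kernel :: "complex mat \<Rightarrow> kernel" where
  "conj_kernel G r s b c = G $$ (r, b) * cnj (G $$ (s, c))"

text \<open>A row of an embedded gate is supported on the indices that agree with r outside the
  digit of the gate; the value of this digit parametrizes them.\<close>

lemma sum_same_block:
  fixes g :: "nat \<Rightarrow> complex"
  assumes D: "d * q dvd D" and r: "r < D"
  shows "(\<Sum>r'<D. if r' div (d * q) = r div (d * q) \<and> r' mod q = r mod q then g r' else 0) = (\<Sum>b<d. g (put_digit d q r b))"
proof -
  obtain p where p: "D = d * q * p" using D by (rule dvdE)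
  have q: "0 < q" "0 < d" using p r by (auto intro: gr0I)
  let ?S = "{r' \<in> {..<D}. r' div (d * q) = r div (d * q) \<and> r' mod q = r mod q}"
  have "?S = put_digit d q r ` {..<d}"
  proof (rule subset_antisym; rule subsetI)
    fix r' assume r': "r' \<in> ?S"
    hence "r' = put_digit d q r (digit d q r')"
      using split_digits[of r' d q] by (simp add: put_digit_def)
    thus "r' \<in> put_digit d q r ` {..<d}" using digit_less[OF q(2)] by blast
  qed (use q D r in \<open>auto simp: put_digit_less put_digit_decomp\<close>)
  moreover have "inj_on (put_digit d q r) {..<d}"
    by (rule inj_on_inverseI[of _ "digit d q"]) (use q in \<open>auto simp: put_digit_decomp\<close>)
  moreover have "(\<Sum>r'<D. if r' div (d * q) = r div (d * q) \<and> r' mod q = r mod q then g r' else 0) = (\<Sum>r'\<in>?S. g r')"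
    by (subst sum.inter_filter) auto
  ultimately show ?thesis by (simp add: sum.reindex)
qed

lemma embed_gate_carrier:
  assumes G: "G \<in> carrier_mat 4 4" and i: "1 \<le> i" "i < n"
  shows "embed_gate n i G \<in> carrier_mat (2 ^ n) (2 ^ n)"
proof -
  have "2 ^ (i - 1) * 4 * 2 ^ (n - i - 1) = (2 ^ (i - 1 + 2 + (n - i - 1)) :: nat)"
    by (simp add: power_add)
  also have "i - 1 + 2 + (n - i - 1) = n" using i by simp
  finally show ?thesis using G unfolding embed_gate_def kron_def by auto
qed

lemma embed_gate_index:
  assumes G: "G \<in> carrier_mat 4 4" and i: "1 \<le> i" "i < n" and q: "q = 2 ^ (n - i - 1)"
    and rs: "r < 2 ^ n" "s < 2 ^ n"
  shows "embed_gate n i G $$ (r, s) =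
    (if s div (4 * q) = r div (4 * q) \<and> s mod q = r mod q then G $$ (digit 4 q r, digit 4 q s) else 0)"
proof -
  have e: "2 ^ (i - 1) * 4 * q = (2 ^ n :: nat)"
  proof -
    have "2 ^ (i - 1) * 4 * q = (2 ^ (i - 1 + 2 + (n - i - 1)) :: nat)" by (simp add: power_add q)
    also have "i - 1 + 2 + (n - i - 1) = n" using i by simp
    finally show ?thesis .
  qed
  have q0: "0 < q" by (simp add: q)
  have lt: "r div q < 2 ^ (i - 1) * 4" "s div q < 2 ^ (i - 1) * 4" "r mod q < q" "s mod q < q"
    using rs q0 unfolding e[symmetric] by (simp_all add: less_mult_imp_div_less)
  hence lt4: "r div q div 4 < 2 ^ (i - 1)" "s div q div 4 < 2 ^ (i - 1)" by (simp_all add: less_mult_imp_div_less)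
  have dd: "x div q div 4 = x div (4 * q)" for x by (simp add: div_mult2_eq[symmetric] mult.commute)
  have "embed_gate n i G $$ (r, s) = kron (1\<^sub>m (2 ^ (i - 1))) G $$ (r div q, s div q) * 1\<^sub>m q $$ (r mod q, s mod q)"
    unfolding embed_gate_def q[symmetric] using rs G unfolding e[symmetric] by (subst kron_def) (auto simp: kron_def)
  also have "kron (1\<^sub>m (2 ^ (i - 1))) G $$ (r div q, s div q) =
     1\<^sub>m (2 ^ (i - 1)) $$ (r div q div 4, s div q div 4) * G $$ (digit 4 q r, digit 4 q s)"
    using lt G by (auto simp: kron_def digit_def)
  finally show ?thesis using lt lt4 by (auto simp: dd)
qed

lemma conjugate_embed_gate:
  assumes G: "G \<in> carrier_mat 4 4" and i: "1 \<le> i" "i < n" and X: "X \<in> carrier_mat (2 ^ n) (2 ^ n)"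
  shows "embed_gate n i G * X * mat_adjoint (embed_gate n i G) = loc (2 ^ n) 4 (2 ^ (n - i - 1)) (conj_kernel G) X"
proof (rule eq_matI)
  let ?E = "embed_gate n i G" and ?D = "2 ^ n :: nat"
  define q where "q = (2 ^ (n - i - 1) :: nat)"
  note E = embed_gate_carrier[OF G i]
  fix r s assume "r < dim_row (loc ?D 4 (2 ^ (n - i - 1)) (conj_kernel G) X)" "s < dim_col (loc ?D 4 (2 ^ (n - i - 1)) (conj_kernel G) X)"
  hence rs: "r < ?D" "s < ?D" by (auto simp: loc_def)
  have D: "4 * q dvd ?D"
  proof -
    have e: "4 * q = 2 ^ (2 + (n - i - 1))" by (simp add: q_def power_add)
    show ?thesis unfolding e by (rule le_imp_power_dvd) (use i in simp)
  qed
  have q0: "0 < q" by (simp add: q_def)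
  let ?c = "\<lambda>r r'. r' div (4 * q) = r div (4 * q) \<and> r' mod q = r mod q"
  have "(?E * X * mat_adjoint ?E) $$ (r, s) =
     (\<Sum>r'<?D. \<Sum>s'<?D. ?E $$ (r, r') * X $$ (r', s') * cnj (?E $$ (s, s')))"
    by (rule conjugate_entry[OF E X rs])
  also have "\<dots> = (\<Sum>r'<?D. if ?c r r' then (\<Sum>s'<?D. if ?c s s' then
      G $$ (digit 4 q r, digit 4 q r') * X $$ (r', s') * cnj (G $$ (digit 4 q s, digit 4 q s')) else 0) else 0)"
    using rs by (intro sum.cong refl) (auto simp: embed_gate_index[OF G i q_def] intro!: sum.cong)
  also have "\<dots> = (\<Sum>b<4. \<Sum>c<4. G $$ (digit 4 q r, digit 4 q (put_digit 4 q r b)) * X $$ (put_digit 4 q r b, put_digit 4 q s c)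
      * cnj (G $$ (digit 4 q s, digit 4 q (put_digit 4 q s c))))"
    unfolding sum_same_block[OF D rs(1)] sum_same_block[OF D rs(2)] ..
  also have "\<dots> = loc ?D 4 q (conj_kernel G) X $$ (r, s)"
    unfolding loc_index[OF rs] using q0 by (intro sum.cong refl) (auto simp: put_digit_decomp conj_kernel_def)
  finally show "(?E * X * mat_adjoint ?E) $$ (r, s) = loc ?D 4 (2 ^ (n - i - 1)) (conj_kernel G) X $$ (r, s)"
    by (simp add: q_def)
qed (use embed_gate_carrier[OF G i] in \<open>auto simp: loc_def\<close>)

subsection \<open>Norm, trace and positivity\<close>

text \<open>The d x d matrix left after fixing all coordinates outside the digit, \<open>x\<close>,
  \<open>y\<close> for rows and \<open>x'\<close>, \<open>y'\<close> for columns. A local map acts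
  on each block separately, and squared Hilbert-Schmidt norms add up over blocks.\<close>

definition block :: "nat \<Rightarrow> nat \<Rightarrow> complex mat \<Rightarrow> nat \<Rightarrow> nat \<Rightarrow> nat \<Rightarrow> nat \<Rightarrow> complex mat" where
  "block d q X x y x' y' = mat d d (\<lambda>(b, c). X $$ ((x * d + b) * q + y, (x' * d + c) * q + y'))"

lemma block_carrier [simp]: "block d q X x y x' y' \<in> carrier_mat d d"
  by (simp add: block_def)

lemma sum_digits:
  "(\<Sum>r<p * d * q. f r) = (\<Sum>x<p. \<Sum>y<q. \<Sum>b<d. f ((x * d + b) * q + y))" for f :: "nat \<Rightarrow> 'a :: comm_monoid_add"
  unfolding sum_div_mod[of f "p * d" q] sum_div_mod[of _ p d] by (intro sum.cong refl sum.swap)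

lemma hs_norm2_square: "X \<in> carrier_mat d d \<Longrightarrow> hs_norm2 X = (\<Sum>r<d. \<Sum>s<d. (cmod (X $$ (r, s)))\<^sup>2)"
  unfolding hs_norm2_def by auto

lemma composite_less: "x < p \<Longrightarrow> b < d \<Longrightarrow> y < q \<Longrightarrow> (x * d + b) * q + y < p * d * q" for x p b d y q :: nat
  by (intro mult_add_less)

lemma hs_norm2_blocks:
  assumes X: "X \<in> carrier_mat (p * d * q) (p * d * q)"
  shows "hs_norm2 X = (\<Sum>x<p. \<Sum>y<q. \<Sum>x'<p. \<Sum>y'<q. hs_norm2 (block d q X x y x' y'))"
proof -
  have "hs_norm2 X = (\<Sum>x<p. \<Sum>y<q. \<Sum>b<d. \<Sum>x'<p. \<Sum>y'<q. \<Sum>c<d.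
      (cmod (X $$ ((x * d + b) * q + y, (x' * d + c) * q + y')))\<^sup>2)"
    unfolding hs_norm2_square[OF X] sum_digits ..
  also have "\<dots> = (\<Sum>x<p. \<Sum>y<q. \<Sum>x'<p. \<Sum>y'<q. \<Sum>b<d. \<Sum>c<d.
      (cmod (X $$ ((x * d + b) * q + y, (x' * d + c) * q + y')))\<^sup>2)"
    by (rule sum.cong[OF refl], rule sum.cong[OF refl], subst sum.swap, rule sum.cong[OF refl], rule sum.swap)
  also have "\<dots> = (\<Sum>x<p. \<Sum>y<q. \<Sum>x'<p. \<Sum>y'<q. hs_norm2 (block d q X x y x' y'))"
    unfolding hs_norm2_square[OF block_carrier] by (intro sum.cong refl) (simp add: block_def)
  finally show ?thesis .
qed

lemma hs_norm2_loc:
  "hs_norm2 (loc (p * d * q) d q k X) = (\<Sum>x<p. \<Sum>y<q. \<Sum>x'<p. \<Sum>y'<q.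
     \<Sum>r<d. \<Sum>s<d. (cmod (\<Sum>b<d. \<Sum>c<d. k r s b c * block d q X x y x' y' $$ (b, c)))\<^sup>2)"
  unfolding hs_norm2_blocks[OF loc_carrier] hs_norm2_square[OF block_carrier]
  by (intro sum.cong refl) (auto simp: block_def loc_index composite_less digits_of_composite)

lemma mtrace_square: "X \<in> carrier_mat d d \<Longrightarrow> mtrace X = (\<Sum>r<d. X $$ (r, r))"
  unfolding mtrace_def by auto

definition trace_preserving_kernel :: "nat \<Rightarrow> kernel \<Rightarrow> bool" where
  "trace_preserving_kernel d k \<longleftrightarrow> (\<forall>b<d. \<forall>c<d. (\<Sum>r<d. k r r b c) = (if b = c then 1 else 0))"

lemma mtrace_loc:
  assumes k: "trace_preserving_kernel d k" and X: "X \<in> carrier_mat (p * d * q) (p * d * q)"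
  shows "mtrace (loc (p * d * q) d q k X) = mtrace X"
proof -
  have "(\<Sum>r<d. \<Sum>b<d. \<Sum>c<d. k r r b c * Y b c) = (\<Sum>b<d. Y b b)" for Y
  proof -
    have "(\<Sum>r<d. \<Sum>b<d. \<Sum>c<d. k r r b c * Y b c) = (\<Sum>b<d. \<Sum>c<d. \<Sum>r<d. k r r b c * Y b c)"
      by (subst sum.swap, rule sum.cong[OF refl], rule sum.swap)
    also have "\<dots> = (\<Sum>b<d. \<Sum>c<d. Y b c * (if b = c then 1 else 0))"
      using k unfolding trace_preserving_kernel_def by (intro sum.cong refl) (simp flip: sum_distrib_right)
    finally show ?thesis by simp
  qed
  note key = this
  show ?thesis
    unfolding mtrace_square[OF loc_carrier] mtrace_square[OF X] sum_digits
  proof (rule sum.cong[OF refl], rule sum.cong[OF refl])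
    fix x y assume xy: "x \<in> {..<p}" "y \<in> {..<q}"
    let ?i = "\<lambda>b. (x * d + b) * q + y"
    have "(\<Sum>r<d. loc (p * d * q) d q k X $$ (?i r, ?i r)) = (\<Sum>r<d. \<Sum>b<d. \<Sum>c<d. k r r b c * X $$ (?i b, ?i c))"
      using xy by (intro sum.cong refl) (simp add: loc_index composite_less digits_of_composite)
    also have "\<dots> = (\<Sum>b<d. X $$ (?i b, ?i b))" by (rule key)
    finally show "(\<Sum>r<d. loc (p * d * q) d q k X $$ (?i r, ?i r)) = (\<Sum>b<d. X $$ (?i b, ?i b))" .
  qed
qed

lemma channel_trace_preserving:
  assumes N: "qubit_channel N"
  shows "trace_preserving_kernel 2 (channel_kernel N)"
  unfolding trace_preserving_kernel_def
proof (intro allI impI)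
  fix b c :: nat assume bc: "b < 2" "c < 2"
  have "(\<Sum>r<2. channel_kernel N r r b c) = mtrace (N (mat_unit 2 b c))"
    by (simp add: channel_kernel_def mtrace_square[OF channel_carrier[OF N mat_unit_carrier]])
  also have "\<dots> = mtrace (mat_unit 2 b c)" using N unfolding qubit_channel_def by simp
  also have "\<dots> = (if b = c then 1 else 0)" using bc unfolding mtrace_square[OF mat_unit_carrier]
    by (auto simp: mat_unit_def sum_lessThan_2 less_2_cases)
  finally show "(\<Sum>r<2. channel_kernel N r r b c) = (if b = c then 1 else 0)" .
qed

lemma conj_trace_preserving:
  assumes U: "unitary_mat d U"
  shows "trace_preserving_kernel d (conj_kernel U)"
  unfolding trace_preserving_kernel_def
proof (intro allI impI)
  fix b c assume bc: "b < d" "c < d"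
  note u = unitaryD[OF U]
  have "(\<Sum>r<d. conj_kernel U r r b c) = (mat_adjoint U * U) $$ (c, b)"
    unfolding mult_index[OF u(2,1) bc(2,1)] using u(1) bc by (auto simp: conj_kernel_def mult.commute intro!: sum.cong)
  thus "(\<Sum>r<d. conj_kernel U r r b c) = (if b = c then 1 else 0)" using u bc by simp
qed

text \<open>The reset map turns a partial trace into a map that does not change the number of qubits:
  \<open>X \<mapsto> |0><0| \<otimes> tr X\<close>.\<close>

definition reset_kernel :: kernel where
  "reset_kernel r s b c = (if r = 0 \<and> s = 0 \<and> b = c then 1 else 0)"

lemma reset_trace_preserving: "0 < d \<Longrightarrow> trace_preserving_kernel d reset_kernel"
  unfolding trace_preserving_kernel_def reset_kernel_def by auto

text \<open>The traces of the blocks are the entries of the partial trace, so a reset state has the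
  purity of the reduced state.\<close>

lemma hs_norm2_reset:
  assumes d: "0 < d"
  shows "hs_norm2 (loc (p * d * q) d q reset_kernel X) =
    (\<Sum>x<p. \<Sum>y<q. \<Sum>x'<p. \<Sum>y'<q. (cmod (mtrace (block d q X x y x' y')))\<^sup>2)"
  unfolding hs_norm2_loc
proof (intro sum.cong refl)
  fix x y x' y'
  let ?B = "block d q X x y x' y'"
  have "(\<Sum>b<d. \<Sum>c<d. reset_kernel r s b c * ?B $$ (b, c)) = (if s = 0 then (if r = 0 then mtrace ?B else 0) else 0)" for r s
    unfolding mtrace_square[OF block_carrier]
    by (auto simp: reset_kernel_def if_distrib[of "\<lambda>z. z * _"] cong: if_cong)
  moreover have "(cmod (if s = 0 then (if r = 0 then z else 0) else 0))\<^sup>2 = (if s = 0 then (if r = 0 then (cmod z)\<^sup>2 else 0) else 0)"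
    for r s :: nat and z by simp
  ultimately show "(\<Sum>r<d. \<Sum>s<d. (cmod (\<Sum>b<d. \<Sum>c<d. reset_kernel r s b c * ?B $$ (b, c)))\<^sup>2) = (cmod (mtrace ?B))\<^sup>2"
    using d by simp
qed

text \<open>The reset map has the Kraus operators |0><a|. The vector \<open>g a\<close> is |a><0|
  applied to \<open>f\<close>, and the form of the image at \<open>f\<close> is the sum of the forms
  of X at the vectors \<open>g a\<close>.\<close>

lemma reset_pos_semidef:
  assumes X: "pos_semidef (p * d * q) X" and d: "0 < d"
  shows "pos_semidef (p * d * q) (loc (p * d * q) d q reset_kernel X)"
  unfolding pos_semidef_iff
proof (intro conjI allI loc_carrier)
  fix f :: "nat \<Rightarrow> complex"
  let ?D = "p * d * q" and ?i = "\<lambda>x b y. (x * d + b) * q + y"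
  define g where "g = (\<lambda>a r. if digit d q r = a then f (put_digit d q r 0) else 0)"
  have "(\<Sum>r<?D. \<Sum>s<?D. loc ?D d q reset_kernel X $$ (r, s) * f s * cnj (f r)) =
    (\<Sum>x<p. \<Sum>y<q. \<Sum>x'<p. \<Sum>y'<q. \<Sum>a<d. X $$ (?i x a y, ?i x' a y') * f (?i x' 0 y') * cnj (f (?i x 0 y)))"
  proof -
    have "(\<Sum>r<?D. \<Sum>s<?D. loc ?D d q reset_kernel X $$ (r, s) * f s * cnj (f r)) =
      (\<Sum>x<p. \<Sum>y<q. \<Sum>b<d. \<Sum>x'<p. \<Sum>y'<q. \<Sum>c<d.
        if c = 0 then (if b = 0 then (\<Sum>a<d. X $$ (?i x a y, ?i x' a y') * f (?i x' 0 y') * cnj (f (?i x 0 y))) else 0) else 0)"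
      unfolding sum_digits
    proof (intro sum.cong refl)
      fix x y b x' y' c assume l: "x \<in> {..<p}" "y \<in> {..<q}" "b \<in> {..<d}" "x' \<in> {..<p}" "y' \<in> {..<q}" "c \<in> {..<d}"
      have "loc ?D d q reset_kernel X $$ (?i x b y, ?i x' c y') =
        (if c = 0 then (if b = 0 then (\<Sum>a<d. X $$ (?i x a y, ?i x' a y')) else 0) else 0)"
        using l by (auto simp: loc_index composite_less digits_of_composite reset_kernel_def if_distrib[of "\<lambda>z. z * _"] cong: if_cong)
      thus "loc ?D d q reset_kernel X $$ (?i x b y, ?i x' c y') * f (?i x' c y') * cnj (f (?i x b y)) =
        (if c = 0 then (if b = 0 then (\<Sum>a<d. X $$ (?i x a y, ?i x' a y') * f (?i x' 0 y') * cnj (f (?i x 0 y))) else 0) else 0)"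
        by (simp add: sum_distrib_right)
    qed
    also have "\<dots> = (\<Sum>x<p. \<Sum>y<q. \<Sum>b<d. if b = 0 then (\<Sum>x'<p. \<Sum>y'<q.
        (\<Sum>a<d. X $$ (?i x a y, ?i x' a y') * f (?i x' 0 y') * cnj (f (?i x 0 y)))) else 0)"
      using d by (intro sum.cong refl) simp
    finally show ?thesis using d by simp
  qed
  also have "\<dots> = (\<Sum>a<d. \<Sum>x<p. \<Sum>y<q. \<Sum>x'<p. \<Sum>y'<q. X $$ (?i x a y, ?i x' a y') * f (?i x' 0 y') * cnj (f (?i x 0 y)))"
  proof -
    have s4: "(\<Sum>x<p. \<Sum>y<q. \<Sum>x'<p. \<Sum>y'<q. \<Sum>a<d. F x y x' y' a) = (\<Sum>a<d. \<Sum>x<p. \<Sum>y<q. \<Sum>x'<p. \<Sum>y'<q. F x y x' y' a)"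
      for F :: "nat \<Rightarrow> nat \<Rightarrow> nat \<Rightarrow> nat \<Rightarrow> nat \<Rightarrow> complex"
      by (simp only: sum.swap[of _ "{..<d}"])
    show ?thesis by (rule s4)
  qed
  also have "\<dots> = (\<Sum>a<d. \<Sum>r<?D. \<Sum>s<?D. X $$ (r, s) * g a s * cnj (g a r))"
  proof (rule sum.cong[OF refl])
    fix a assume a: "a \<in> {..<d}"
    have "(\<Sum>r<?D. \<Sum>s<?D. X $$ (r, s) * g a s * cnj (g a r)) =
      (\<Sum>x<p. \<Sum>y<q. \<Sum>b<d. \<Sum>x'<p. \<Sum>y'<q. \<Sum>c<d. if c = a then (if b = a then X $$ (?i x a y, ?i x' a y') * f (?i x' 0 y') * cnj (f (?i x 0 y)) else 0) else 0)"
      unfolding sum_digits by (intro sum.cong refl) (auto simp: g_def digits_of_composite)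
    also have "\<dots> = (\<Sum>x<p. \<Sum>y<q. \<Sum>b<d. if b = a then (\<Sum>x'<p. \<Sum>y'<q. X $$ (?i x a y, ?i x' a y') * f (?i x' 0 y') * cnj (f (?i x 0 y))) else 0)"
      using a by (intro sum.cong refl) simp
    finally show "(\<Sum>x<p. \<Sum>y<q. \<Sum>x'<p. \<Sum>y'<q. X $$ (?i x a y, ?i x' a y') * f (?i x' 0 y') * cnj (f (?i x 0 y))) =
      (\<Sum>r<?D. \<Sum>s<?D. X $$ (r, s) * g a s * cnj (g a r))" using a by simp
  qed
  finally show "0 \<le> (\<Sum>r<?D. \<Sum>s<?D. loc ?D d q reset_kernel X $$ (r, s) * f s * cnj (f r))"
    using pos_semidef_form[OF X] by (simp add: sum_nonneg)
qed

lemma conjugate_pos_semidef: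
  assumes X: "pos_semidef d X" and A: "A \<in> carrier_mat d d"
  shows "pos_semidef d (A * X * mat_adjoint A)"
  unfolding pos_semidef_iff
proof (intro conjI allI)
  have Xc: "X \<in> carrier_mat d d" using X by (rule pos_semidef_carrier)
  show "A * X * mat_adjoint A \<in> carrier_mat d d" using A Xc by simp
  fix f :: "nat \<Rightarrow> complex"
  define g where "g = (\<lambda>a. \<Sum>r<d. cnj (A $$ (r, a)) * f r)"
  have "(\<Sum>r<d. \<Sum>s<d. (A * X * mat_adjoint A) $$ (r, s) * f s * cnj (f r)) =
     (\<Sum>r<d. \<Sum>s<d. \<Sum>a<d. \<Sum>b<d. A $$ (r, a) * X $$ (a, b) * cnj (A $$ (s, b)) * f s * cnj (f r))"
    by (intro sum.cong refl) (simp add: conjugate_entry[OF A Xc] sum_distrib_right)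
  also have "\<dots> = (\<Sum>a<d. \<Sum>b<d. \<Sum>r<d. \<Sum>s<d. A $$ (r, a) * X $$ (a, b) * cnj (A $$ (s, b)) * f s * cnj (f r))"
    by (subst (2) sum.swap, subst sum.swap, subst (3) sum.swap, subst (2) sum.swap) (rule refl)
  also have "\<dots> = (\<Sum>a<d. \<Sum>b<d. X $$ (a, b) * g b * cnj (g a))"
  proof (intro sum.cong refl)
    fix a b
    have "X $$ (a, b) * g b * cnj (g a) = (\<Sum>r<d. \<Sum>s<d. X $$ (a, b) * (cnj (A $$ (s, b)) * f s) * (A $$ (r, a) * cnj (f r)))"
      unfolding g_def cnj_sum sum_distrib_left sum_distrib_right by simp
    thus "(\<Sum>r<d. \<Sum>s<d. A $$ (r, a) * X $$ (a, b) * cnj (A $$ (s, b)) * f s * cnj (f r)) = X $$ (a, b) * g b * cnj (g a)"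
      by (simp add: mult_ac)
  qed
  finally show "0 \<le> (\<Sum>r<d. \<Sum>s<d. (A * X * mat_adjoint A) $$ (r, s) * f s * cnj (f r))"
    using pos_semidef_form[OF X] by simp
qed

text \<open>Complete positivity is given for an ancilla in front of the qubit, whereas here the
  qubit stands in the middle. Moving the trailing factor of dimension q to the front is a
  permutation of the basis and preserves positivity.\<close>

lemma channel_loc_pos_semidef:
  assumes N: "qubit_channel N" and X: "pos_semidef (p * 2 * q) X"
  shows "pos_semidef (p * 2 * q) (loc (p * 2 * q) 2 q (channel_kernel N) X)"
proof -
  let ?D = "p * 2 * q" and ?E = "p * q * 2 * 1" and ?i = "\<lambda>x b y. (x * 2 + b) * q + y" and ?j = "\<lambda>x b y. ((x * q + y) * 2 + b) * 1 + 0"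
  have E: "?E = p * q * 2" by simp
  \<comment> \<open>\<open>\<pi>\<close> translates an index with the qubit in last place into the
    original order; \<open>\<sigma>\<close> translates back.\<close>
  define \<pi> where "\<pi> = (\<lambda>r. ?i (r div 2 div q) (r mod 2) (r div 2 mod q))"
  define \<sigma> where "\<sigma> = (\<lambda>r. ?j (r div (2 * q)) (digit 2 q r) (r mod q))"
  have \<pi>: "\<pi> (?j x b y) = ?i x b y" if "b < 2" "y < q" for x b y
  proof -
    have "(k * 2 + b) div 2 = k" "(k * 2 + b) mod 2 = b" for k using that by auto
    moreover have "(x * q + y) div q = x" "(x * q + y) mod q = y" using that by auto
    ultimately show ?thesis by (simp only: \<pi>_def mult_1_right add_0_right)
  qed
  have \<sigma>: "\<sigma> (?i x b y) = ?j x b y" if "b < 2" "y < q" for x b y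
    unfolding \<sigma>_def using digits_of_composite[OF that, of x] by simp
  have sumE: "(\<Sum>r<?E. F r) = (\<Sum>x<p. \<Sum>y<q. \<Sum>b<2. F (?j x b y))" for F :: "nat \<Rightarrow> complex"
    unfolding sum_digits[of F "p * q" 2 1] by (simp add: sum_div_mod[of _ p q])
  define X' where "X' = mat ?E ?E (\<lambda>(r, s). X $$ (\<pi> r, \<pi> s))"
  have jE: "?j x b y < ?E" if "x < p" "b < 2" "y < q" for x b y
    using that mult_add_less[OF mult_add_less[of x p y q], of b 2] by simp
  have X'e: "X' $$ (?j x b y, ?j x' c y') = X $$ (?i x b y, ?i x' c y')"
    if "x < p" "b < 2" "y < q" "x' < p" "c < 2" "y' < q" for x b y x' c y'
    unfolding X'_def by (subst index_mat(1)[OF jE[OF that(1-3)] jE[OF that(4-6)]]) (simp only: prod.case \<pi> that)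
  have "pos_semidef ?E X'"
    unfolding pos_semidef_iff
  proof (intro conjI allI)
    show "X' \<in> carrier_mat ?E ?E" by (simp add: X'_def)
    fix f :: "nat \<Rightarrow> complex"
    have "(\<Sum>r<?E. \<Sum>s<?E. X' $$ (r, s) * f s * cnj (f r)) = (\<Sum>r<?D. \<Sum>s<?D. X $$ (r, s) * f (\<sigma> s) * cnj (f (\<sigma> r)))"
      unfolding sumE sum_digits[of _ p 2 q] by (intro sum.cong refl) (simp only: lessThan_iff X'e \<sigma>)
    thus "0 \<le> (\<Sum>r<?E. \<Sum>s<?E. X' $$ (r, s) * f s * cnj (f r))" using pos_semidef_form[OF X] by simp
  qed
  hence "pos_semidef (p * q * 2) (apply_local (p * q) N 1 X')" using N unfolding qubit_channel_def by simp
  moreover have "apply_local (p * q) N 1 X' = loc ?E 2 1 (channel_kernel N) X'"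
    by (rule apply_local_eq_loc[OF N]) (simp_all add: X'_def)
  ultimately have P: "pos_semidef ?E (loc ?E 2 1 (channel_kernel N) X')" by simp
  show ?thesis
    unfolding pos_semidef_iff
  proof (intro conjI allI loc_carrier)
    fix f :: "nat \<Rightarrow> complex"
    have e: "loc ?D 2 q (channel_kernel N) X $$ (?i x b y, ?i x' c y') = loc ?E 2 1 (channel_kernel N) X' $$ (?j x b y, ?j x' c y')"
      if "x < p" "b < 2" "y < q" "x' < p" "c < 2" "y' < q" for x b y x' c y'
    proof -
      have "loc ?E 2 1 (channel_kernel N) X' $$ (?j x b y, ?j x' c y') =
        (\<Sum>b'<2. \<Sum>c'<2. channel_kernel N b c b' c' * X' $$ (?j x b' y, ?j x' c' y'))"
        using digits_of_composite[of b 2 0 1 "x * q + y"] digits_of_composite[of c 2 0 1 "x' * q + y'"] jE that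
        by (subst loc_index) auto
      also have "\<dots> = (\<Sum>b'<2. \<Sum>c'<2. channel_kernel N b c b' c' * X $$ (?i x b' y, ?i x' c' y'))"
        using that by (intro sum.cong refl) (simp only: lessThan_iff X'e)
      also have "\<dots> = loc ?D 2 q (channel_kernel N) X $$ (?i x b y, ?i x' c y')"
        using that by (simp add: loc_index composite_less digits_of_composite)
      finally show ?thesis by simp
    qed
    have "(\<Sum>r<?D. \<Sum>s<?D. loc ?D 2 q (channel_kernel N) X $$ (r, s) * f s * cnj (f r)) =
       (\<Sum>r<?E. \<Sum>s<?E. loc ?E 2 1 (channel_kernel N) X' $$ (r, s) * f (\<pi> s) * cnj (f (\<pi> r)))"
      unfolding sumE sum_digits[of _ p 2 q] by (intro sum.cong refl) (simp only: lessThan_iff e \<pi>)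
    thus "0 \<le> (\<Sum>r<?D. \<Sum>s<?D. loc ?D 2 q (channel_kernel N) X $$ (r, s) * f s * cnj (f r))"
      using pos_semidef_form[OF P] by simp
  qed
qed

section \<open>Layers of the brickwall circuit\<close>

definition gate_map :: "nat \<Rightarrow> nat \<Rightarrow> complex mat \<Rightarrow> complex mat \<Rightarrow> complex mat" where
  "gate_map n i G = loc (2 ^ n) 4 (2 ^ (n - i - 1)) (conj_kernel G)"

definition noise_map :: "nat \<Rightarrow> (complex mat \<Rightarrow> complex mat) \<Rightarrow> nat \<Rightarrow> complex mat \<Rightarrow> complex mat" where
  "noise_map n N i = loc (2 ^ n) 2 (2 ^ (n - i)) (channel_kernel N)"

definition reset_map :: "nat \<Rightarrow> nat \<Rightarrow> complex mat \<Rightarrow> complex mat" where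
  "reset_map n i = loc (2 ^ n) 4 (2 ^ (n - i - 1)) reset_kernel"

definition noisy_gate :: "nat \<Rightarrow> (complex mat \<Rightarrow> complex mat) \<Rightarrow> nat \<Rightarrow> complex mat \<Rightarrow> complex mat \<Rightarrow> complex mat" where
  "noisy_gate n N i G X = noise_map n N i (noise_map n N (i + 1) (gate_map n i G X))"

lemma two_power_pair: "1 \<le> i \<Longrightarrow> i < n \<Longrightarrow> (2::nat) ^ n = 2 ^ (i - 1) * 4 * 2 ^ (n - i - 1)"
proof -
  assume i: "1 \<le> i" "i < n"
  have "2 ^ (i - 1) * 4 * 2 ^ (n - i - 1) = (2 ^ (i - 1 + 2 + (n - i - 1)) :: nat)" by (simp add: power_add)
  also have "i - 1 + 2 + (n - i - 1) = n" using i by simp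
  finally show ?thesis by simp
qed

lemma two_power_single: "1 \<le> i \<Longrightarrow> i \<le> n \<Longrightarrow> (2::nat) ^ n = 2 ^ (i - 1) * 2 * 2 ^ (n - i)"
proof -
  assume i: "1 \<le> i" "i \<le> n"
  have "2 ^ (i - 1) * 2 * 2 ^ (n - i) = (2 ^ (i - 1 + 1 + (n - i)) :: nat)" by (simp add: power_add)
  also have "i - 1 + 1 + (n - i) = n" using i by simp
  finally show ?thesis by simp
qed

lemma pair_dvd: "1 \<le> i \<Longrightarrow> i < n \<Longrightarrow> 4 * 2 ^ (n - i - 1) dvd (2 ^ n :: nat)"
  using two_power_pair[of i n] by (metis dvd_triv_right mult.assoc)

lemma single_dvd: "1 \<le> i \<Longrightarrow> i \<le> n \<Longrightarrow> 2 * 2 ^ (n - i) dvd (2 ^ n :: nat)"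
  using two_power_single[of i n] by (metis dvd_triv_right mult.assoc)

lemma four_power_dvd: "i + 2 \<le> j \<Longrightarrow> j < n \<Longrightarrow> 4 * 2 ^ (n - j - 1) dvd (2 ^ (n - i - 1) :: nat)"
proof -
  assume "i + 2 \<le> j" "j < n"
  have "4 * 2 ^ (n - j - 1) = (2 ^ (2 + (n - j - 1)) :: nat)" by (simp add: power_add)
  thus ?thesis using \<open>i + 2 \<le> j\<close> \<open>j < n\<close> by (simp only:) (rule le_imp_power_dvd, simp)
qed

lemma two_power_dvd: "i < j \<Longrightarrow> j \<le> n \<Longrightarrow> 2 * 2 ^ (n - j) dvd (2 ^ (n - i) :: nat)"
proof -
  assume "i < j" "j \<le> n"
  have "2 * 2 ^ (n - j) = (2 ^ (1 + (n - j)) :: nat)" by simp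
  thus ?thesis using \<open>i < j\<close> \<open>j \<le> n\<close> by (simp only:) (rule le_imp_power_dvd, simp)
qed

lemma noise_commute:
  assumes "1 \<le> i" "i \<le> n" "1 \<le> j" "j \<le> n"
  shows "noise_map n N i (noise_map n N j X) = noise_map n N j (noise_map n N i X)"
proof (cases i j rule: linorder_cases)
  case less
  thus ?thesis unfolding noise_map_def using assms by (intro loc_commute single_dvd two_power_dvd) auto
next
  case greater
  thus ?thesis unfolding noise_map_def using assms by (intro loc_commute[symmetric] single_dvd two_power_dvd) auto
qed simp

lemma noise_gate_commute:
  assumes "1 \<le> i" "i + 2 \<le> j" "j \<le> n"
  shows "noise_map n N j (gate_map n i G X) = gate_map n i G (noise_map n N j X)"
  unfolding noise_map_def gate_map_def
  using assms two_power_dvd[of "i + 1" j n] by (intro loc_commute[symmetric] pair_dvd) auto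

lemma noisy_gate_eq:
  assumes "1 \<le> i" "i < n"
  shows "noisy_gate n N i G X = loc (2 ^ n) 4 (2 ^ (n - i - 1)) (pair_kernel (channel_kernel N)) (gate_map n i G X)"
proof -
  have "2 ^ (n - i) = (2 * 2 ^ (n - i - 1) :: nat)"
    using assms by (metis Suc_diff_Suc diff_Suc_1 diff_diff_left plus_1_eq_Suc power_Suc add.commute)
  moreover have "n - (i + 1) = n - i - 1" by simp
  ultimately show ?thesis
    unfolding noisy_gate_def noise_map_def using loc_pair[OF pair_dvd[OF assms]] by simp
qed

lemma reset_noisy_gate_commute:
  assumes i: "1 \<le> i" and j: "i + 2 \<le> j" "j < n"
  shows "reset_map n i (noisy_gate n N j G X) = noisy_gate n N j G (reset_map n i X)"
proof -
  have c: "reset_map n i (loc (2 ^ n) 4 (2 ^ (n - j - 1)) k X) = loc (2 ^ n) 4 (2 ^ (n - j - 1)) k (reset_map n i X)" for k X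
    unfolding reset_map_def using i j by (intro loc_commute pair_dvd four_power_dvd) auto
  have "1 \<le> j" using i j by simp
  show ?thesis unfolding noisy_gate_eq[OF \<open>1 \<le> j\<close> j(2)] gate_map_def by (simp only: c)
qed

text \<open>Gates in increasing order with disjoint supports. Of two gates the later one in the list
  acts on the less significant digits, which is the direction of the divisibility condition for
  commuting local maps.\<close>

definition spaced :: "nat \<Rightarrow> nat list \<Rightarrow> bool" where
  "spaced n ps \<longleftrightarrow> sorted_wrt (\<lambda>i j. i + 2 \<le> j) ps \<and> (\<forall>i\<in>set ps. 1 \<le> i \<and> i < n)"

lemma spaced_Cons: "spaced n (i # ps) \<Longrightarrow> spaced n ps" "spaced n (i # ps) \<Longrightarrow> 1 \<le> i \<and> i < n"
    "spaced n (i # ps) \<Longrightarrow> j \<in> set ps \<Longrightarrow> i + 2 \<le> j"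
  by (auto simp: spaced_def)

lemma spaced_gate_positions: "spaced n (gate_positions n l)"
proof -
  have "sorted_wrt (<) (gate_positions n l)"
    unfolding gate_positions_def by (intro sorted_wrt_filter sorted_wrt_upt)
  hence "sorted_wrt (\<lambda>i j. i + 2 \<le> j) (gate_positions n l)"
  proof (rule sorted_wrt_mono_rel[rotated])
    fix i j assume "i \<in> set (gate_positions n l)" "j \<in> set (gate_positions n l)" "i < j"
    hence "odd i \<longleftrightarrow> odd j" "i < j" by (auto simp: gate_positions_def)
    thus "i + 2 \<le> j" by presburger
  qed
  thus ?thesis by (auto simp: spaced_def gate_positions_def)
qed

definition covered :: "nat list \<Rightarrow> nat list" where
  "covered ps = concat (map (\<lambda>i. [i, i + 1]) ps)"

lemma covered_Cons: "covered (i # ps) = i # (i + 1) # covered ps"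
  by (simp add: covered_def)

lemma set_covered: "set (covered ps) = (\<Union>i\<in>set ps. {i, i + 1})"
  by (auto simp: covered_def)

lemma length_covered: "length (covered ps) = 2 * length ps"
  by (induction ps) (simp_all add: covered_Cons, simp add: covered_def)

lemma distinct_covered: "spaced n ps \<Longrightarrow> distinct (covered ps)"
proof (induction ps)
  case (Cons i ps)
  have "i + 2 \<le> k" if "k \<in> set (covered ps)" for k
    using that spaced_Cons(3)[OF Cons.prems] by (auto simp: set_covered) fastforce+
  thus ?case using Cons.IH[OF spaced_Cons(1)[OF Cons.prems]] by (fastforce simp: covered_Cons)
qed (simp add: covered_def)

definition uncovered :: "nat \<Rightarrow> nat list \<Rightarrow> nat list" where
  "uncovered n ps = filter (\<lambda>j. j \<notin> set (covered ps)) [1..<n + 1]"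

text \<open>For an interior qubit j one of j - 1 and j has the parity of the layer and carries a
  gate.\<close>

lemma uncovered_gate_positions: "set (uncovered n (gate_positions n l)) \<subseteq> {1, n}"
proof
  fix j assume j: "j \<in> set (uncovered n (gate_positions n l))"
  show "j \<in> {1, n}"
  proof (rule ccontr)
    assume "j \<notin> {1, n}"
    hence j2: "2 \<le> j" "j < n" using j by (auto simp: uncovered_def)
    have "j \<in> set (gate_positions n l) \<or> j - 1 \<in> set (gate_positions n l)"
      using j2 by (auto simp: gate_positions_def)
    hence "j \<in> set (covered (gate_positions n l))"
    proof
      assume "j - 1 \<in> set (gate_positions n l)"
      moreover have "j \<in> {j - 1, j - 1 + 1}" using j2 by simp
      ultimately show ?thesis unfolding set_covered by (rule UN_I)
    qed (auto simp: set_covered)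
    thus False using j by (simp add: uncovered_def)
  qed
qed

lemma length_uncovered_le: "length (uncovered n (gate_positions n l)) \<le> 2"
proof -
  have "distinct (uncovered n (gate_positions n l))" by (simp add: uncovered_def)
  hence "length (uncovered n (gate_positions n l)) = card (set (uncovered n (gate_positions n l)))"
    by (simp add: distinct_card)
  also have "\<dots> \<le> card {1, n}" by (intro card_mono uncovered_gate_positions) simp
  also have "\<dots> \<le> 2" by (simp add: card_insert_if)
  finally show ?thesis .
qed

lemma mset_qubits:
  assumes "spaced n ps"
  shows "mset [1..<n + 1] = mset (uncovered n ps @ covered ps)"
proof -
  have "distinct (uncovered n ps @ covered ps)"
    using distinct_covered[OF assms] by (auto simp: uncovered_def)
  moreover have "set (covered ps) \<subseteq> {1..n}" using assms by (fastforce simp: set_covered spaced_def)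
  hence "set [1..<n + 1] = set (uncovered n ps @ covered ps)" by (fastforce simp: uncovered_def)
  ultimately show ?thesis by (subst (asm) set_eq_iff_mset_eq_distinct) auto
qed

text \<open>Converts decay in the number of gates of a layer into decay in n.\<close>

lemma gate_count: "n \<le> 2 * length (gate_positions n l) + 2"
proof -
  have "size (mset [1..<n + 1]) = size (mset (uncovered n (gate_positions n l) @ covered (gate_positions n l)))"
    by (rule arg_cong[OF mset_qubits[OF spaced_gate_positions]])
  hence "n = length (uncovered n (gate_positions n l)) + 2 * length (gate_positions n l)"
    by (simp add: length_covered del: mset_upt upt_Suc)
  thus ?thesis using length_uncovered_le[of n l] by linarith
qed

lemma foldr_covered:
  "foldr (noise_map n N) (covered ps) X = foldr (\<lambda>i Y. noise_map n N i (noise_map n N (i + 1) Y)) ps X"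
  by (induction ps) (simp_all add: covered_Cons, simp add: covered_def)

text \<open>The noise on the qubits of later gates is pulled through the first gate, which acts
  elsewhere. Every gate is then directly followed by the noise on its own two qubits.\<close>

lemma noise_gates_foldr:
  assumes "spaced n ps"
  shows "foldr (noise_map n N) (covered ps) (foldr (\<lambda>i. gate_map n i (G i)) ps X) =
    foldr (\<lambda>i. noisy_gate n N i (G i)) ps X"
  using assms
proof (induction ps)
  case Nil
  thus ?case by (simp add: covered_def)
next
  case (Cons i ps)
  note sp = spaced_Cons[OF Cons.prems]
  have comm: "foldr (\<lambda>i Y. noise_map n N i (noise_map n N (i + 1) Y)) qs (gate_map n i (G i) Z) =
      gate_map n i (G i) (foldr (\<lambda>i Y. noise_map n N i (noise_map n N (i + 1) Y)) qs Z)" if "set qs \<subseteq> set ps" for qs Z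
    using that
  proof (induction qs)
    case (Cons j qs)
    have j: "i + 2 \<le> j" "j < n" using Cons.prems sp(3) \<open>spaced n (i # ps)\<close> by (auto simp: spaced_def)
    thus ?case using Cons noise_gate_commute[of i j n N] noise_gate_commute[of i "j + 1" n N] sp(2) by simp
  qed simp
  show ?case using Cons.IH[OF sp(1)] comm[of ps] by (simp add: covered_Cons foldr_covered noisy_gate_def)
qed

lemma noise_layer_eq:
  assumes N: "qubit_channel N" and X: "X \<in> carrier_mat (2 ^ n) (2 ^ n)"
  shows "noise_layer n N X = fold (noise_map n N) [1..<n + 1] X"
proof -
  have "fold (\<lambda>i. apply_local (2 ^ (i - 1)) N (2 ^ (n - i))) xs Y = fold (noise_map n N) xs Y"
    if "set xs \<subseteq> {1..n}" "Y \<in> carrier_mat (2 ^ n) (2 ^ n)" for xs Y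
    using that
  proof (induction xs arbitrary: Y)
    case (Cons i xs)
    have "apply_local (2 ^ (i - 1)) N (2 ^ (n - i)) Y = noise_map n N i Y"
      unfolding noise_map_def using Cons.prems by (intro apply_local_eq_loc[OF N two_power_single]) auto
    thus ?case using Cons by (simp add: noise_map_def)
  qed simp
  from this[of "[1..<n + 1]" X] show ?thesis unfolding noise_layer_def using X by (fastforce simp del: upt_Suc)
qed

text \<open>Single-qubit noise maps commute, so only the multiset of qubits matters. The noise on
  qubits without a gate is placed outermost, where it can be estimated after the averaging.\<close>

lemma noise_layer_reorder:
  assumes N: "qubit_channel N" and X: "X \<in> carrier_mat (2 ^ n) (2 ^ n)" and ps: "spaced n ps"
  shows "noise_layer n N X = foldr (noise_map n N) (uncovered n ps) (foldr (noise_map n N) (covered ps) X)"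
proof -
  have "fold (noise_map n N) [1..<n + 1] = fold (noise_map n N) (rev (uncovered n ps @ covered ps))"
  proof (rule fold_multiset_equiv)
    fix i j assume "i \<in> set [1..<n + 1]" "j \<in> set [1..<n + 1]"
    thus "noise_map n N i \<circ> noise_map n N j = noise_map n N j \<circ> noise_map n N i"
      using noise_commute[of i n j N] by (auto simp: fun_eq_iff)
  qed (simp only: mset_rev mset_qubits[OF ps])
  thus ?thesis unfolding noise_layer_eq[OF N X] by (simp add: foldr_conv_fold)
qed

lemma layer_unitary_conj:
  assumes G: "\<And>i. i \<in> set (gate_positions n l) \<Longrightarrow> g (l, i) \<in> carrier_mat 4 4"
    and X: "X \<in> carrier_mat (2 ^ n) (2 ^ n)"
  shows "layer_unitary n g l * X * mat_adjoint (layer_unitary n g l) =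
    foldr (\<lambda>i. gate_map n i (g (l, i))) (gate_positions n l) X"
proof -
  let ?D = "2 ^ n :: nat"
  have "foldr (\<lambda>i A. embed_gate n i (g (l, i)) * A) ps (1\<^sub>m ?D) \<in> carrier_mat ?D ?D \<and>
     foldr (\<lambda>i A. embed_gate n i (g (l, i)) * A) ps (1\<^sub>m ?D) * X * mat_adjoint (foldr (\<lambda>i A. embed_gate n i (g (l, i)) * A) ps (1\<^sub>m ?D)) =
       foldr (\<lambda>i. gate_map n i (g (l, i))) ps X"
    if "set ps \<subseteq> set (gate_positions n l)" for ps
    using that
  proof (induction ps)
    case Nil
    have "mat_adjoint (1\<^sub>m ?D) = (1\<^sub>m ?D :: complex mat)" by (rule eq_matI) auto
    thus ?case using X by (simp add: left_mult_one_mat[of _ ?D ?D] right_mult_one_mat[of _ ?D ?D])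
  next
    case (Cons i ps)
    define A where "A = foldr (\<lambda>i A. embed_gate n i (g (l, i)) * A) ps (1\<^sub>m ?D)"
    define E where "E = embed_gate n i (g (l, i))"
    have i: "1 \<le> i" "i < n" "g (l, i) \<in> carrier_mat 4 4" using Cons.prems G by (auto simp: gate_positions_def)
    have E: "E \<in> carrier_mat ?D ?D" unfolding E_def by (rule embed_gate_carrier[OF i(3,1,2)])
    have A: "A \<in> carrier_mat ?D ?D" and IH: "A * X * mat_adjoint A = foldr (\<lambda>i. gate_map n i (g (l, i))) ps X"
      using Cons.IH Cons.prems by (auto simp: A_def)
    have "E * A * X * mat_adjoint (E * A) = E * (A * X * mat_adjoint A) * mat_adjoint E"
      using E A X by (simp add: mat_adjoint_mult[of _ ?D ?D _ ?D] assoc_mult_mat[of _ ?D ?D _ ?D _ ?D])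
    also have "\<dots> = gate_map n i (g (l, i)) (A * X * mat_adjoint A)"
      unfolding E_def gate_map_def using A X by (intro conjugate_embed_gate[OF i(3,1,2)]) simp
    finally show ?case using E A IH by (simp flip: A_def E_def)
  qed
  thus ?thesis unfolding layer_unitary_def by blast
qed

lemma noise_map_carrier [simp]: "noise_map n N i X \<in> carrier_mat (2 ^ n) (2 ^ n)"
  by (simp add: noise_map_def)

lemma gate_map_carrier [simp]: "gate_map n i G X \<in> carrier_mat (2 ^ n) (2 ^ n)"
  by (simp add: gate_map_def)

lemma foldr_gate_carrier: "X \<in> carrier_mat (2 ^ n) (2 ^ n) \<Longrightarrow> foldr (\<lambda>i. gate_map n i (G i)) ps X \<in> carrier_mat (2 ^ n) (2 ^ n)"
  by (cases ps) auto

lemma circuit_state_Suc: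
  assumes N: "qubit_channel N"
    and G: "\<And>i. i \<in> set (gate_positions n (Suc l)) \<Longrightarrow> g (Suc l, i) \<in> carrier_mat 4 4"
    and X: "circuit_state n N g \<rho>0 l \<in> carrier_mat (2 ^ n) (2 ^ n)"
  shows "circuit_state n N g \<rho>0 (Suc l) =
    foldr (noise_map n N) (uncovered n (gate_positions n (Suc l)))
      (foldr (\<lambda>i. noisy_gate n N i (g (Suc l, i))) (gate_positions n (Suc l)) (circuit_state n N g \<rho>0 l))"
proof -
  let ?ps = "gate_positions n (Suc l)"
  have "circuit_state n N g \<rho>0 (Suc l) = noise_layer n N (foldr (\<lambda>i. gate_map n i (g (Suc l, i))) ?ps (circuit_state n N g \<rho>0 l))"
    by (simp add: layer_unitary_conj[where g = g, OF G X])
  also have "\<dots> = foldr (noise_map n N) (uncovered n ?ps) (foldr (noise_map n N) (covered ?ps)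
      (foldr (\<lambda>i. gate_map n i (g (Suc l, i))) ?ps (circuit_state n N g \<rho>0 l)))"
    by (rule noise_layer_reorder[OF N foldr_gate_carrier[OF X] spaced_gate_positions])
  finally show ?thesis unfolding noise_gates_foldr[OF spaced_gate_positions] .
qed

subsection \<open>States stay density operators\<close>

lemma noise_map_density:
  assumes N: "qubit_channel N" and i: "1 \<le> i" "i \<le> n" and X: "density_operator (2 ^ n) X"
  shows "density_operator (2 ^ n) (noise_map n N i X)"
proof -
  have X': "pos_semidef (2 ^ (i - 1) * 2 * 2 ^ (n - i)) X" "mtrace X = 1"
    using X unfolding density_operator_def two_power_single[OF i] by auto
  show ?thesis
    unfolding density_operator_def noise_map_def two_power_single[OF i]
    using channel_loc_pos_semidef[OF N X'(1)] mtrace_loc[OF channel_trace_preserving[OF N] pos_semidef_carrier[OF X'(1)]] X'(2) by simp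
qed

lemma gate_map_density:
  assumes i: "1 \<le> i" "i < n" and U: "unitary_mat 4 U" and X: "density_operator (2 ^ n) X"
  shows "density_operator (2 ^ n) (gate_map n i U X)"
proof -
  have P: "pos_semidef (2 ^ n) X" and t: "mtrace X = 1" using X by (auto simp: density_operator_def)
  have Xc: "X \<in> carrier_mat (2 ^ n) (2 ^ n)" using P by (rule pos_semidef_carrier)
  have "gate_map n i U X = embed_gate n i U * X * mat_adjoint (embed_gate n i U)"
    unfolding gate_map_def by (rule conjugate_embed_gate[OF unitaryD(1)[OF U] i Xc, symmetric])
  hence "pos_semidef (2 ^ n) (gate_map n i U X)"
    using conjugate_pos_semidef[OF P embed_gate_carrier[OF unitaryD(1)[OF U] i]] by simp
  moreover have "mtrace (gate_map n i U X) = 1"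
    using mtrace_loc[OF conj_trace_preserving[OF U] Xc[unfolded two_power_pair[OF i]]] t
    unfolding gate_map_def two_power_pair[OF i] by simp
  ultimately show ?thesis by (simp add: density_operator_def)
qed

lemma reset_map_density:
  assumes i: "1 \<le> i" "i < n" and X: "density_operator (2 ^ n) X"
  shows "density_operator (2 ^ n) (reset_map n i X)"
proof -
  have X': "pos_semidef (2 ^ (i - 1) * 4 * 2 ^ (n - i - 1)) X" "mtrace X = 1"
    using X unfolding density_operator_def two_power_pair[OF i] by auto
  show ?thesis
    unfolding density_operator_def reset_map_def two_power_pair[OF i]
    using reset_pos_semidef[OF X'(1)] mtrace_loc[OF reset_trace_preserving pos_semidef_carrier[OF X'(1)]] X'(2) by simp
qed

lemma density_carrier: "density_operator d X \<Longrightarrow> X \<in> carrier_mat d d"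
  unfolding density_operator_def by (blast intro: pos_semidef_carrier)

lemma circuit_state_density:
  assumes N: "qubit_channel N" and \<rho>: "density_operator (2 ^ n) \<rho>0"
    and g: "\<And>m i. 1 \<le> m \<Longrightarrow> m \<le> l \<Longrightarrow> i \<in> set (gate_positions n m) \<Longrightarrow> unitary_mat 4 (g (m, i))"
  shows "density_operator (2 ^ n) (circuit_state n N g \<rho>0 l)"
  using g
proof (induction l)
  case 0
  thus ?case using \<rho> by simp
next
  case (Suc l)
  let ?X = "circuit_state n N g \<rho>0 l" and ?ps = "gate_positions n (Suc l)"
  have X: "density_operator (2 ^ n) ?X" using Suc by simp
  have noise: "density_operator (2 ^ n) (foldr (noise_map n N) qs Y)"
    if "set qs \<subseteq> {1..n}" "density_operator (2 ^ n) Y" for qs Y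
    using that by (induction qs) (auto intro: noise_map_density[OF N])
  have gates: "density_operator (2 ^ n) (foldr (\<lambda>i. noisy_gate n N i (g (Suc l, i))) qs ?X)" if "set qs \<subseteq> set ?ps" for qs
    using that
  proof (induction qs)
    case (Cons i qs)
    have "1 \<le> i" "i < n" "unitary_mat 4 (g (Suc l, i))"
      using Cons.prems Suc.prems[of "Suc l" i] by (auto simp: gate_positions_def)
    thus ?case using Cons
      by (auto simp: noisy_gate_def intro!: noise_map_density[OF N] gate_map_density)
  qed (use X in simp)
  have U: "g (Suc l, i) \<in> carrier_mat 4 4" if "i \<in> set ?ps" for i
    using Suc.prems[of "Suc l" i] that unitaryD(1) by auto
  have "circuit_state n N g \<rho>0 (Suc l) = foldr (noise_map n N) (uncovered n ?ps)
      (foldr (\<lambda>i. noisy_gate n N i (g (Suc l, i))) ?ps ?X)"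
    using N U density_carrier[OF X] by (rule circuit_state_Suc)
  moreover have "density_operator (2 ^ n) \<dots>"
    by (intro noise gates) (auto simp: uncovered_def)
  ultimately show ?case by (simp only:)
qed

section \<open>Product states are density operators\<close>

lemma kron_carrier: "A \<in> carrier_mat m m \<Longrightarrow> B \<in> carrier_mat n n \<Longrightarrow> kron A B \<in> carrier_mat (m * n) (m * n)"
  by (auto simp: kron_def)

lemma kron_index:
  "A \<in> carrier_mat m m \<Longrightarrow> B \<in> carrier_mat n n \<Longrightarrow> i < m \<Longrightarrow> k < n \<Longrightarrow> j < m \<Longrightarrow> l < n \<Longrightarrow>
     kron A B $$ (i * n + k, j * n + l) = A $$ (i, j) * B $$ (k, l)"
  by (auto simp: kron_def mult_add_less)

text \<open>The spectral decomposition of A writes the form of A \<otimes> B at f as a sum over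
  \<alpha> of the eigenvalue \<open>\<mu> \<alpha>\<close> times the form of B at
  \<open>h \<alpha>\<close>, the partial inner product of f with the eigenvector.\<close>

lemma kron_pos_semidef:
  assumes A: "pos_semidef m A" and B: "pos_semidef n B"
  shows "pos_semidef (m * n) (kron A B)"
proof -
  have Ac: "A \<in> carrier_mat m m" and Bc: "B \<in> carrier_mat n n" using A B by (auto intro: pos_semidef_carrier)
  have "hermitian_on m (\<lambda>u v. A $$ (u, v))"
    by (rule hermitian_onI, rule pos_semidef_hermitian[OF A, symmetric])
  from hermitian_spectral[OF this] obtain r q \<mu> where q: "orthonormal_on m r q"
    and "\<And>\<alpha>. \<alpha> < r \<Longrightarrow> \<mu> \<alpha> \<noteq> (0::real)"
    and ev: "\<And>\<alpha> u. \<alpha> < r \<Longrightarrow> u < m \<Longrightarrow> (\<Sum>w<m. A $$ (u, w) * q \<alpha> w) = complex_of_real (\<mu> \<alpha>) * q \<alpha> u"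
    and dec: "\<And>u w. u < m \<Longrightarrow> w < m \<Longrightarrow> A $$ (u, w) = (\<Sum>\<alpha><r. complex_of_real (\<mu> \<alpha>) * q \<alpha> u * cnj (q \<alpha> w))"
    by blast
  have \<mu>: "0 \<le> complex_of_real (\<mu> \<alpha>)" if a: "\<alpha> < r" for \<alpha>
  proof -
    have "(\<Sum>i<m. \<Sum>j<m. A $$ (i, j) * q \<alpha> j * cnj (q \<alpha> i)) = (\<Sum>i<m. complex_of_real (\<mu> \<alpha>) * (cnj (q \<alpha> i) * q \<alpha> i))"
    proof (rule sum.cong[OF refl])
      fix i assume "i \<in> {..<m}"
      hence "(\<Sum>j<m. A $$ (i, j) * q \<alpha> j) * cnj (q \<alpha> i) = complex_of_real (\<mu> \<alpha>) * (cnj (q \<alpha> i) * q \<alpha> i)"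
        using ev[OF a] by simp
      thus "(\<Sum>j<m. A $$ (i, j) * q \<alpha> j * cnj (q \<alpha> i)) = complex_of_real (\<mu> \<alpha>) * (cnj (q \<alpha> i) * q \<alpha> i)"
        by (simp only: sum_distrib_right)
    qed
    also have "\<dots> = complex_of_real (\<mu> \<alpha>)" using q a unfolding orthonormal_on_def by (simp flip: sum_distrib_left)
    finally show ?thesis using pos_semidef_form[OF A, of "q \<alpha>"] by simp
  qed
  show ?thesis
    unfolding pos_semidef_iff
  proof (intro conjI allI kron_carrier Ac Bc)
    fix f :: "nat \<Rightarrow> complex"
    define h where "h = (\<lambda>\<alpha> k. \<Sum>i<m. cnj (q \<alpha> i) * f (i * n + k))"
    have "(\<Sum>r<m * n. \<Sum>s<m * n. kron A B $$ (r, s) * f s * cnj (f r)) =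
      (\<Sum>i<m. \<Sum>k<n. \<Sum>j<m. \<Sum>l<n. \<Sum>\<alpha><r. complex_of_real (\<mu> \<alpha>) * (B $$ (k, l) * (cnj (q \<alpha> j) * f (j * n + l)) * cnj (cnj (q \<alpha> i) * f (i * n + k))))"
      unfolding sum_div_mod
    proof (intro sum.cong refl)
      fix i k j l assume "i \<in> {..<m}" "k \<in> {..<n}" "j \<in> {..<m}" "l \<in> {..<n}"
      hence e: "kron A B $$ (i * n + k, j * n + l) = (\<Sum>\<alpha><r. complex_of_real (\<mu> \<alpha>) * q \<alpha> i * cnj (q \<alpha> j)) * B $$ (k, l)"
        by (simp add: kron_index[OF Ac Bc] dec)
      show "kron A B $$ (i * n + k, j * n + l) * f (j * n + l) * cnj (f (i * n + k)) =
        (\<Sum>\<alpha><r. complex_of_real (\<mu> \<alpha>) * (B $$ (k, l) * (cnj (q \<alpha> j) * f (j * n + l)) * cnj (cnj (q \<alpha> i) * f (i * n + k))))"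
        unfolding e sum_distrib_right by (simp only: complex_cnj_mult complex_cnj_cnj mult_ac)
    qed
    also have "\<dots> = (\<Sum>\<alpha><r. \<Sum>i<m. \<Sum>k<n. \<Sum>j<m. \<Sum>l<n. complex_of_real (\<mu> \<alpha>) * (B $$ (k, l) * (cnj (q \<alpha> j) * f (j * n + l)) * cnj (cnj (q \<alpha> i) * f (i * n + k))))"
    proof -
      have s4: "(\<Sum>x<m. \<Sum>y<n. \<Sum>x'<m. \<Sum>y'<n. \<Sum>a<r. F x y x' y' a) = (\<Sum>a<r. \<Sum>x<m. \<Sum>y<n. \<Sum>x'<m. \<Sum>y'<n. F x y x' y' a)"
        for F :: "nat \<Rightarrow> nat \<Rightarrow> nat \<Rightarrow> nat \<Rightarrow> nat \<Rightarrow> complex"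
        by (simp only: sum.swap[of _ "{..<r}"])
      show ?thesis by (rule s4)
    qed
    also have "\<dots> = (\<Sum>\<alpha><r. complex_of_real (\<mu> \<alpha>) * (\<Sum>k<n. \<Sum>l<n. B $$ (k, l) * h \<alpha> l * cnj (h \<alpha> k)))"
    proof (rule sum.cong[OF refl])
      fix \<alpha>
      let ?T = "\<lambda>i k j l. B $$ (k, l) * (cnj (q \<alpha> j) * f (j * n + l)) * cnj (cnj (q \<alpha> i) * f (i * n + k))"
      have "(\<Sum>k<n. \<Sum>l<n. B $$ (k, l) * h \<alpha> l * cnj (h \<alpha> k)) = (\<Sum>k<n. \<Sum>l<n. \<Sum>i<m. \<Sum>j<m. ?T i k j l)"
        unfolding h_def cnj_sum sum_distrib_left sum_distrib_right ..
      also have "\<dots> = (\<Sum>k<n. \<Sum>i<m. \<Sum>l<n. \<Sum>j<m. ?T i k j l)"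
        by (rule sum.cong[OF refl], rule sum.swap)
      also have "\<dots> = (\<Sum>i<m. \<Sum>k<n. \<Sum>j<m. \<Sum>l<n. ?T i k j l)"
        by (subst sum.swap, rule sum.cong[OF refl], rule sum.cong[OF refl], rule sum.swap)
      finally show "(\<Sum>i<m. \<Sum>k<n. \<Sum>j<m. \<Sum>l<n. complex_of_real (\<mu> \<alpha>) * ?T i k j l) =
          complex_of_real (\<mu> \<alpha>) * (\<Sum>k<n. \<Sum>l<n. B $$ (k, l) * h \<alpha> l * cnj (h \<alpha> k))"
        by (simp only: sum_distrib_left)
    qed
    finally have eq: "(\<Sum>r<m * n. \<Sum>s<m * n. kron A B $$ (r, s) * f s * cnj (f r)) =
      (\<Sum>\<alpha><r. complex_of_real (\<mu> \<alpha>) * (\<Sum>k<n. \<Sum>l<n. B $$ (k, l) * h \<alpha> l * cnj (h \<alpha> k)))" .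
    show "0 \<le> (\<Sum>r<m * n. \<Sum>s<m * n. kron A B $$ (r, s) * f s * cnj (f r))"
      unfolding eq by (rule sum_nonneg, rule mult_nonneg_nonneg) (auto intro: \<mu> pos_semidef_form[OF B])
  qed
qed

lemma kron_density:
  assumes A: "density_operator m A" and B: "density_operator n B"
  shows "density_operator (m * n) (kron A B)"
proof -
  note Ac = density_carrier[OF A] and Bc = density_carrier[OF B]
  have "mtrace (kron A B) = mtrace A * mtrace B"
    unfolding mtrace_square[OF kron_carrier[OF Ac Bc]] mtrace_square[OF Ac] mtrace_square[OF Bc] sum_div_mod sum_product
    by (intro sum.cong refl) (simp add: kron_index[OF Ac Bc])
  thus ?thesis using A B kron_pos_semidef unfolding density_operator_def by simp
qed

lemma product_state_density:
  assumes "product_state n \<rho>"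
  shows "density_operator (2 ^ n) \<rho>"
proof -
  obtain \<sigma> where \<sigma>: "\<And>i. i \<in> {1..n} \<Longrightarrow> density_operator 2 (\<sigma> i)"
    and \<rho>: "\<rho> = foldr (\<lambda>i A. kron (\<sigma> i) A) [1..<n + 1] (1\<^sub>m 1)"
    using assms unfolding product_state_def by blast
  \<comment> \<open>The dimension is expressed by the length of the list, so that the induction
    passes through tails of the list of qubits.\<close>
  have "density_operator (2 ^ length xs) (foldr (\<lambda>i A. kron (\<sigma> i) A) xs (1\<^sub>m 1))" if "set xs \<subseteq> {1..n}" for xs
    using that
  proof (induction xs)
    case Nil
    have "0 \<le> cnj (f 0) * f (0::nat)" for f using complex_mult_cnj_nonneg[of "f 0"] by (simp add: mult.commute)
    thus ?case by (simp add: density_operator_def pos_semidef_iff mtrace_def mult.commute)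
  next
    case (Cons i xs)
    thus ?case using kron_density[OF \<sigma>] by simp
  qed
  from this[of "[1..<n + 1]"] show ?thesis unfolding \<rho> by (fastforce simp del: upt_Suc)
qed

section \<open>Purity decay\<close>

text \<open>Cauchy-Schwarz in each block: the Hilbert-Schmidt norm of a map bounds its operator
  norm. A qubit without a gate offers nothing to average over, so this cruder bound is used there
  and costs a factor 2, the bound on the channel norm.\<close>

lemma hs_norm2_loc_le:
  "hs_norm2 (loc (p * d * q) d q k X) \<le> (\<Sum>r<d. \<Sum>s<d. \<Sum>b<d. \<Sum>c<d. (cmod (k r s b c))\<^sup>2) * hs_norm2 X"
  if X: "X \<in> carrier_mat (p * d * q) (p * d * q)"
proof -
  let ?K = "\<Sum>r<d. \<Sum>s<d. \<Sum>b<d. \<Sum>c<d. (cmod (k r s b c))\<^sup>2"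
  have bound: "(\<Sum>r<d. \<Sum>s<d. (cmod (\<Sum>b<d. \<Sum>c<d. k r s b c * B $$ (b, c)))\<^sup>2) \<le> ?K * hs_norm2 B"
    if B: "B \<in> carrier_mat d d" for B
  proof -
    have "(cmod (\<Sum>b<d. \<Sum>c<d. k r s b c * B $$ (b, c)))\<^sup>2 \<le> (\<Sum>b<d. \<Sum>c<d. (cmod (k r s b c))\<^sup>2) * hs_norm2 B" for r s
    proof -
      let ?S = "{..<d} \<times> {..<d}"
      have "cmod (\<Sum>b<d. \<Sum>c<d. k r s b c * B $$ (b, c)) = cmod (\<Sum>p\<in>?S. k r s (fst p) (snd p) * B $$ p)"
        by (simp add: sum.cartesian_product case_prod_beta)
      also have "\<dots> \<le> (\<Sum>p\<in>?S. cmod (k r s (fst p) (snd p)) * cmod (B $$ p))"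
        by (rule order_trans[OF norm_sum]) (simp add: norm_mult)
      finally have "(cmod (\<Sum>b<d. \<Sum>c<d. k r s b c * B $$ (b, c)))\<^sup>2 \<le> (\<Sum>p\<in>?S. cmod (k r s (fst p) (snd p)) * cmod (B $$ p))\<^sup>2"
        by (intro power_mono) auto
      also have "\<dots> \<le> (\<Sum>p\<in>?S. (cmod (k r s (fst p) (snd p)))\<^sup>2) * (\<Sum>p\<in>?S. (cmod (B $$ p))\<^sup>2)"
        by (rule Cauchy_Schwarz_ineq_sum)
      also have "\<dots> = (\<Sum>b<d. \<Sum>c<d. (cmod (k r s b c))\<^sup>2) * hs_norm2 B"
        by (simp add: hs_norm2_square[OF B] sum.cartesian_product case_prod_beta)
      finally show ?thesis .
    qed
    hence "(\<Sum>r<d. \<Sum>s<d. (cmod (\<Sum>b<d. \<Sum>c<d. k r s b c * B $$ (b, c)))\<^sup>2) \<le> (\<Sum>r<d. \<Sum>s<d. (\<Sum>b<d. \<Sum>c<d. (cmod (k r s b c))\<^sup>2) * hs_norm2 B)"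
      by (intro sum_mono)
    thus ?thesis by (simp only: sum_distrib_right)
  qed
  have "hs_norm2 (loc (p * d * q) d q k X) \<le> (\<Sum>x<p. \<Sum>y<q. \<Sum>x'<p. \<Sum>y'<q. ?K * hs_norm2 (block d q X x y x' y'))"
    unfolding hs_norm2_loc by (intro sum_mono bound block_carrier)
  thus ?thesis unfolding hs_norm2_blocks[OF X] by (simp only: sum_distrib_left)
qed

lemma hs_norm2_noise_le:
  assumes N: "qubit_channel N" and c: "channel_norm N \<le> 2" and i: "1 \<le> i" "i \<le> n"
    and X: "X \<in> carrier_mat (2 ^ n) (2 ^ n)"
  shows "hs_norm2 (noise_map n N i X) \<le> 2 * hs_norm2 X"
proof -
  have "hs_norm2 (noise_map n N i X) \<le> channel_norm N * hs_norm2 X"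
    unfolding noise_map_def channel_norm_kernel[OF N] two_power_single[OF i]
    by (rule hs_norm2_loc_le) (use X in \<open>simp only: two_power_single[OF i]\<close>)
  also have "\<dots> \<le> 2 * hs_norm2 X" using c by (intro mult_right_mono hs_norm2_nonneg)
  finally show ?thesis .
qed

lemma hs_norm2_noises_le:
  assumes N: "qubit_channel N" and c: "channel_norm N \<le> 2"
    and X: "X \<in> carrier_mat (2 ^ n) (2 ^ n)" and ps: "set ps \<subseteq> {1..n}"
  shows "hs_norm2 (foldr (noise_map n N) ps X) \<le> 2 ^ length ps * hs_norm2 X"
  using ps
proof (induction ps)
  case (Cons i ps)
  have "foldr (noise_map n N) ps X \<in> carrier_mat (2 ^ n) (2 ^ n)" using X by (cases ps) auto
  hence "hs_norm2 (foldr (noise_map n N) (i # ps) X) \<le> 2 * hs_norm2 (foldr (noise_map n N) ps X)"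
    using Cons.prems by (simp add: hs_norm2_noise_le[OF N c])
  also have "\<dots> \<le> 2 * (2 ^ length ps * hs_norm2 X)" using Cons by simp
  finally show ?case by simp
qed simp

lemma block_gate_map:
  assumes U: "U \<in> carrier_mat d d" and l: "x < p" "y < q" "x' < p" "y' < q"
  shows "block d q (loc (p * d * q) d q (conj_kernel U) X) x y x' y' = U * block d q X x y x' y' * mat_adjoint U"
proof (rule eq_matI)
  fix b c assume "b < dim_row (U * block d q X x y x' y' * mat_adjoint U)" "c < dim_col (U * block d q X x y x' y' * mat_adjoint U)"
  hence bc: "b < d" "c < d" using U by auto
  show "block d q (loc (p * d * q) d q (conj_kernel U) X) x y x' y' $$ (b, c) = (U * block d q X x y x' y' * mat_adjoint U) $$ (b, c)"
    unfolding conjugate_entry[OF U block_carrier bc] using bc l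
    by (auto simp: block_def loc_index composite_less digits_of_composite conj_kernel_def intro!: sum.cong)
qed (use U in \<open>auto simp: block_def\<close>)

text \<open>Gate and noise act on each block separately, so the two-qubit moment is applied block by
  block. The squared moduli of the block traces add up to the squared norm of the reset
  matrix.\<close>

lemma noisy_gate_moment:
  assumes N: "qubit_channel N" and des: "unitary_2_design 4 \<nu>" and i: "1 \<le> i" "i < n"
    and Y: "Y \<in> carrier_mat (2 ^ n) (2 ^ n)"
  shows "integrable \<nu> (\<lambda>U. hs_norm2 (noisy_gate n N i U Y))"
    and "(LINT U|\<nu>. hs_norm2 (noisy_gate n N i U Y)) =
      pair_trace_coeff N * hs_norm2 (reset_map n i Y) + pair_norm_coeff N * hs_norm2 Y"
proof -
  interpret unitary_probability \<nu> 4 using des by (rule design_unitary_probability)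
  define p q where "p = (2::nat) ^ (i - 1)" and "q = (2::nat) ^ (n - i - 1)"
  have D: "2 ^ n = p * 4 * q" unfolding p_def q_def by (rule two_power_pair[OF i])
  let ?f = "\<lambda>B U. \<Sum>r<4. \<Sum>s<4. (cmod (\<Sum>x<4. \<Sum>y<4. pair_kernel (channel_kernel N) r s x y * (U * B * mat_adjoint U) $$ (x, y)))\<^sup>2"
  let ?B = "\<lambda>x y x' y'. block 4 q Y x y x' y'"
  have eq: "hs_norm2 (noisy_gate n N i U Y) = (\<Sum>x<p. \<Sum>y<q. \<Sum>x'<p. \<Sum>y'<q. ?f (?B x y x' y') U)" if "U \<in> space \<nu>" for U
  proof -
    have U: "U \<in> carrier_mat 4 4" using that unitaryD(1) by (auto simp: space_eq)
    show ?thesis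
      unfolding noisy_gate_eq[OF i] gate_map_def q_def[symmetric] D hs_norm2_loc
      by (intro sum.cong refl) (simp add: block_gate_map[OF U])
  qed
  note m = pair_moment[OF N des block_carrier]
  have "integrable \<nu> (\<lambda>U. \<Sum>x<p. \<Sum>y<q. \<Sum>x'<p. \<Sum>y'<q. ?f (?B x y x' y') U)"
    by (intro Bochner_Integration.integrable_sum m(1))
  thus "integrable \<nu> (\<lambda>U. hs_norm2 (noisy_gate n N i U Y))"
    by (rule Bochner_Integration.integrable_cong[THEN iffD1, rotated -1]) (auto simp: eq)
  have "(LINT U|\<nu>. hs_norm2 (noisy_gate n N i U Y)) = (LINT U|\<nu>. (\<Sum>x<p. \<Sum>y<q. \<Sum>x'<p. \<Sum>y'<q. ?f (?B x y x' y') U))"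
    by (intro Bochner_Integration.integral_cong refl eq)
  also have "\<dots> = (\<Sum>x<p. \<Sum>y<q. \<Sum>x'<p. \<Sum>y'<q. (LINT U|\<nu>. ?f (?B x y x' y') U))"
    by (simp only: Bochner_Integration.integral_sum Bochner_Integration.integrable_sum m(1))
  also have "\<dots> = (\<Sum>x<p. \<Sum>y<q. \<Sum>x'<p. \<Sum>y'<q.
      pair_trace_coeff N * (cmod (mtrace (?B x y x' y')))\<^sup>2 + pair_norm_coeff N * hs_norm2 (?B x y x' y'))"
    by (simp only: m(2))
  also have "\<dots> = pair_trace_coeff N * hs_norm2 (reset_map n i Y) + pair_norm_coeff N * hs_norm2 Y"
    unfolding reset_map_def q_def[symmetric] hs_norm2_blocks[OF Y[unfolded D]] D hs_norm2_reset[OF zero_less_numeral]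
    by (simp only: sum.distrib sum_distrib_left)
  finally show "(LINT U|\<nu>. hs_norm2 (noisy_gate n N i U Y)) =
      pair_trace_coeff N * hs_norm2 (reset_map n i Y) + pair_norm_coeff N * hs_norm2 Y" .
qed

text \<open>One coordinate of a product measure may be replaced by an independent fresh copy. This
  averages over a single gate without splitting the product space, so the induction over the gates
  stays on one space.\<close>

lemma nn_integral_resample:
  assumes \<nu>: "prob_space \<nu>" and I: "finite I" "i \<in> I" and f: "f \<in> borel_measurable (PiM I (\<lambda>_. \<nu>))"
  shows "(\<integral>\<^sup>+ g. f g \<partial>PiM I (\<lambda>_. \<nu>)) = (\<integral>\<^sup>+ g. (\<integral>\<^sup>+ u. f (g(i := u)) \<partial>\<nu>) \<partial>PiM I (\<lambda>_. \<nu>))"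
proof -
  interpret prob_space \<nu> by fact
  interpret product_sigma_finite "\<lambda>_. \<nu>" by (simp add: product_sigma_finite_def sigma_finite_measure_axioms)
  define J where "J = I - {i}"
  have J: "finite J" "i \<notin> J" "I = insert i J" using I by (auto simp: J_def)
  have "(\<lambda>p. (fst p)(i := snd p)) \<in> measurable (PiM I (\<lambda>_. \<nu>) \<Otimes>\<^sub>M \<nu>) (PiM I (\<lambda>_. \<nu>))"
    by (rule measurable_fun_upd[where J = I]) (use I in auto)
  hence "(\<lambda>p. f ((fst p)(i := snd p))) \<in> borel_measurable (PiM I (\<lambda>_. \<nu>) \<Otimes>\<^sub>M \<nu>)"
    by (rule measurable_compose[OF _ f])
  hence h: "(\<lambda>g. \<integral>\<^sup>+ u. f (g(i := u)) \<partial>\<nu>) \<in> borel_measurable (PiM I (\<lambda>_. \<nu>))"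
    by (intro borel_measurable_nn_integral) (simp add: case_prod_beta')
  have "(\<integral>\<^sup>+ g. (\<integral>\<^sup>+ u. f (g(i := u)) \<partial>\<nu>) \<partial>PiM I (\<lambda>_. \<nu>)) =
      (\<integral>\<^sup>+ x. (\<integral>\<^sup>+ y. (\<integral>\<^sup>+ u. f ((x(i := y))(i := u)) \<partial>\<nu>) \<partial>\<nu>) \<partial>PiM J (\<lambda>_. \<nu>))"
    using product_nn_integral_insert[OF J(1,2) h[unfolded J(3)]] unfolding J(3) .
  \<comment> \<open>The overwritten value \<open>y\<close> no longer occurs, and its integral
    contributes the total mass 1.\<close>
  also have "\<dots> = (\<integral>\<^sup>+ x. (\<integral>\<^sup>+ u. f (x(i := u)) \<partial>\<nu>) \<partial>PiM J (\<lambda>_. \<nu>))"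
    by (simp add: emeasure_space_1)
  also have "\<dots> = (\<integral>\<^sup>+ g. f g \<partial>PiM I (\<lambda>_. \<nu>))"
    using product_nn_integral_insert[OF J(1,2) f[unfolded J(3)]] unfolding J(3) by simp
  finally show ?thesis by simp
qed

text \<open>Entrywise, so that no sigma-algebra on matrices has to be fixed; norms and Schmidt
  moments are built from finitely many entries.\<close>

definition measurable_mat :: "'a measure \<Rightarrow> nat \<Rightarrow> ('a \<Rightarrow> complex mat) \<Rightarrow> bool" where
  "measurable_mat M D X \<longleftrightarrow> (\<forall>r<D. \<forall>s<D. (\<lambda>g. X g $$ (r, s)) \<in> borel_measurable M)"

lemma measurable_mat_loc:
  assumes X: "measurable_mat M D X" and D: "d * q dvd D"
    and k: "\<And>r s b c. r < d \<Longrightarrow> s < d \<Longrightarrow> b < d \<Longrightarrow> c < d \<Longrightarrow> (\<lambda>g. k g r s b c) \<in> borel_measurable M"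
  shows "measurable_mat M D (\<lambda>g. loc D d q (k g) (X g))"
  unfolding measurable_mat_def
proof (intro allI impI)
  fix r s assume rs: "r < D" "s < D"
  hence d: "0 < d" using D by (auto intro: gr0I)
  have "(\<lambda>g. \<Sum>b<d. \<Sum>c<d. k g (digit d q r) (digit d q s) b c * X g $$ (put_digit d q r b, put_digit d q s c)) \<in> borel_measurable M"
    using X rs d put_digit_less[OF D] unfolding measurable_mat_def
    by (intro borel_measurable_sum borel_measurable_times k) (auto simp: digit_less)
  thus "(\<lambda>g. loc D d q (k g) (X g) $$ (r, s)) \<in> borel_measurable M" by (simp add: loc_index[OF rs])
qed

lemma measurable_hs_norm2:
  assumes X: "measurable_mat M D X" and c: "\<And>g. g \<in> space M \<Longrightarrow> X g \<in> carrier_mat D D"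
  shows "(\<lambda>g. hs_norm2 (X g)) \<in> borel_measurable M"
proof -
  have "(\<lambda>g. \<Sum>r<D. \<Sum>s<D. (cmod (X g $$ (r, s)))\<^sup>2) \<in> borel_measurable M"
    using X unfolding measurable_mat_def
    by (intro borel_measurable_sum borel_measurable_power borel_measurable_norm[THEN measurable_compose[rotated]] measurable_compose[OF _ borel_measurable_norm]) auto
  thus ?thesis by (rule measurable_cong[THEN iffD1, rotated]) (simp add: hs_norm2_square[OF c])
qed

section \<open>Expected purity of a random layer\<close>

locale brickwall =
  fixes N :: "complex mat \<Rightarrow> complex mat" and n L :: nat and \<nu> :: "complex mat measure"
  assumes channel: "qubit_channel N" and coefficient: "contraction_coefficient N < 1 / 3"
    and design: "unitary_2_design 4 \<nu>"
begin

sublocale unitary_probability \<nu> 4 using design by (rule design_unitary_probability)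

definition M where "M = circuit_measure n L \<nu>"

lemma M_eq: "M = PiM (gate_sites n L) (\<lambda>_. \<nu>)"
  by (simp add: M_def circuit_measure_def)

sublocale P: prob_space M
  unfolding M_eq by (intro prob_space_PiM prob_space_axioms)

lemma finite_sites: "finite (gate_sites n L)"
  by (auto simp: gate_sites_def)

lemma site: "1 \<le> l \<Longrightarrow> l \<le> L \<Longrightarrow> i \<in> set (gate_positions n l) \<Longrightarrow> (l, i) \<in> gate_sites n L"
  by (auto simp: gate_sites_def)

lemma gate_unitary: "g \<in> space M \<Longrightarrow> s \<in> gate_sites n L \<Longrightarrow> unitary_mat 4 (g s)"
  by (auto simp: M_eq space_PiM PiE_iff space_eq)

lemma measurable_gate_entry:
  assumes "s \<in> gate_sites n L" "a < 4" "b < 4"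
  shows "(\<lambda>g. g s $$ (a, b)) \<in> borel_measurable M"
proof -
  have "(\<lambda>g. g s) \<in> measurable M \<nu>"
    unfolding M_eq by (rule measurable_component_singleton[OF assms(1)])
  from measurable_compose[OF this entry_measurable[OF assms(2,3)]] show ?thesis .
qed

lemma measurable_gate_map:
  assumes X: "measurable_mat M (2 ^ n) X" and i: "1 \<le> i" "i < n" and s: "s \<in> gate_sites n L"
  shows "measurable_mat M (2 ^ n) (\<lambda>g. gate_map n i (g s) (X g))"
  unfolding gate_map_def
  by (rule measurable_mat_loc[OF X pair_dvd[OF i]])
    (auto simp: conj_kernel_def intro!: borel_measurable_times measurable_gate_entry[OF s] measurable_compose[OF _ measurable_cnj])

lemma measurable_noise_map:
  assumes X: "measurable_mat M (2 ^ n) X" and i: "1 \<le> i" "i \<le> n"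
  shows "measurable_mat M (2 ^ n) (\<lambda>g. noise_map n N i (X g))"
  unfolding noise_map_def by (rule measurable_mat_loc[OF X single_dvd[OF i]]) simp

lemma measurable_noisy_gate:
  assumes X: "measurable_mat M (2 ^ n) X" and i: "1 \<le> i" "i < n" and s: "s \<in> gate_sites n L"
  shows "measurable_mat M (2 ^ n) (\<lambda>g. noisy_gate n N i (g s) (X g))"
  unfolding noisy_gate_def using i by (intro measurable_noise_map measurable_gate_map X s) auto

lemma measurable_noisy_gates:
  assumes X: "measurable_mat M (2 ^ n) X" and l: "1 \<le> l" "l \<le> L" and ps: "set ps \<subseteq> set (gate_positions n l)"
  shows "measurable_mat M (2 ^ n) (\<lambda>g. foldr (\<lambda>i. noisy_gate n N i (g (l, i))) ps (X g))"
  using ps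
proof (induction ps)
  case (Cons i ps)
  hence "1 \<le> i" "i < n" "(l, i) \<in> gate_sites n L" using site[OF l] by (auto simp: gate_positions_def)
  thus ?case using Cons measurable_noisy_gate[of "\<lambda>g. foldr (\<lambda>i. noisy_gate n N i (g (l, i))) ps (X g)" i "(l, i)"] by simp
qed (use X in simp)

abbreviation "rate \<equiv> pair_trace_coeff N + pair_norm_coeff N"

lemmas coeffs = pair_coeffs[OF channel coefficient]

lemma noisy_gate_carrier [simp]: "noisy_gate n N i G X \<in> carrier_mat (2 ^ n) (2 ^ n)"
  by (simp add: noisy_gate_def)

text \<open>Averaging over the outermost gate turns the purity into a combination of the purities of two
  states that do not depend on that gate, the second one with its two qubits reset; the reset is
  then moved into the initial state.\<close>

lemma expected_purity_gates:
  assumes l: "1 \<le> l" "l \<le> L" and ps: "spaced n ps" "set ps \<subseteq> set (gate_positions n l)"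
    and X: "\<And>g. g \<in> space M \<Longrightarrow> density_operator (2 ^ n) (X g)" "measurable_mat M (2 ^ n) X"
      "\<And>g i u. i \<in> set ps \<Longrightarrow> X (g((l, i) := u)) = X g"
  shows "(\<integral>\<^sup>+ g. ennreal (hs_norm2 (foldr (\<lambda>i. noisy_gate n N i (g (l, i))) ps (X g))) \<partial>M) \<le> ennreal (rate ^ length ps)"
  using ps X
proof (induction ps arbitrary: X)
  case Nil
  \<comment> \<open>With no gate left to average over, the bound is the trivial one for the purity
    of a state.\<close>
  have "hs_norm2 (X g) \<le> 1" if "g \<in> space M" for g
    using pos_semidef_hs_norm2_le[of "2 ^ n" "X g"] Nil.prems(3)[OF that] by (simp add: density_operator_def)
  hence "(\<integral>\<^sup>+ g. ennreal (hs_norm2 (X g)) \<partial>M) \<le> (\<integral>\<^sup>+ g. 1 \<partial>M)"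
    by (intro nn_integral_mono) (metis ennreal_1 ennreal_leI)
  thus ?case by (simp add: P.emeasure_space_1)
next
  case (Cons i ps)
  note sp = spaced_Cons[OF Cons.prems(1)]
  have i: "1 \<le> i" "i < n" using sp(2) by auto
  have s: "(l, i) \<in> gate_sites n L" using site[OF l] Cons.prems(2) by simp
  have ips: "i \<notin> set ps" using sp(3) by fastforce
  have psub: "set ps \<subseteq> set (gate_positions n l)" using Cons.prems(2) by simp
  let ?F = "\<lambda>X g. foldr (\<lambda>i. noisy_gate n N i (g (l, i))) ps (X g)"
  have Fc: "?F X g \<in> carrier_mat (2 ^ n) (2 ^ n)" if "g \<in> space M" for g
    using density_carrier[OF Cons.prems(3)[OF that]] by (cases ps) auto
  have Fm: "measurable_mat M (2 ^ n) (?F X)"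
    by (rule measurable_noisy_gates[OF Cons.prems(4) l psub])
  \<comment> \<open>Resampling the outermost gate leaves the matrix it acts on unchanged, so the
    inner integral is a second moment at a fixed matrix.\<close>
  have upd: "?F X (g((l, i) := u)) = ?F X g" for g u
  proof -
    have "X (g((l, i) := u)) = X g" by (rule Cons.prems(5)) simp
    moreover have "foldr (\<lambda>j. noisy_gate n N j ((g((l, i) := u)) (l, j))) ps Z = foldr (\<lambda>j. noisy_gate n N j (g (l, j))) ps Z" for Z
      by (rule foldr_cong) (use ips in auto)
    ultimately show ?thesis by (simp only:)
  qed
  have XR: "measurable_mat M (2 ^ n) (\<lambda>g. reset_map n i (X g))"
    unfolding reset_map_def by (rule measurable_mat_loc[OF Cons.prems(4) pair_dvd[OF i]]) simp
  have FRm: "measurable_mat M (2 ^ n) (?F (\<lambda>g. reset_map n i (X g)))"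
    by (rule measurable_noisy_gates[OF XR l psub])
  have FRc: "?F (\<lambda>g. reset_map n i (X g)) g \<in> carrier_mat (2 ^ n) (2 ^ n)" for g
    by (cases ps) (auto simp: reset_map_def)
  \<comment> \<open>The reset meets only gates on later qubits, with which it commutes. It arrives
    at the input, where it yields another density operator.\<close>
  have RF: "reset_map n i (?F X g) = ?F (\<lambda>g. reset_map n i (X g)) g" for g
  proof -
    have "reset_map n i (foldr (\<lambda>i. noisy_gate n N i (g (l, i))) qs Y) = foldr (\<lambda>i. noisy_gate n N i (g (l, i))) qs (reset_map n i Y)"
      if "set qs \<subseteq> set ps" for qs Y
      using that
    proof (induction qs)
      case (Cons j qs)
      have "i + 2 \<le> j" "j < n" using Cons.prems sp(3) \<open>spaced n (i # ps)\<close> by (auto simp: spaced_def)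
      thus ?case using Cons reset_noisy_gate_commute[OF i(1)] by simp
    qed simp
    thus ?thesis by simp
  qed
  let ?H = "\<lambda>g. hs_norm2 (noisy_gate n N i (g (l, i)) (?F X g))"
  have Hm: "(\<lambda>g. ennreal (?H g)) \<in> borel_measurable M"
    by (intro measurable_compose[OF _ measurable_ennreal] measurable_hs_norm2[where D = "2 ^ n"] measurable_noisy_gate Fm i s) simp
  have "(\<integral>\<^sup>+ g. ennreal (?H g) \<partial>M) = (\<integral>\<^sup>+ g. (\<integral>\<^sup>+ u. ennreal (?H (g((l, i) := u))) \<partial>\<nu>) \<partial>M)"
    unfolding M_eq by (rule nn_integral_resample[OF prob_space_axioms finite_sites s Hm[unfolded M_eq]])
  also have "\<dots> = (\<integral>\<^sup>+ g. ennreal (pair_trace_coeff N) * ennreal (hs_norm2 (?F (\<lambda>g. reset_map n i (X g)) g)) +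
      ennreal (pair_norm_coeff N) * ennreal (hs_norm2 (?F X g)) \<partial>M)"
  proof (rule nn_integral_cong)
    fix g assume g: "g \<in> space M"
    note mom = noisy_gate_moment[OF channel design i Fc[OF g]]
    have "(\<integral>\<^sup>+ u. ennreal (?H (g((l, i) := u))) \<partial>\<nu>) = (\<integral>\<^sup>+ u. ennreal (hs_norm2 (noisy_gate n N i u (?F X g))) \<partial>\<nu>)"
      by (simp only: upd fun_upd_same)
    also have "\<dots> = ennreal (LINT u|\<nu>. hs_norm2 (noisy_gate n N i u (?F X g)))"
      by (rule nn_integral_eq_integral[OF mom(1)]) (simp add: hs_norm2_nonneg)
    also have "\<dots> = ennreal (pair_trace_coeff N) * ennreal (hs_norm2 (?F (\<lambda>g. reset_map n i (X g)) g)) +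
      ennreal (pair_norm_coeff N) * ennreal (hs_norm2 (?F X g))"
      unfolding mom(2) RF using coeffs by (simp add: ennreal_mult hs_norm2_nonneg)
    finally show "(\<integral>\<^sup>+ u. ennreal (?H (g((l, i) := u))) \<partial>\<nu>) = ennreal (pair_trace_coeff N) * ennreal (hs_norm2 (?F (\<lambda>g. reset_map n i (X g)) g)) +
      ennreal (pair_norm_coeff N) * ennreal (hs_norm2 (?F X g))" .
  qed
  also have "\<dots> = ennreal (pair_trace_coeff N) * (\<integral>\<^sup>+ g. ennreal (hs_norm2 (?F (\<lambda>g. reset_map n i (X g)) g)) \<partial>M) +
      ennreal (pair_norm_coeff N) * (\<integral>\<^sup>+ g. ennreal (hs_norm2 (?F X g)) \<partial>M)"
  proof -
    have "(\<lambda>g. ennreal (hs_norm2 (?F X g))) \<in> borel_measurable M"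
      by (intro measurable_compose[OF _ measurable_ennreal] measurable_hs_norm2[OF Fm] Fc)
    moreover have "(\<lambda>g. ennreal (hs_norm2 (?F (\<lambda>g. reset_map n i (X g)) g))) \<in> borel_measurable M"
      by (intro measurable_compose[OF _ measurable_ennreal] measurable_hs_norm2[OF FRm] FRc)
    ultimately show ?thesis by (simp add: nn_integral_add nn_integral_cmult)
  qed
  \<comment> \<open>The induction hypothesis is used for two inputs, \<open>X\<close> and its reset;
    for this reason \<open>X\<close> is generalized in the induction.\<close>
  also have "\<dots> \<le> ennreal (pair_trace_coeff N) * ennreal (rate ^ length ps) + ennreal (pair_norm_coeff N) * ennreal (rate ^ length ps)"
  proof (intro add_mono mult_left_mono)
    show "(\<integral>\<^sup>+ g. ennreal (hs_norm2 (?F (\<lambda>g. reset_map n i (X g)) g)) \<partial>M) \<le> ennreal (rate ^ length ps)"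
      using Cons.prems(3,5) by (intro Cons.IH[OF sp(1) psub _ XR]) (auto intro: reset_map_density[OF i])
    show "(\<integral>\<^sup>+ g. ennreal (hs_norm2 (?F X g)) \<partial>M) \<le> ennreal (rate ^ length ps)"
      using Cons.prems(3,5) by (intro Cons.IH[OF sp(1) psub _ Cons.prems(4)]) auto
  qed simp_all
  also have "\<dots> = ennreal (rate ^ length (i # ps))"
    using coeffs by (simp add: ennreal_mult'[symmetric] ennreal_plus[symmetric] distrib_right del: ennreal_plus)
  finally show ?case by simp
qed

end

section \<open>The random circuit with a product state as input\<close>

locale brickwall_state = brickwall +
  fixes \<rho>0 :: "complex mat"
  assumes initial: "product_state n \<rho>0"
begin

abbreviation "state g l \<equiv> circuit_state n N g \<rho>0 l"

lemma state_density: "g \<in> space M \<Longrightarrow> l \<le> L \<Longrightarrow> density_operator (2 ^ n) (state g l)"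
  by (rule circuit_state_density[OF channel product_state_density[OF initial]]) (auto intro!: gate_unitary site)

lemma state_carrier: "g \<in> space M \<Longrightarrow> l \<le> L \<Longrightarrow> state g l \<in> carrier_mat (2 ^ n) (2 ^ n)"
  by (intro density_carrier state_density)

lemma state_Suc:
  assumes "g \<in> space M" "Suc l \<le> L"
  shows "state g (Suc l) = foldr (noise_map n N) (uncovered n (gate_positions n (Suc l)))
      (foldr (\<lambda>i. noisy_gate n N i (g (Suc l, i))) (gate_positions n (Suc l)) (state g l))"
proof (rule circuit_state_Suc[OF channel])
  show "g (Suc l, i) \<in> carrier_mat 4 4" if "i \<in> set (gate_positions n (Suc l))" for i
    by (rule unitaryD(1)[OF gate_unitary[OF assms(1) site]]) (use assms(2) that in auto)
qed (use assms in \<open>auto intro: state_carrier\<close>)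

text \<open>This independence allows a layer to be averaged with its random input held
  fixed.\<close>

lemma state_upd: "l < m \<Longrightarrow> state (g((m, i) := u)) l = state g l"
proof (induction l)
  case (Suc l)
  have "layer_unitary n (g((m, i) := u)) (Suc l) = layer_unitary n g (Suc l)"
    using Suc.prems unfolding layer_unitary_def by (intro foldr_cong) auto
  thus ?case using Suc by (simp only: circuit_state.simps Suc_lessD)
qed simp

lemma measurable_state: "l \<le> L \<Longrightarrow> measurable_mat M (2 ^ n) (\<lambda>g. state g l)"
proof (induction l)
  case 0
  thus ?case by (simp add: measurable_mat_def)
next
  case (Suc l)
  have "measurable_mat M (2 ^ n) (\<lambda>g. foldr (noise_map n N) qs (Y g))"
    if "set qs \<subseteq> {1..n}" "measurable_mat M (2 ^ n) Y" for qs Y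
    using that by (induction qs) (auto intro: measurable_noise_map)
  moreover have "measurable_mat M (2 ^ n) (\<lambda>g. foldr (\<lambda>i. noisy_gate n N i (g (Suc l, i))) (gate_positions n (Suc l)) (state g l))"
    using Suc by (intro measurable_noisy_gates) auto
  moreover have "set (uncovered n (gate_positions n (Suc l))) \<subseteq> {1..n}" by (auto simp: uncovered_def)
  ultimately have m: "measurable_mat M (2 ^ n) (\<lambda>g. foldr (noise_map n N) (uncovered n (gate_positions n (Suc l)))
      (foldr (\<lambda>i. noisy_gate n N i (g (Suc l, i))) (gate_positions n (Suc l)) (state g l)))"
    by blast
  show ?case
    unfolding measurable_mat_def
  proof (intro allI impI)
    fix r s assume "r < (2::nat) ^ n" "s < (2::nat) ^ n"
    with m have "(\<lambda>g. foldr (noise_map n N) (uncovered n (gate_positions n (Suc l)))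
      (foldr (\<lambda>i. noisy_gate n N i (g (Suc l, i))) (gate_positions n (Suc l)) (state g l)) $$ (r, s)) \<in> borel_measurable M"
      by (simp add: measurable_mat_def)
    thus "(\<lambda>g. state g (Suc l) $$ (r, s)) \<in> borel_measurable M"
      by (rule measurable_cong[THEN iffD1, rotated]) (simp only: state_Suc[OF _ Suc.prems])
  qed
qed

lemma expected_purity:
  assumes l: "1 \<le> l" "l \<le> L"
  shows "(\<integral>\<^sup>+ g. ennreal (hs_norm2 (state g l)) \<partial>M) \<le> ennreal (4 * rate ^ length (gate_positions n l))"
proof -
  obtain k where k: "l = Suc k" using l by (cases l) auto
  let ?Y = "\<lambda>g. foldr (\<lambda>i. noisy_gate n N i (g (l, i))) (gate_positions n l) (state g k)"
  have c: "channel_norm N \<le> 2" using channel_norm_contraction_coefficient[OF channel] coefficient by simp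
  have "hs_norm2 (state g l) \<le> 4 * hs_norm2 (?Y g)" if g: "g \<in> space M" for g
  proof -
    have Y: "?Y g \<in> carrier_mat (2 ^ n) (2 ^ n)"
      using state_carrier[OF g, of k] l k by (cases "gate_positions n l") auto
    have "hs_norm2 (state g l) \<le> 2 ^ length (uncovered n (gate_positions n l)) * hs_norm2 (?Y g)"
      unfolding k state_Suc[OF g l(2)[unfolded k]] using Y[unfolded k]
      by (intro hs_norm2_noises_le[OF channel c]) (auto simp: uncovered_def)
    also have "\<dots> \<le> 2\<^sup>2 * hs_norm2 (?Y g)"
      by (intro mult_right_mono power_increasing length_uncovered_le hs_norm2_nonneg) simp
    finally show ?thesis by simp
  qed
  hence "(\<integral>\<^sup>+ g. ennreal (hs_norm2 (state g l)) \<partial>M) \<le> (\<integral>\<^sup>+ g. ennreal 4 * ennreal (hs_norm2 (?Y g)) \<partial>M)"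
    by (intro nn_integral_mono, subst ennreal_mult[symmetric]) (auto intro!: ennreal_leI simp: hs_norm2_nonneg)
  also have "\<dots> = ennreal 4 * (\<integral>\<^sup>+ g. ennreal (hs_norm2 (?Y g)) \<partial>M)"
  proof (rule nn_integral_cmult, rule measurable_compose[OF _ measurable_ennreal], rule measurable_hs_norm2[where D = "2 ^ n"])
    show "measurable_mat M (2 ^ n) ?Y" using l k by (intro measurable_noisy_gates measurable_state) auto
    show "?Y g \<in> carrier_mat (2 ^ n) (2 ^ n)" if g: "g \<in> space M" for g
      using state_carrier[OF g, of k] l k by (cases "gate_positions n l") auto
  qed
  also have "\<dots> \<le> ennreal 4 * ennreal (rate ^ length (gate_positions n l))"
    using l k by (intro mult_left_mono expected_purity_gates spaced_gate_positions)
      (auto intro: state_density measurable_state state_upd)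
  also have "\<dots> = ennreal (4 * rate ^ length (gate_positions n l))"
    using coeffs by (simp add: ennreal_mult)
  finally show ?thesis .
qed

text \<open>A definite description gives no access to measurability, so the entropy is treated as a
  pointwise limit of combinations of Schmidt moments, which are finite sums of products of entries
  and their conjugates.\<close>

lemma measurable_entanglement:
  assumes a: "a \<le> n" and l: "l \<le> L"
  shows "(\<lambda>g. operator_entanglement n a (state g l)) \<in> borel_measurable M"
proof -
  let ?A = "2 ^ a :: nat" and ?B = "2 ^ (n - a) :: nat"
  have AB: "?A * ?B = 2 ^ n" using a by (simp flip: power_add)
  have re: "(\<lambda>g. realign ?A ?B (state g l) u y) \<in> borel_measurable M" if "u < ?A * ?A" "y < ?B * ?B" for u y
  proof -
    have "u div ?A * ?B + y div ?B < 2 ^ n" "u mod ?A * ?B + y mod ?B < 2 ^ n"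
      using that unfolding AB[symmetric] by (auto intro!: mult_add_less div_mod_less)
    thus ?thesis unfolding realign_def using measurable_state[OF l] by (simp add: measurable_mat_def)
  qed
  have gr: "(\<lambda>g. realigned_gram ?A ?B (state g l) u v) \<in> borel_measurable M" if "u < ?A * ?A" "v < ?A * ?A" for u v
    unfolding realigned_gram_def using that
    by (intro borel_measurable_sum borel_measurable_times re measurable_compose[OF re measurable_cnj]) auto
  have gp: "(\<lambda>g. gram_power ?A ?B (state g l) k u v) \<in> borel_measurable M" if "u < ?A * ?A" "v < ?A * ?A" for u v k
    using that
  proof (induction k arbitrary: v)
    case (Suc k)
    thus ?case unfolding gram_power.simps
      by (intro borel_measurable_sum borel_measurable_times gr) auto
  qed (simp add: gr)
  have sm: "(\<lambda>g. schmidt_moment ?A ?B (state g l) k) \<in> borel_measurable M" for k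
    unfolding schmidt_moment_def
    by (intro measurable_compose[OF _ borel_measurable_Re] borel_measurable_sum gp) auto
  show ?thesis
  proof (rule operator_entanglement_limit)
    fix m :: "nat \<Rightarrow> nat" and c :: "nat \<Rightarrow> nat \<Rightarrow> real"
    assume lim: "\<And>n a \<rho>. a \<le> n \<Longrightarrow> \<rho> \<in> carrier_mat (2 ^ n) (2 ^ n) \<Longrightarrow>
      (\<lambda>k. \<Sum>i<m k. c k i * schmidt_moment (2 ^ a) (2 ^ (n - a)) \<rho> i) \<longlonglongrightarrow> operator_entanglement n a \<rho>"
    show ?thesis
    proof (rule borel_measurable_LIMSEQ_real)
      fix g assume "g \<in> space M"
      from lim[OF a state_carrier[OF this l]]
      show "(\<lambda>k. \<Sum>i<m k. c k i * schmidt_moment ?A ?B (state g l) i) \<longlonglongrightarrow> operator_entanglement n a (state g l)" .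
    qed (intro borel_measurable_sum borel_measurable_times borel_measurable_const sm)
  qed
qed

text \<open>Markov's inequality at the threshold 1 / n, below which the term 2 n P of the entropy
  bound is at most 2.\<close>

lemma purity_tail:
  assumes l: "1 \<le> l" "l \<le> L" and n: "0 < n"
  shows "P.prob {g \<in> space M. hs_norm2 (state g l) \<ge> 1 / real n} \<le> 4 * real n * rate ^ length (gate_positions n l)"
proof -
  let ?f = "\<lambda>g. ennreal (hs_norm2 (state g l))"
  have m: "?f \<in> borel_measurable M"
    using l by (intro measurable_compose[OF _ measurable_ennreal] measurable_hs_norm2[where D = "2 ^ n"] measurable_state state_carrier) auto
  have "emeasure M {g \<in> space M. hs_norm2 (state g l) \<ge> 1 / real n} = emeasure M {g \<in> space M. 1 \<le> ennreal (real n) * ?f g}"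
    using n by (intro arg_cong[where f = "emeasure M"] Collect_cong conj_cong refl)
      (simp add: ennreal_mult'[symmetric] hs_norm2_nonneg field_simps)
  also have "\<dots> \<le> ennreal (real n) * (\<integral>\<^sup>+ g. ?f g * indicator (space M) g \<partial>M)"
    using m by (intro nn_integral_Markov_inequality) auto
  also have "(\<integral>\<^sup>+ g. ?f g * indicator (space M) g \<partial>M) = (\<integral>\<^sup>+ g. ?f g \<partial>M)"
    by (intro nn_integral_cong) simp
  also have "ennreal (real n) * \<dots> \<le> ennreal (real n) * ennreal (4 * rate ^ length (gate_positions n l))"
    by (intro mult_left_mono expected_purity[OF l]) simp
  also have "\<dots> = ennreal (4 * real n * rate ^ length (gate_positions n l))"
    by (subst ennreal_mult'[symmetric]) (simp_all add: mult_ac)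
  finally show ?thesis using coeffs unfolding P.emeasure_eq_measure by (subst (asm) ennreal_le_iff) auto
qed

text \<open>Outside the union of the bad events of all layers n P is at most 1 throughout, and the
  entropy bound gives the constant 1 / ln 2 + 2. The failure probabilities are added up by the union
  bound, although the states of different layers are dependent.\<close>

theorem entanglement_bound:
  assumes n: "0 < n" and a: "a \<le> n" and L: "1 \<le> L"
    and small: "\<And>l. l \<in> {1..L} \<Longrightarrow> 4 * real n * rate ^ length (gate_positions n l) \<le> \<epsilon>"
  shows "P.prob {g \<in> space M. (SUP l\<in>{1..L}. operator_entanglement n a (state g l)) \<le> 1 / ln 2 + 2} \<ge> 1 - real L * \<epsilon>"
proof -
  let ?C = "1 / ln 2 + 2 :: real"
  let ?G = "{g \<in> space M. (SUP l\<in>{1..L}. operator_entanglement n a (state g l)) \<le> ?C}"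
  let ?B = "\<lambda>l. {g \<in> space M. hs_norm2 (state g l) \<ge> 1 / real n}"
  have hm: "(\<lambda>g. hs_norm2 (state g l)) \<in> borel_measurable M" if "l \<le> L" for l
    using that by (intro measurable_hs_norm2[where D = "2 ^ n"] measurable_state state_carrier) auto
  have B: "?B l \<in> sets M" if "l \<in> {1..L}" for l
  proof -
    have "(\<lambda>g. hs_norm2 (state g l)) \<in> borel_measurable M" using that by (intro hm) simp
    thus ?thesis by measurable
  qed
  \<comment> \<open>The index set of the supremum is finite, and nonempty because \<open>L\<close>
    is at least 1; so the supremum is controlled by the single values.\<close>
  have G: "?G = {g \<in> space M. \<forall>l\<in>{1..L}. operator_entanglement n a (state g l) \<le> ?C}"
    using L by (intro Collect_cong conj_cong refl cSUP_le_iff) auto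
  \<comment> \<open>Monotonicity of the measure asks for a measurable superset, so the good event
    itself has to be measurable.\<close>
  have "{g \<in> space M. operator_entanglement n a (state g l) \<le> ?C} \<in> sets M" if "l \<in> {1..L}" for l
  proof -
    have "(\<lambda>g. operator_entanglement n a (state g l)) \<in> borel_measurable M"
      using that by (intro measurable_entanglement[OF a]) simp
    thus ?thesis by measurable
  qed
  hence "{g \<in> space M. \<forall>l\<in>{1..L}. operator_entanglement n a (state g l) \<le> ?C} \<in> sets M"
    by (intro sets.sets_Collect_finite_All') (use L in auto)
  hence Gm: "?G \<in> sets M" unfolding G .
  have "space M - (\<Union>l\<in>{1..L}. ?B l) \<subseteq> ?G"
  proof
    fix g assume g: "g \<in> space M - (\<Union>l\<in>{1..L}. ?B l)"
    have "operator_entanglement n a (state g l) \<le> ?C" if l: "l \<in> {1..L}" for l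
    proof -
      have le: "operator_entanglement n a (state g l) \<le> 1 / ln 2 + 2 * real n * hs_norm2 (state g l)"
        using g l by (intro operator_entanglement_le[OF a] state_carrier) auto
      have "hs_norm2 (state g l) < 1 / real n" using g l by (auto simp: not_le)
      hence "real n * hs_norm2 (state g l) \<le> 1" using n by (simp add: field_simps)
      with le show ?thesis unfolding mult.assoc by linarith
    qed
    thus "g \<in> ?G" unfolding G using g by simp
  qed
  hence "P.prob (space M - (\<Union>l\<in>{1..L}. ?B l)) \<le> P.prob ?G" by (intro P.finite_measure_mono Gm)
  moreover have "P.prob (space M - (\<Union>l\<in>{1..L}. ?B l)) = 1 - P.prob (\<Union>l\<in>{1..L}. ?B l)"
    using B by (intro P.prob_compl) auto
  moreover have "P.prob (\<Union>l\<in>{1..L}. ?B l) \<le> (\<Sum>l\<in>{1..L}. P.prob (?B l))"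
    using B by (intro P.finite_measure_subadditive_finite) auto
  moreover have "(\<Sum>l\<in>{1..L}. P.prob (?B l)) \<le> (\<Sum>l\<in>{1..L}. \<epsilon>)"
    using purity_tail[OF _ _ n] small by (intro sum_mono) (meson atLeastAtMost_iff order_trans)
  ultimately show ?thesis by simp
qed

end

text \<open>From k \<ge> (n - 2) / 2 the decay is at least exp(- 2 \<kappa> (n - 2)). Half of this
  exponent is kept; the other half absorbs the factor 4 n and the shift by 2. This is why \<kappa>
  is a quarter of - ln s.\<close>

lemma exponential_rate:
  fixes r :: real
  assumes r: "0 \<le> r" "r < 1"
  obtains \<kappa> n0 where "\<kappa> > 0" "n0 > 0"
    "\<And>n k. n \<ge> n0 \<Longrightarrow> n \<le> 2 * k + 2 \<Longrightarrow> 4 * real n * r ^ k \<le> exp (- \<kappa> * real n)"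
proof -
  \<comment> \<open>A positive base, so that its logarithm gives a rate also when r = 0.\<close>
  define s where "s = max r (1 / 2)"
  have s: "0 < s" "s < 1" "r \<le> s" using r by (auto simp: s_def)
  define \<kappa> where "\<kappa> = - ln s / 4"
  have \<kappa>: "\<kappa> > 0" "ln s = - 4 * \<kappa>" using s by (auto simp: \<kappa>_def)
  have "eventually (\<lambda>n. 4 * real n * exp (- 2 * \<kappa> * (real n - 2)) \<le> exp (- \<kappa> * real n)) at_top"
    using \<kappa>(1) by real_asymp
  then obtain n0 where n0: "\<And>n. n \<ge> n0 \<Longrightarrow> 4 * real n * exp (- 2 * \<kappa> * (real n - 2)) \<le> exp (- \<kappa> * real n)"
    unfolding eventually_at_top_linorder by blast
  show thesis
  proof (rule that[of \<kappa> "Suc n0"])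
    fix n k assume n: "Suc n0 \<le> n" "n \<le> 2 * k + 2"
    have "r ^ k \<le> s ^ k" using r s by (intro power_mono)
    also have "s ^ k = exp (real k * ln s)" using s by (simp add: exp_of_nat_mult)
    also have "\<dots> = exp (- 4 * \<kappa> * real k)" by (simp add: \<kappa>(2))
    also have "\<dots> \<le> exp (- 2 * \<kappa> * (real n - 2))"
    proof -
      have "real n - 2 \<le> 2 * real k" using n(2) by linarith
      hence "\<kappa> * (real n - 2) \<le> \<kappa> * (2 * real k)" using \<kappa> by (intro mult_left_mono) auto
      thus ?thesis by simp
    qed
    finally have "4 * real n * r ^ k \<le> 4 * real n * exp (- 2 * \<kappa> * (real n - 2))" by (intro mult_left_mono) auto
    also have "\<dots> \<le> exp (- \<kappa> * real n)" using n by (intro n0) simp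
    finally show "4 * real n * r ^ k \<le> exp (- \<kappa> * real n)" .
  qed (use \<kappa> in auto)
qed

theorem theorem2:
  fixes N :: "complex mat \<Rightarrow> complex mat"
  assumes "qubit_channel N"
    and "contraction_coefficient N < 1 / 3"
  shows "\<exists>(C :: real) (\<kappa> :: real) (n0 :: nat). C > 0 \<and> \<kappa> > 0 \<and>
    (\<forall>n \<ge> n0. \<forall>L \<ge> 1. \<forall>(\<nu> :: complex mat measure) (\<rho>0 :: complex mat) (a :: nat).
       unitary_2_design 4 \<nu> \<longrightarrow> product_state n \<rho>0 \<longrightarrow> 1 \<le> a \<longrightarrow> a < n \<longrightarrow>
       measure (circuit_measure n L \<nu>)
         {g \<in> space (circuit_measure n L \<nu>).
            (SUP l \<in> {1..L}. operator_entanglement n a (circuit_state n N g \<rho>0 l)) \<le> C}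
       \<ge> 1 - real L * exp (- \<kappa> * real n))"
proof -
  note coeffs = pair_coeffs[OF assms]
  obtain \<kappa> n0 where \<kappa>: "\<kappa> > 0" and n0: "n0 > 0"
    and decay: "\<And>n k. n \<ge> n0 \<Longrightarrow> n \<le> 2 * k + 2 \<Longrightarrow>
      4 * real n * (pair_trace_coeff N + pair_norm_coeff N) ^ k \<le> exp (- \<kappa> * real n)"
    using exponential_rate[of "pair_trace_coeff N + pair_norm_coeff N"] coeffs by (metis add_nonneg_nonneg)
  show ?thesis
  \<comment> \<open>The entropy constant is the same for all admissible channels; \<kappa> and
    \<open>n0\<close> depend on \<open>N\<close> only through the sum of the two
    coefficients.\<close>
  proof (rule exI[of _ "1 / ln 2 + 2"], rule exI[of _ \<kappa>], rule exI[of _ n0], intro conjI allI impI \<kappa>)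
    show "0 < 1 / ln 2 + (2 :: real)" by (simp add: add_pos_pos)
    fix n L :: nat and \<nu> :: "complex mat measure" and \<rho>0 :: "complex mat" and a :: nat
    assume n: "n0 \<le> n" and L: "1 \<le> L" and des: "unitary_2_design 4 \<nu>" and \<rho>: "product_state n \<rho>0"
      and a: "1 \<le> a" "a < n"
    interpret brickwall_state N n L \<nu> \<rho>0 by unfold_locales (fact assms des \<rho>)+
    show "1 - real L * exp (- \<kappa> * real n) \<le> measure (circuit_measure n L \<nu>)
       {g \<in> space (circuit_measure n L \<nu>).
          (SUP l \<in> {1..L}. operator_entanglement n a (circuit_state n N g \<rho>0 l)) \<le> 1 / ln 2 + 2}"
      unfolding M_def[symmetric]
      by (rule entanglement_bound[OF _ _ L decay[OF n gate_count]]) (use a in auto)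
  qed
qed

end
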